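(* There is an adjunction $\mathsf{b}\Omega_{\mathsf{fin}}:\mathbf{BiTop}\leftrightarrows \mathbf{BiFrm_{fin}}^{op}:\mathsf{bpt}$ with $\mathsf{b}\Omega_{\mathsf{fin}}\dashv \mathsf{bpt}$, with unit $\psi$ and counit $\varphi$.
   Context: A biframe is a triple $\mathcal L=(L^+,L^-,L)$ of frames with injective frame maps $e_L^{\pm}:L^{\pm}\to L$ such that every element of $L$ (the main component) is a join of elements $e_L^+(x^+)\wedge e_L^-(x^-)$. A biframe map $(f^+,f^-):\mathcal L\to\mathcal M$ is a pair of frame maps $f^{\pm}:L^{\pm}\to M^{\pm}$ for which there is a (necessarily unique) frame map $f:L\to M$ with $f\circ e_L^{\pm}=e_M^{\pm}\circ f^{\pm}$. $\mathbf{BiFrm}$ is the category of biframes. A relation $R$ on a frame is treated as a set of inequalities: the quotient by $R$ is the universal frame quotient $q$ with $q(a)\le q(b)$ for all $(a,b)\in R$, and the congruence generated by $R$ is the kernel of $q$. For a biframe $\mathcal L$, $\mathsf{fin}(L)\subseteq L$ is the set of finite joins of elements $e_L^+(x^+)\wedge e_L^-(x^-)$; a congruence on $L$ is finitary if it is generated by some relation $R\subseteq \mathsf{fin}(L)\times\mathsf{fin}(L)$. Let $L^+\oplus L^-$ be the frame coproduct, with injections $\ulcorner - \urcorner$, and let $C_L$ be the kernel of the canonical surjection $L^+\oplus L^-\to L$. $\mathcal L$ is finitary if $C_L$ is a finitary congruence on $L^+\oplus L^-$ (the main component of $(L^+,L^-,L^+\oplus L^-)$). $\mathbf{BiFrm_{fin}}$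 is the full subcategory of finitary biframes. A bispace is a set $X$ with two topologies $\Omega^+(X),\Omega^-(X)$ (positive and negative opens); morphisms in $\mathbf{BiTop}$ are bicontinuous maps (continuous for both topologies). $\mathsf{bpt}(\mathcal L)$ is the bispace with point set the set of biframe maps $\mathcal L\to \mathbf 2=(2,2,2)$, with positive opens $\varphi^+_{\mathcal L}(a^+)=\{(f^+,f^-):f^+(a^+)=1\}$, $a^+\in L^+$, and negative opens $\varphi^-_{\mathcal L}(a^-)=\{(f^+,f^-):f^-(a^-)=1\}$, $a^-\in L^-$; on morphisms it acts by precomposition. $\mathsf{b}\Omega_{\mathsf{fin}}(X)=(\Omega^+(X),\Omega^-(X),\Omega_{\mathsf{fin}}(X))$, where $\Omega_{\mathsf{fin}}(X)$ is the quotient of $\Omega^+(X)\oplus\Omega^-(X)$ by the relation $\{(\ulcorner U^+\urcorner\wedge\ulcorner U^-\urcorner,\ulcorner V^+\urcorner\vee\ulcorner V^-\urcorner):U^+\cap U^-\subseteq V^+\cup V^-\}$; on a bicontinuous map $f$ it gives the pair of preimage maps $(f^{-1},f^{-1})$. $\psi_X:X\to\mathsf{bpt}(\mathsf{b}\Omega_{\mathsf{fin}}(X))$ sends $x$ to $(N_x^+,N_x^-)$, where $N_x^{\pm}(U)=1$ iff $x\in U$. $\varphi_{\mathcal L}=(\varphi^+_{\mathcal L},\varphi^-_{\mathcal L}):\mathcal L\to\mathsf{b}\Omega_{\mathsf{fin}}(\mathsf{bpt}(\mathcal L))$. *)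

theory Defs
  imports "HOL-Algebra.Complete_Lattice" "HOL-Analysis.Abstract_Topology"
begin

section \<open>Frames\<close>

locale frame = complete_lattice L for L :: "'a gorder" (structure) +
  assumes meet_Sup_distrib:
    "\<lbrakk>a \<in> carrier L; S \<subseteq> carrier L\<rbrakk> \<Longrightarrow> a \<sqinter> \<Squnion> S = \<Squnion> ((\<lambda>s. a \<sqinter> s) ` S)"

definition frame_map :: "'a gorder \<Rightarrow> 'b gorder \<Rightarrow> ('a \<Rightarrow> 'b) \<Rightarrow> bool" where
  "frame_map A B f \<longleftrightarrow>
     f \<in> carrier A \<rightarrow> carrier B \<and>
     f \<top>\<^bsub>A\<^esub> = \<top>\<^bsub>B\<^esub> \<and>
     (\<forall>a \<in> carrier A. \<forall>b \<in> carrier A. f (a \<sqinter>\<^bsub>A\<^esub> b) = f a \<sqinter>\<^bsub>B\<^esub> f b) \<and>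
     (\<forall>S. S \<subseteq> carrier A \<longrightarrow> f (\<Squnion>\<^bsub>A\<^esub> S) = \<Squnion>\<^bsub>B\<^esub> (f ` S))"

definition two_frame :: "bool gorder" where
  "two_frame = \<lparr>carrier = UNIV, eq = (=), le = (\<le>)\<rparr>"

definition opens_frame :: "'x topology \<Rightarrow> 'x set gorder" where
  "opens_frame T = \<lparr>carrier = {U. openin T U}, eq = (=), le = (\<subseteq>)\<rparr>"


section \<open>Congruences and quotients\<close>

definition frame_congruence :: "'a gorder \<Rightarrow> ('a \<times> 'a) set \<Rightarrow> bool" where
  "frame_congruence A \<theta> \<longleftrightarrow>
     equiv (carrier A) \<theta> \<and>
     (\<forall>(a, b) \<in> \<theta>. \<forall>(c, d) \<in> \<theta>. (a \<sqinter>\<^bsub>A\<^esub> c, b \<sqinter>\<^bsub>A\<^esub> d) \<in> \<theta>) \<and>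
     (\<forall>S. S \<subseteq> \<theta> \<longrightarrow> (\<Squnion>\<^bsub>A\<^esub> (fst ` S), \<Squnion>\<^bsub>A\<^esub> (snd ` S)) \<in> \<theta>)"

definition frame_kernel :: "'a gorder \<Rightarrow> ('a \<Rightarrow> 'b) \<Rightarrow> ('a \<times> 'a) set" where
  "frame_kernel A f = {(a, b). a \<in> carrier A \<and> b \<in> carrier A \<and> f a = f b}"

text \<open>A relation \<open>R\<close> is read as a set of inequalities: \<open>(a, b) \<in> R\<close> imposes \<open>a \<sqinter> b = a\<close>
  in the quotient. The least congruence imposing \<open>R\<close> is the kernel of the universal frame quotient
  by \<open>R\<close>, which is therefore the frame of its classes.\<close>

definition generated_congruence :: "'a gorder \<Rightarrow> ('a \<times> 'a) set \<Rightarrow> ('a \<times> 'a) set" where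
  "generated_congruence A R =
     \<Inter> {\<theta>. frame_congruence A \<theta> \<and> (\<forall>(a, b) \<in> R. (a \<sqinter>\<^bsub>A\<^esub> b, a) \<in> \<theta>)}"

definition quotient_map :: "'a gorder \<Rightarrow> ('a \<times> 'a) set \<Rightarrow> 'a \<Rightarrow> 'a set" where
  "quotient_map A R a = generated_congruence A R `` {a}"

definition quotient_frame :: "'a gorder \<Rightarrow> ('a \<times> 'a) set \<Rightarrow> 'a set gorder" where
  "quotient_frame A R =
     \<lparr>carrier = carrier A // generated_congruence A R,
      eq = (=),
      le = (\<lambda>P Q. \<exists>a \<in> P. \<exists>b \<in> Q. (a \<sqinter>\<^bsub>A\<^esub> b, a) \<in> generated_congruence A R)\<rparr>"


section \<open>Binary coproducts\<close>

text \<open>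
  The coproduct of \<open>A\<close> and \<open>B\<close> is realised as the frame of \<open>C\<close>-ideals: the down-sets of
  \<open>A \<times> B\<close> closed under joins in each coordinate. Since empty joins are included, every
  \<open>C\<close>-ideal contains all \<open>(\<bottom>, b)\<close> and \<open>(a, \<bottom>)\<close>.
\<close>

definition C_ideal :: "'a gorder \<Rightarrow> 'b gorder \<Rightarrow> ('a \<times> 'b) set \<Rightarrow> bool" where
  "C_ideal A B I \<longleftrightarrow>
     I \<subseteq> carrier A \<times> carrier B \<and>
     (\<forall>(a, b) \<in> I. \<forall>a' \<in> carrier A. \<forall>b' \<in> carrier B.
        a' \<sqsubseteq>\<^bsub>A\<^esub> a \<longrightarrow> b' \<sqsubseteq>\<^bsub>B\<^esub> b \<longrightarrow> (a', b') \<in> I) \<and>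
     (\<forall>S b. S \<subseteq> carrier A \<longrightarrow> b \<in> carrier B \<longrightarrow> S \<times> {b} \<subseteq> I \<longrightarrow> (\<Squnion>\<^bsub>A\<^esub> S, b) \<in> I) \<and>
     (\<forall>a T. a \<in> carrier A \<longrightarrow> T \<subseteq> carrier B \<longrightarrow> {a} \<times> T \<subseteq> I \<longrightarrow> (a, \<Squnion>\<^bsub>B\<^esub> T) \<in> I)"

definition coproduct_frame :: "'a gorder \<Rightarrow> 'b gorder \<Rightarrow> ('a \<times> 'b) set gorder" where
  "coproduct_frame A B = \<lparr>carrier = {I. C_ideal A B I}, eq = (=), le = (\<subseteq>)\<rparr>"

definition coproduct_inl :: "'a gorder \<Rightarrow> 'b gorder \<Rightarrow> 'a \<Rightarrow> ('a \<times> 'b) set" where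
  "coproduct_inl A B a = \<Inter> {I. C_ideal A B I \<and> (a, \<top>\<^bsub>B\<^esub>) \<in> I}"

definition coproduct_inr :: "'a gorder \<Rightarrow> 'b gorder \<Rightarrow> 'b \<Rightarrow> ('a \<times> 'b) set" where
  "coproduct_inr A B b = \<Inter> {I. C_ideal A B I \<and> (\<top>\<^bsub>A\<^esub>, b) \<in> I}"

text \<open>Each \<open>C\<close>-ideal is the join of the \<open>inl a \<sqinter> inr b\<close> with \<open>(a, b)\<close> in it, so this is the only
  candidate for a frame map out of the coproduct restricting to \<open>f\<close> and \<open>g\<close>.\<close>

definition copairing :: "'c gorder \<Rightarrow> ('a \<Rightarrow> 'c) \<Rightarrow> ('b \<Rightarrow> 'c) \<Rightarrow> ('a \<times> 'b) set \<Rightarrow> 'c" where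
  "copairing C f g I = \<Squnion>\<^bsub>C\<^esub> {f a \<sqinter>\<^bsub>C\<^esub> g b | a b. (a, b) \<in> I}"


section \<open>Biframes\<close>

record ('p, 'n, 'm) biframe =
  pos_part :: "'p gorder"
  neg_part :: "'n gorder"
  main_part :: "'m gorder"
  pos_emb :: "'p \<Rightarrow> 'm"
  neg_emb :: "'n \<Rightarrow> 'm"

definition rectangles :: "('p, 'n, 'm) biframe \<Rightarrow> 'm set" where
  "rectangles L = {pos_emb L a \<sqinter>\<^bsub>main_part L\<^esub> neg_emb L b | a b.
                     a \<in> carrier (pos_part L) \<and> b \<in> carrier (neg_part L)}"

definition BiFrm :: "('p, 'n, 'm) biframe set" where
  "BiFrm = {L.
     frame (pos_part L) \<and> frame (neg_part L) \<and> frame (main_part L) \<and>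
     frame_map (pos_part L) (main_part L) (pos_emb L) \<and> inj_on (pos_emb L) (carrier (pos_part L)) \<and>
     frame_map (neg_part L) (main_part L) (neg_emb L) \<and> inj_on (neg_emb L) (carrier (neg_part L)) \<and>
     (\<forall>x \<in> carrier (main_part L). \<exists>S. S \<subseteq> rectangles L \<and> x = \<Squnion>\<^bsub>main_part L\<^esub> S)}"

text \<open>
  Arrows are extensional functions on the carriers (\<open>undefined\<close> outside), so that equality
  of arrows is equality in HOL.
\<close>

definition biframe_hom ::
    "('p, 'n, 'm) biframe \<Rightarrow> ('q, 'o, 'k) biframe \<Rightarrow> (('p \<Rightarrow> 'q) \<times> ('n \<Rightarrow> 'o)) set" where
  "biframe_hom L M = {(fp, fn).
     fp \<in> extensional (carrier (pos_part L)) \<and> frame_map (pos_part L) (pos_part M) fp \<and>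
     fn \<in> extensional (carrier (neg_part L)) \<and> frame_map (neg_part L) (neg_part M) fn \<and>
     (\<exists>f. frame_map (main_part L) (main_part M) f \<and>
          (\<forall>a \<in> carrier (pos_part L). f (pos_emb L a) = pos_emb M (fp a)) \<and>
          (\<forall>b \<in> carrier (neg_part L). f (neg_emb L b) = neg_emb M (fn b)))}"

definition biframe_id :: "('p, 'n, 'm) biframe \<Rightarrow> ('p \<Rightarrow> 'p) \<times> ('n \<Rightarrow> 'n)" where
  "biframe_id L = (\<lambda>a \<in> carrier (pos_part L). a, \<lambda>b \<in> carrier (neg_part L). b)"

text \<open>\<open>biframe_comp L g f\<close> is \<open>g \<circ> f\<close>, where \<open>L\<close> is the domain of \<open>f\<close>.\<close>

definition biframe_comp :: "('p, 'n, 'm) biframe \<Rightarrow>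
    ('q \<Rightarrow> 'r) \<times> ('o \<Rightarrow> 's) \<Rightarrow> ('p \<Rightarrow> 'q) \<times> ('n \<Rightarrow> 'o) \<Rightarrow> ('p \<Rightarrow> 'r) \<times> ('n \<Rightarrow> 's)" where
  "biframe_comp L g f =
     (compose (carrier (pos_part L)) (fst g) (fst f),
      compose (carrier (neg_part L)) (snd g) (snd f))"

definition two_biframe :: "(bool, bool, bool) biframe" where
  "two_biframe =
     \<lparr>pos_part = two_frame, neg_part = two_frame, main_part = two_frame,
      pos_emb = id, neg_emb = id\<rparr>"

definition fin_elements :: "('p, 'n, 'm) biframe \<Rightarrow> 'm set" where
  "fin_elements L = {\<Squnion>\<^bsub>main_part L\<^esub> F | F. finite F \<and> F \<subseteq> rectangles L}"

definition finitary_congruence :: "('p, 'n, 'm) biframe \<Rightarrow> ('m \<times> 'm) set \<Rightarrow> bool" where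
  "finitary_congruence L \<theta> \<longleftrightarrow>
     (\<exists>R. R \<subseteq> fin_elements L \<times> fin_elements L \<and> \<theta> = generated_congruence (main_part L) R)"

definition coproduct_biframe :: "'p gorder \<Rightarrow> 'n gorder \<Rightarrow> ('p, 'n, ('p \<times> 'n) set) biframe" where
  "coproduct_biframe A B =
     \<lparr>pos_part = A, neg_part = B, main_part = coproduct_frame A B,
      pos_emb = coproduct_inl A B, neg_emb = coproduct_inr A B\<rparr>"

definition canonical_congruence ::
    "('p, 'n, 'm) biframe \<Rightarrow> (('p \<times> 'n) set \<times> ('p \<times> 'n) set) set" where
  "canonical_congruence L =
     frame_kernel (coproduct_frame (pos_part L) (neg_part L))
       (copairing (main_part L) (pos_emb L) (neg_emb L))"

definition BiFrm_fin :: "('p, 'n, 'm) biframe set" where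
  "BiFrm_fin = {L \<in> BiFrm.
     finitary_congruence (coproduct_biframe (pos_part L) (neg_part L)) (canonical_congruence L)}"


section \<open>Bispaces\<close>

record 'x bispace =
  pos_top :: "'x topology"
  neg_top :: "'x topology"

definition BiTop :: "'x bispace set" where
  "BiTop = {X. topspace (pos_top X) = topspace (neg_top X)}"

definition points :: "'x bispace \<Rightarrow> 'x set" where
  "points X = topspace (pos_top X)"

definition bitop_hom :: "'x bispace \<Rightarrow> 'y bispace \<Rightarrow> ('x \<Rightarrow> 'y) set" where
  "bitop_hom X Y = {f \<in> extensional (points X).
     continuous_map (pos_top X) (pos_top Y) f \<and> continuous_map (neg_top X) (neg_top Y) f}"

definition bitop_id :: "'x bispace \<Rightarrow> 'x \<Rightarrow> 'x" where
  "bitop_id X = (\<lambda>x \<in> points X. x)"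

definition bitop_comp :: "'x bispace \<Rightarrow> ('y \<Rightarrow> 'z) \<Rightarrow> ('x \<Rightarrow> 'y) \<Rightarrow> 'x \<Rightarrow> 'z" where
  "bitop_comp X g f = compose (points X) g f"


section \<open>The functor from biframes to bispaces\<close>

definition bpoints :: "('p, 'n, 'm) biframe \<Rightarrow> (('p \<Rightarrow> bool) \<times> ('n \<Rightarrow> bool)) set" where
  "bpoints L = biframe_hom L two_biframe"

definition phi_pos :: "('p, 'n, 'm) biframe \<Rightarrow> 'p \<Rightarrow> (('p \<Rightarrow> bool) \<times> ('n \<Rightarrow> bool)) set" where
  "phi_pos L = (\<lambda>a \<in> carrier (pos_part L). {(fp, fn) \<in> bpoints L. fp a})"

definition phi_neg :: "('p, 'n, 'm) biframe \<Rightarrow> 'n \<Rightarrow> (('p \<Rightarrow> bool) \<times> ('n \<Rightarrow> bool)) set" where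
  "phi_neg L = (\<lambda>b \<in> carrier (neg_part L). {(fp, fn) \<in> bpoints L. fn b})"

text \<open>The sets \<open>phi_pos L a\<close> form a topology when \<open>L\<close> is a biframe, likewise \<open>phi_neg L b\<close>;
  only then is \<open>topology\<close> meaningful.\<close>

definition bpt :: "('p, 'n, 'm) biframe \<Rightarrow> (('p \<Rightarrow> bool) \<times> ('n \<Rightarrow> bool)) bispace" where
  "bpt L =
     \<lparr>pos_top = topology (\<lambda>U. U \<in> phi_pos L ` carrier (pos_part L)),
      neg_top = topology (\<lambda>U. U \<in> phi_neg L ` carrier (neg_part L))\<rparr>"

definition bpt_map :: "('p, 'n, 'm) biframe \<Rightarrow> ('q, 'o, 'k) biframe \<Rightarrow>
    ('p \<Rightarrow> 'q) \<times> ('n \<Rightarrow> 'o) \<Rightarrow>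
    ('q \<Rightarrow> bool) \<times> ('o \<Rightarrow> bool) \<Rightarrow> ('p \<Rightarrow> bool) \<times> ('n \<Rightarrow> bool)" where
  "bpt_map L M g = (\<lambda>h \<in> bpoints M. biframe_comp L h g)"


section \<open>The functor from bispaces to finitary biframes\<close>

definition Omega_fin_coproduct :: "'x bispace \<Rightarrow> ('x set \<times> 'x set) set gorder" where
  "Omega_fin_coproduct X = coproduct_frame (opens_frame (pos_top X)) (opens_frame (neg_top X))"

definition open_inl :: "'x bispace \<Rightarrow> 'x set \<Rightarrow> ('x set \<times> 'x set) set" where
  "open_inl X = coproduct_inl (opens_frame (pos_top X)) (opens_frame (neg_top X))"

definition open_inr :: "'x bispace \<Rightarrow> 'x set \<Rightarrow> ('x set \<times> 'x set) set" where
  "open_inr X = coproduct_inr (opens_frame (pos_top X)) (opens_frame (neg_top X))"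

definition Omega_fin_rel ::
    "'x bispace \<Rightarrow> (('x set \<times> 'x set) set \<times> ('x set \<times> 'x set) set) set" where
  "Omega_fin_rel X =
     {(open_inl X U \<sqinter>\<^bsub>Omega_fin_coproduct X\<^esub> open_inr X U',
       open_inl X V \<squnion>\<^bsub>Omega_fin_coproduct X\<^esub> open_inr X V') | U U' V V'.
        openin (pos_top X) U \<and> openin (neg_top X) U' \<and>
        openin (pos_top X) V \<and> openin (neg_top X) V' \<and> U \<inter> U' \<subseteq> V \<union> V'}"

definition bOmega_fin ::
    "'x bispace \<Rightarrow> ('x set, 'x set, ('x set \<times> 'x set) set set) biframe" where
  "bOmega_fin X =
     \<lparr>pos_part = opens_frame (pos_top X),
      neg_part = opens_frame (neg_top X),
      main_part = quotient_frame (Omega_fin_coproduct X) (Omega_fin_rel X),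
      pos_emb = (\<lambda>U. quotient_map (Omega_fin_coproduct X) (Omega_fin_rel X) (open_inl X U)),
      neg_emb = (\<lambda>U. quotient_map (Omega_fin_coproduct X) (Omega_fin_rel X) (open_inr X U))\<rparr>"

definition bOmega_fin_map :: "'x bispace \<Rightarrow> 'y bispace \<Rightarrow> ('x \<Rightarrow> 'y) \<Rightarrow>
    ('y set \<Rightarrow> 'x set) \<times> ('y set \<Rightarrow> 'x set)" where
  "bOmega_fin_map X Y f =
     (\<lambda>U \<in> {U. openin (pos_top Y) U}. {x \<in> points X. f x \<in> U},
      \<lambda>U \<in> {U. openin (neg_top Y) U}. {x \<in> points X. f x \<in> U})"


section \<open>Unit and counit\<close>

definition psi :: "'x bispace \<Rightarrow> 'x \<Rightarrow> ('x set \<Rightarrow> bool) \<times> ('x set \<Rightarrow> bool)" where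
  "psi X = (\<lambda>x \<in> points X.
     (\<lambda>U \<in> {U. openin (pos_top X) U}. x \<in> U, \<lambda>U \<in> {U. openin (neg_top X) U}. x \<in> U))"

definition phi :: "('p, 'n, 'm) biframe \<Rightarrow>
    ('p \<Rightarrow> (('p \<Rightarrow> bool) \<times> ('n \<Rightarrow> bool)) set) \<times>
    ('n \<Rightarrow> (('p \<Rightarrow> bool) \<times> ('n \<Rightarrow> bool)) set)" where
  "phi L = (phi_pos L, phi_neg L)"

end

theory Submission
  imports Defs
begin

text \<open>
  The point of the adjunction is that the counit \<open>phi L\<close> is a biframe map for finitary \<open>L\<close>. An
  inequality \<open>r \<le> s\<close> between finite joins of rectangles reduces, by distributivity, to finitely many
  inequalities \<open>a \<sqinter> b \<le> u \<squnion> v\<close> with \<open>a, u\<close> positive and \<open>b, v\<close> negative. Hence a pair of frame maps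
  on the two parts of a finitary biframe extends to the main part as soon as it respects the
  inequalities of this simple shape. Under \<open>phi\<close> they become inclusions
  \<open>phi_pos L a \<inter> phi_neg L b \<subseteq> phi_pos L u \<union> phi_neg L v\<close>, which are exactly the relations imposed in
  \<open>Omega_fin\<close>. The same extension principle yields the action of \<open>bOmega_fin\<close> on morphisms, while
  evaluation at the points of a bispace shows that its opens embed into \<open>Omega_fin\<close>.
\<close>

section \<open>Frames and frame maps\<close>

text \<open>The reduction rests on one half of binary dual distributivity: \<open>z\<close> lies
  below \<open>w \<squnion> (p \<sqinter> q)\<close> as soon as it lies below
  \<open>w \<squnion> p\<close> and below \<open>w \<squnion> q\<close>. A rectangle on the right
  side can thus be traded for its positive or its negative factor, and these factors collect in a
  single positive and a single negative term because the embeddings preserve joins. For infinitely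
  many rectangles the same trade would require joins to distribute over infinite meets, a law that
  frames do not have. This is why the generating relations must compare finite joins.

  The main part of a finitary biframe is reached as a quotient of the coproduct of its two parts: a
  map out of it is first built as a copairing on \<open>C\<close>-ideals and then shown to identify
  whatever the canonical map identifies. Arrows record only their two parts. Once the main
  components are known to exist, functoriality, naturality and the triangle identities therefore
  become elementary statements about preimages of opens and about truth values of points.\<close>

lemma frameI:
  fixes A :: "'a gorder"
  assumes eq: "eq A = (=)"
    and refl: "\<And>x. x \<in> carrier A \<Longrightarrow> x \<sqsubseteq>\<^bsub>A\<^esub> x"
    and antisym: "\<And>x y. \<lbrakk>x \<in> carrier A; y \<in> carrier A; x \<sqsubseteq>\<^bsub>A\<^esub> y; y \<sqsubseteq>\<^bsub>A\<^esub> x\<rbrakk> \<Longrightarrow> x = y"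
    and trans: "\<And>x y z. \<lbrakk>x \<in> carrier A; y \<in> carrier A; z \<in> carrier A; x \<sqsubseteq>\<^bsub>A\<^esub> y; y \<sqsubseteq>\<^bsub>A\<^esub> z\<rbrakk>
      \<Longrightarrow> x \<sqsubseteq>\<^bsub>A\<^esub> z"
    and lub: "\<And>S. S \<subseteq> carrier A \<Longrightarrow> is_lub A (\<sigma> S) S"
    and distrib: "\<And>a S m z. \<lbrakk>a \<in> carrier A; S \<subseteq> carrier A; m \<in> carrier A; z \<in> carrier A;
      m \<sqsubseteq>\<^bsub>A\<^esub> a; m \<sqsubseteq>\<^bsub>A\<^esub> \<sigma> S;
      \<And>s y. \<lbrakk>s \<in> S; y \<in> carrier A; y \<sqsubseteq>\<^bsub>A\<^esub> a; y \<sqsubseteq>\<^bsub>A\<^esub> s\<rbrakk> \<Longrightarrow> y \<sqsubseteq>\<^bsub>A\<^esub> z\<rbrakk> \<Longrightarrow> m \<sqsubseteq>\<^bsub>A\<^esub> z"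
  shows "frame A"
proof -
  interpret A: partial_order A
    by unfold_locales (simp_all add: eq refl antisym, erule (4) trans)
  \<comment> \<open>Given all joins, the meet of \<open>S\<close> is the join of its lower bounds.
    Meets become available only through this step, which is why \<open>distrib\<close> is phrased
    with lower bounds \<open>m\<close> and \<open>y\<close> alone.\<close>
  have glb: "\<exists>i. is_glb A i S" if "S \<subseteq> carrier A" for S
  proof
    have "Lower A S \<subseteq> carrier A" by simp
    note l = lub[OF this]
    have "\<sigma> (Lower A S) \<sqsubseteq>\<^bsub>A\<^esub> y" if "y \<in> S" for y
      using l \<open>S \<subseteq> carrier A\<close> that by (intro least_le[OF l] Upper_memI) auto
    moreover have "x \<sqsubseteq>\<^bsub>A\<^esub> \<sigma> (Lower A S)" if "x \<in> Lower A S" for x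
      using least_mem[OF l] that by (rule Upper_memD[THEN conjunct1]) simp
    ultimately show "is_glb A (\<sigma> (Lower A S)) S"
      using least_closed[OF l] by (auto simp: greatest_def intro: Lower_memI)
  qed
  interpret A: complete_lattice A
    by unfold_locales (rule exI, erule lub, erule glb)
  have sup: "\<Squnion>\<^bsub>A\<^esub> S = \<sigma> S" if "S \<subseteq> carrier A" for S
    by (rule A.least_unique[OF A.sup_lub[OF that] lub[OF that]])
  show ?thesis
  proof
    fix a S
    assume a: "a \<in> carrier A" and S: "S \<subseteq> carrier A"
    then have S': "(\<lambda>s. a \<sqinter>\<^bsub>A\<^esub> s) ` S \<subseteq> carrier A" by auto
    show "a \<sqinter>\<^bsub>A\<^esub> \<Squnion>\<^bsub>A\<^esub> S = \<Squnion>\<^bsub>A\<^esub> ((\<lambda>s. a \<sqinter>\<^bsub>A\<^esub> s) ` S)"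
    proof (rule A.le_antisym)
      show "a \<sqinter>\<^bsub>A\<^esub> \<Squnion>\<^bsub>A\<^esub> S \<sqsubseteq>\<^bsub>A\<^esub> \<Squnion>\<^bsub>A\<^esub> ((\<lambda>s. a \<sqinter>\<^bsub>A\<^esub> s) ` S)"
      \<comment> \<open>Here \<open>m\<close> is the meet on the left and \<open>z\<close> the join
        of all \<open>a \<sqinter> s\<close>: a common lower bound of \<open>a\<close> and
        \<open>s\<close> lies below \<open>a \<sqinter> s\<close>, hence below
        \<open>z\<close>.\<close>
      proof (rule distrib[OF a S])
        show "a \<sqinter>\<^bsub>A\<^esub> \<Squnion>\<^bsub>A\<^esub> S \<sqsubseteq>\<^bsub>A\<^esub> \<sigma> S"
          using A.meet_right[OF a A.sup_closed[OF S]] sup[OF S] by simp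
        fix s y
        assume "s \<in> S" "y \<in> carrier A" "y \<sqsubseteq>\<^bsub>A\<^esub> a" "y \<sqsubseteq>\<^bsub>A\<^esub> s"
        then have "y \<sqsubseteq>\<^bsub>A\<^esub> a \<sqinter>\<^bsub>A\<^esub> s" using a S by (auto intro: A.meet_le)
        moreover have "a \<sqinter>\<^bsub>A\<^esub> s \<in> carrier A" using a S \<open>s \<in> S\<close> by auto
        moreover have "a \<sqinter>\<^bsub>A\<^esub> s \<sqsubseteq>\<^bsub>A\<^esub> \<Squnion>\<^bsub>A\<^esub> ((\<lambda>s. a \<sqinter>\<^bsub>A\<^esub> s) ` S)"
          using \<open>s \<in> S\<close> by (intro A.sup_upper[OF S']) auto
        ultimately show "y \<sqsubseteq>\<^bsub>A\<^esub> \<Squnion>\<^bsub>A\<^esub> ((\<lambda>s. a \<sqinter>\<^bsub>A\<^esub> s) ` S)"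
          using \<open>y \<in> carrier A\<close> A.sup_closed[OF S'] by (meson A.le_trans)
      qed (use a S S' in \<open>auto intro: A.meet_left\<close>)
      show "\<Squnion>\<^bsub>A\<^esub> ((\<lambda>s. a \<sqinter>\<^bsub>A\<^esub> s) ` S) \<sqsubseteq>\<^bsub>A\<^esub> a \<sqinter>\<^bsub>A\<^esub> \<Squnion>\<^bsub>A\<^esub> S"
      proof (rule A.sup_least[OF S'])
        fix x assume "x \<in> (\<lambda>s. a \<sqinter>\<^bsub>A\<^esub> s) ` S"
        then obtain s where s: "s \<in> S" "x = a \<sqinter>\<^bsub>A\<^esub> s" by blast
        then have sc: "s \<in> carrier A" using S by blast
        have "x \<sqsubseteq>\<^bsub>A\<^esub> \<Squnion>\<^bsub>A\<^esub> S"
          unfolding s(2)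
          using A.meet_right[OF a sc] A.sup_upper[OF S s(1)] A.meet_closed[OF a sc]
            A.sup_closed[OF S] sc
          by (meson A.le_trans)
        then show "x \<sqsubseteq>\<^bsub>A\<^esub> a \<sqinter>\<^bsub>A\<^esub> \<Squnion>\<^bsub>A\<^esub> S"
          using s sc a S by (auto intro: A.meet_le A.meet_left)
      qed (use a S in auto)
    qed (use a S S' in auto)
  qed
qed

context frame
begin

lemma Sup_eqI:
  assumes "x \<in> carrier L" "S \<subseteq> carrier L" "\<And>s. s \<in> S \<Longrightarrow> s \<sqsubseteq> x"
    and "\<And>y. \<lbrakk>y \<in> carrier L; \<And>s. s \<in> S \<Longrightarrow> s \<sqsubseteq> y\<rbrakk> \<Longrightarrow> x \<sqsubseteq> y"
  shows "\<Squnion> S = x"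
  using assms by (intro le_antisym sup_least assms sup_closed sup_upper)

lemma meet_eqI:
  assumes "x \<in> carrier L" "a \<in> carrier L" "b \<in> carrier L" "x \<sqsubseteq> a" "x \<sqsubseteq> b"
    and "\<And>y. \<lbrakk>y \<in> carrier L; y \<sqsubseteq> a; y \<sqsubseteq> b\<rbrakk> \<Longrightarrow> y \<sqsubseteq> x"
  shows "a \<sqinter> b = x"
  using assms by (intro le_antisym meet_le assms meet_closed meet_left meet_right)

lemma top_eqI: "\<lbrakk>x \<in> carrier L; \<And>y. y \<in> carrier L \<Longrightarrow> y \<sqsubseteq> x\<rbrakk> \<Longrightarrow> \<top> = x"
  by (simp add: le_antisym top_higher)

lemma Sup_empty: "\<Squnion> {} = \<bottom>"
  using weak_sup_empty by (simp add: eq_is_equal)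

lemma meet_idem: "a \<in> carrier L \<Longrightarrow> a \<sqinter> a = a"
  by (rule meet_eqI) auto

lemma meet_absorb: "\<lbrakk>a \<in> carrier L; b \<in> carrier L; a \<sqsubseteq> b\<rbrakk> \<Longrightarrow> a \<sqinter> b = a"
  by (rule meet_eqI) auto

lemma meet_top: "a \<in> carrier L \<Longrightarrow> a \<sqinter> \<top> = a"
  by (rule meet_absorb) (auto simp: top_higher)

lemma top_meet_eq: "a \<in> carrier L \<Longrightarrow> \<top> \<sqinter> a = a"
  by (metis meet_comm meet_top)

lemma meet_mono:
  assumes "a \<in> carrier L" "b \<in> carrier L" "c \<in> carrier L" "d \<in> carrier L" "a \<sqsubseteq> c" "b \<sqsubseteq> d"
  shows "a \<sqinter> b \<sqsubseteq> c \<sqinter> d"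
proof (rule meet_le)
  show "a \<sqinter> b \<sqsubseteq> c" by (rule le_trans[OF meet_left assms(5)]) (simp_all add: assms)
  show "a \<sqinter> b \<sqsubseteq> d" by (rule le_trans[OF meet_right assms(6)]) (simp_all add: assms)
qed (simp_all add: assms)

lemma join_mono:
  assumes "a \<in> carrier L" "b \<in> carrier L" "c \<in> carrier L" "d \<in> carrier L" "a \<sqsubseteq> c" "b \<sqsubseteq> d"
  shows "a \<squnion> b \<sqsubseteq> c \<squnion> d"
proof (rule join_le)
  show "a \<sqsubseteq> c \<squnion> d" by (rule le_trans[OF assms(5) join_left]) (simp_all add: assms)
  show "b \<sqsubseteq> c \<squnion> d" by (rule le_trans[OF assms(6) join_right]) (simp_all add: assms)
qed (simp_all add: assms)

lemma Sup_insert: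
  assumes "a \<in> carrier L" "S \<subseteq> carrier L"
  shows "\<Squnion> (insert a S) = a \<squnion> \<Squnion> S"
  using weak_sup_insert[OF assms] by (simp add: eq_is_equal)

lemma Sup_meet_distrib:
  assumes "a \<in> carrier L" "S \<subseteq> carrier L"
  shows "\<Squnion> S \<sqinter> a = \<Squnion> ((\<lambda>s. s \<sqinter> a) ` S)"
  using meet_Sup_distrib[OF assms] by (simp add: meet_comm)

lemma meet_join_distrib:
  assumes "a \<in> carrier L" "b \<in> carrier L" "c \<in> carrier L"
  shows "a \<sqinter> (b \<squnion> c) = (a \<sqinter> b) \<squnion> (a \<sqinter> c)"
  using meet_Sup_distrib[of a "{b, c}"] assms by (simp add: join_def)

lemma join_left_commute:
  assumes "a \<in> carrier L" "b \<in> carrier L" "c \<in> carrier L"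
  shows "a \<squnion> (b \<squnion> c) = b \<squnion> (a \<squnion> c)"
  using assms by (simp add: join_assoc[symmetric] join_comm[of _ a b])

text \<open>The three shapes arise in the induction of \<open>finite_join_le_transfer\<close>:
  \<open>p\<close> has been absorbed by the positive term, by the negative term, or by the join of
  the remaining rectangles. The common right side isolates \<open>p\<close> for
  \<open>le_join_meetI\<close>.\<close>

lemma join_rearrange:
  assumes "a \<in> carrier L" "b \<in> carrier L" "p \<in> carrier L" "y \<in> carrier L"
  shows "((a \<squnion> p) \<squnion> b) \<squnion> y = ((a \<squnion> b) \<squnion> y) \<squnion> p"
    and "(a \<squnion> (b \<squnion> p)) \<squnion> y = ((a \<squnion> b) \<squnion> y) \<squnion> p"
    and "(a \<squnion> b) \<squnion> (p \<squnion> y) = ((a \<squnion> b) \<squnion> y) \<squnion> p"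
  using assms by (simp_all add: join_assoc join_left_commute join_comm[of L])

lemma meet_interchange:
  assumes "a \<in> carrier L" "b \<in> carrier L" "c \<in> carrier L" "d \<in> carrier L"
  shows "(a \<sqinter> b) \<sqinter> (c \<sqinter> d) = (a \<sqinter> c) \<sqinter> (b \<sqinter> d)"
proof -
  have "b \<sqinter> (c \<sqinter> d) = c \<sqinter> (b \<sqinter> d)"
    using assms by (simp add: meet_assoc[symmetric] meet_comm[of _ b c])
  then show ?thesis using assms by (simp add: meet_assoc)
qed

text \<open>Distributivity applied once in each argument. It reduces preservation of meets by the
  copairing to meets of two rectangles.\<close>

lemma Sup_meet_Sup_le:
  assumes X: "X \<subseteq> carrier L" and Y: "Y \<subseteq> carrier L" and z: "z \<in> carrier L"
    and le: "\<And>x y. \<lbrakk>x \<in> X; y \<in> Y\<rbrakk> \<Longrightarrow> x \<sqinter> y \<sqsubseteq> z"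
  shows "\<Squnion> X \<sqinter> \<Squnion> Y \<sqsubseteq> z"
proof -
  have "\<Squnion> X \<sqinter> y \<sqsubseteq> z" if "y \<in> Y" for y
  proof -
    have y: "y \<in> carrier L" using that Y by auto
    show ?thesis
      unfolding Sup_meet_distrib[OF y X] using X y z le that by (intro sup_least) auto
  qed
  then show ?thesis
    unfolding meet_Sup_distrib[OF sup_closed[OF X] Y] using X Y z by (intro sup_least) auto
qed

text \<open>By distributivity \<open>z = (z \<sqinter> w) \<squnion> (z \<sqinter> p)\<close>. The
  first piece lies below \<open>w\<close>, the second below \<open>(w \<squnion> q) \<sqinter> p =
  (p \<sqinter> w) \<squnion> (p \<sqinter> q)\<close>. This lets a rectangle on the right of an
  inequality be tested through its two factors.\<close>

lemma le_join_meetI: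
  assumes c [simp]: "z \<in> carrier L" "w \<in> carrier L" "p \<in> carrier L" "q \<in> carrier L"
    and p: "z \<sqsubseteq> w \<squnion> p" and q: "z \<sqsubseteq> w \<squnion> q"
  shows "z \<sqsubseteq> w \<squnion> (p \<sqinter> q)"
proof -
  have w: "x \<sqinter> w \<sqsubseteq> w \<squnion> (p \<sqinter> q)" if "x \<in> carrier L" for x
    using that by (intro le_trans[OF meet_right join_left]) auto
  have "z \<sqinter> p \<sqsubseteq> (w \<squnion> q) \<sqinter> p"
    using q by (intro meet_mono) auto
  also have "(w \<squnion> q) \<sqinter> p = (p \<sqinter> w) \<squnion> (p \<sqinter> q)"
    by (metis meet_comm meet_join_distrib c(2-4))
  also have "\<dots> \<sqsubseteq> w \<squnion> (p \<sqinter> q)"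
    by (rule join_le) (auto simp: w join_right)
  finally have zp: "z \<sqinter> p \<sqsubseteq> w \<squnion> (p \<sqinter> q)" by simp
  have "z = (z \<sqinter> w) \<squnion> (z \<sqinter> p)"
    using p meet_absorb[of z "w \<squnion> p"] meet_join_distrib[of z w p] by simp
  moreover have "\<dots> \<sqsubseteq> w \<squnion> (p \<sqinter> q)"
    by (rule join_le) (auto simp: w zp)
  ultimately show ?thesis by simp
qed

lemma le_iff_meet_eq:
  "\<lbrakk>a \<in> carrier L; b \<in> carrier L\<rbrakk> \<Longrightarrow> a \<sqsubseteq> b \<longleftrightarrow> a \<sqinter> b = a"
  using le_iff_join by metis

end

lemma frame_map_closed: "\<lbrakk>frame_map A B f; a \<in> carrier A\<rbrakk> \<Longrightarrow> f a \<in> carrier B"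
  by (auto simp: frame_map_def)

lemma frame_map_image: "\<lbrakk>frame_map A B f; S \<subseteq> carrier A\<rbrakk> \<Longrightarrow> f ` S \<subseteq> carrier B"
  by (auto simp: frame_map_def)

lemma frame_map_top: "frame_map A B f \<Longrightarrow> f \<top>\<^bsub>A\<^esub> = \<top>\<^bsub>B\<^esub>"
  by (simp add: frame_map_def)

lemma frame_map_meet:
  "\<lbrakk>frame_map A B f; a \<in> carrier A; b \<in> carrier A\<rbrakk> \<Longrightarrow> f (a \<sqinter>\<^bsub>A\<^esub> b) = f a \<sqinter>\<^bsub>B\<^esub> f b"
  by (simp add: frame_map_def)

lemma frame_map_Sup:
  "\<lbrakk>frame_map A B f; S \<subseteq> carrier A\<rbrakk> \<Longrightarrow> f (\<Squnion>\<^bsub>A\<^esub> S) = \<Squnion>\<^bsub>B\<^esub> (f ` S)"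
  by (simp add: frame_map_def)

lemma frame_map_join:
  "\<lbrakk>frame_map A B f; a \<in> carrier A; b \<in> carrier A\<rbrakk> \<Longrightarrow> f (a \<squnion>\<^bsub>A\<^esub> b) = f a \<squnion>\<^bsub>B\<^esub> f b"
  unfolding join_def by (simp add: frame_map_Sup)

lemma frame_map_mono:
  assumes "frame A" "frame B" "frame_map A B f" "a \<in> carrier A" "b \<in> carrier A" "a \<sqsubseteq>\<^bsub>A\<^esub> b"
  shows "f a \<sqsubseteq>\<^bsub>B\<^esub> f b"
  using assms frame_map_meet[OF assms(3-5)]
  by (simp add: frame.le_iff_meet_eq frame_map_closed)

lemma frame_map_bottom:
  assumes "frame A" "frame B" "frame_map A B f"
  shows "f \<bottom>\<^bsub>A\<^esub> = \<bottom>\<^bsub>B\<^esub>"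
  using frame_map_Sup[OF assms(3), of "{}"] frame.Sup_empty[OF assms(1)] frame.Sup_empty[OF assms(2)]
  by simp

lemma frame_map_comp:
  assumes "frame_map A B f" "frame_map B C g"
  shows "frame_map A C (\<lambda>x. g (f x))"
  using assms frame_map_image[OF assms(1)]
  by (simp add: frame_map_def Pi_iff image_image)

lemma frame_map_cong:
  assumes "frame A" "\<And>a. a \<in> carrier A \<Longrightarrow> f a = g a"
  shows "frame_map A B f \<longleftrightarrow> frame_map A B g"
proof -
  interpret A: frame A by fact
  have "f ` S = g ` S" if "S \<subseteq> carrier A" for S
    using assms(2) that by (auto intro!: image_cong)
  then show ?thesis
    using assms(2) by (simp add: frame_map_def Pi_iff)
qed

text \<open>The map is \<open>h\<close> after a section \<open>i\<close> of \<open>c\<close>. The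
  section need not preserve any operation, but \<open>c\<close> sends the operation on chosen
  preimages to the right element, and by \<open>ker\<close> the choice is invisible to
  \<open>h\<close>.\<close>

lemma frame_map_factor:
  assumes A: "frame A"
    and c: "frame_map A M c" "c ` carrier A = carrier M"
    and h: "frame_map A N h"
    and ker: "\<And>x y. \<lbrakk>x \<in> carrier A; y \<in> carrier A; c x = c y\<rbrakk> \<Longrightarrow> h x = h y"
  obtains k where "frame_map M N k" "\<And>x. x \<in> carrier A \<Longrightarrow> k (c x) = h x"
proof -
  interpret A: frame A by fact
  define i where "i = inv_into (carrier A) c"
  define k where "k = (\<lambda>y. h (i y))"
  have i: "i y \<in> carrier A" "c (i y) = y" if "y \<in> carrier M" for y
    using that c(2) unfolding i_def by (auto simp: inv_into_into f_inv_into_f)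
  have kc: "k (c x) = h x" if "x \<in> carrier A" for x
    unfolding k_def by (rule ker) (use that i frame_map_closed[OF c(1)] in auto)
  have "frame_map M N k"
    unfolding frame_map_def
  proof (intro conjI ballI allI impI)
    show "k \<in> carrier M \<rightarrow> carrier N"
      unfolding k_def using i frame_map_closed[OF h] by auto
    show "k \<top>\<^bsub>M\<^esub> = \<top>\<^bsub>N\<^esub>"
      using kc[of "\<top>\<^bsub>A\<^esub>"] frame_map_top[OF c(1)] frame_map_top[OF h] by simp
  next
    fix x y assume xy: "x \<in> carrier M" "y \<in> carrier M"
    have "x \<sqinter>\<^bsub>M\<^esub> y = c (i x \<sqinter>\<^bsub>A\<^esub> i y)"
      using i xy by (simp add: frame_map_meet[OF c(1)])
    then have "k (x \<sqinter>\<^bsub>M\<^esub> y) = h (i x \<sqinter>\<^bsub>A\<^esub> i y)"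
      using kc i xy by simp
    then show "k (x \<sqinter>\<^bsub>M\<^esub> y) = k x \<sqinter>\<^bsub>N\<^esub> k y"
      using i xy by (simp add: frame_map_meet[OF h] k_def)
  next
    fix S assume S: "S \<subseteq> carrier M"
    have iS: "i ` S \<subseteq> carrier A" using i S by auto
    have "c ` i ` S = S" using i S by force
    then have "\<Squnion>\<^bsub>M\<^esub> S = c (\<Squnion>\<^bsub>A\<^esub> (i ` S))" by (simp add: frame_map_Sup[OF c(1) iS])
    then have "k (\<Squnion>\<^bsub>M\<^esub> S) = h (\<Squnion>\<^bsub>A\<^esub> (i ` S))" using kc iS by simp
    then show "k (\<Squnion>\<^bsub>M\<^esub> S) = \<Squnion>\<^bsub>N\<^esub> (k ` S)"
      by (simp add: frame_map_Sup[OF h iS] k_def image_image)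
  qed
  then show ?thesis using that kc by blast
qed

section \<open>Two concrete frames: open sets and truth values\<close>

lemma opens_frame_simps [simp]:
  "carrier (opens_frame T) = {U. openin T U}"
  "le (opens_frame T) = (\<subseteq>)"
  "eq (opens_frame T) = (=)"
  by (simp_all add: opens_frame_def)

lemma opens_frame: "frame (opens_frame T)"
proof (rule frameI[where \<sigma> = "\<Union>"])
  fix S assume "S \<subseteq> carrier (opens_frame T)"
  then show "is_lub (opens_frame T) (\<Union> S) S"
    by (auto simp: least_def Upper_def)
next
  fix a S m z
  assume *: "a \<in> carrier (opens_frame T)" "S \<subseteq> carrier (opens_frame T)"
    "m \<sqsubseteq>\<^bsub>opens_frame T\<^esub> a" "m \<sqsubseteq>\<^bsub>opens_frame T\<^esub> \<Union> S"
    and z: "\<And>s y. \<lbrakk>s \<in> S; y \<in> carrier (opens_frame T); y \<sqsubseteq>\<^bsub>opens_frame T\<^esub> a;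
      y \<sqsubseteq>\<^bsub>opens_frame T\<^esub> s\<rbrakk> \<Longrightarrow> y \<sqsubseteq>\<^bsub>opens_frame T\<^esub> z"
  have "a \<inter> s \<subseteq> z" if "s \<in> S" for s
    using z[of s "a \<inter> s"] that * by auto
  then have "(\<Union>s \<in> S. a \<inter> s) \<subseteq> z" by blast
  moreover have "m \<subseteq> (\<Union>s \<in> S. a \<inter> s)" using *(3,4) by auto
  ultimately show "m \<sqsubseteq>\<^bsub>opens_frame T\<^esub> z" by (simp only: opens_frame_simps)
qed auto

lemma opens_frame_ops:
  shows "\<top>\<^bsub>opens_frame T\<^esub> = topspace T"
    and "\<lbrakk>openin T U; openin T V\<rbrakk> \<Longrightarrow> U \<sqinter>\<^bsub>opens_frame T\<^esub> V = U \<inter> V"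
    and "\<forall>U \<in> S. openin T U \<Longrightarrow> \<Squnion>\<^bsub>opens_frame T\<^esub> S = \<Union> S"
proof -
  interpret frame "opens_frame T" by (rule opens_frame)
  show "\<top>\<^bsub>opens_frame T\<^esub> = topspace T"
    by (rule top_eqI) (auto dest: openin_subset)
  show "\<lbrakk>openin T U; openin T V\<rbrakk> \<Longrightarrow> U \<sqinter>\<^bsub>opens_frame T\<^esub> V = U \<inter> V"
    by (rule meet_eqI) auto
  show "\<forall>U \<in> S. openin T U \<Longrightarrow> \<Squnion>\<^bsub>opens_frame T\<^esub> S = \<Union> S"
    by (rule Sup_eqI) auto
qed

lemma two_frame_simps [simp]:
  "carrier two_frame = UNIV" "le two_frame = (\<le>)" "eq two_frame = (=)"
  by (simp_all add: two_frame_def)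

lemma two_frame: "frame two_frame"
proof (rule frameI[where \<sigma> = "\<lambda>S. True \<in> S"])
  show "is_lub two_frame (True \<in> S) S" for S
    by (force simp: least_def Upper_def)
qed auto

lemma two_frame_ops:
  shows "\<top>\<^bsub>two_frame\<^esub> = True"
    and "a \<sqinter>\<^bsub>two_frame\<^esub> b = (a \<and> b)"
    and "a \<squnion>\<^bsub>two_frame\<^esub> b = (a \<or> b)"
    and "\<Squnion>\<^bsub>two_frame\<^esub> S = (True \<in> S)"
proof -
  interpret frame two_frame by (rule two_frame)
  show "\<top>\<^bsub>two_frame\<^esub> = True" by (rule top_eqI) auto
  show "a \<sqinter>\<^bsub>two_frame\<^esub> b = (a \<and> b)" by (rule meet_eqI) auto
  have Sup: "\<Squnion>\<^bsub>two_frame\<^esub> S = (True \<in> S)" for S by (rule Sup_eqI) auto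
  show "\<Squnion>\<^bsub>two_frame\<^esub> S = (True \<in> S)" by (rule Sup)
  show "a \<squnion>\<^bsub>two_frame\<^esub> b = (a \<or> b)" by (auto simp: join_def Sup)
qed

text \<open>In this form a frame map to the two-element frame is the membership predicate of a
  completely prime filter, so points can be handled by plain logic.\<close>

lemma frame_map_two_iff:
  "frame_map A two_frame f \<longleftrightarrow> f \<top>\<^bsub>A\<^esub> \<and>
     (\<forall>a \<in> carrier A. \<forall>b \<in> carrier A. f (a \<sqinter>\<^bsub>A\<^esub> b) \<longleftrightarrow> f a \<and> f b) \<and>
     (\<forall>S. S \<subseteq> carrier A \<longrightarrow> (f (\<Squnion>\<^bsub>A\<^esub> S) \<longleftrightarrow> (\<exists>s \<in> S. f s)))"
proof -
  have "True \<in> f ` S \<longleftrightarrow> (\<exists>s \<in> S. f s)" for S by (auto simp: image_iff)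
  then show ?thesis
    by (simp add: frame_map_def two_frame_ops)
qed

section \<open>Coproducts\<close>

lemma coproduct_frame_simps [simp]:
  "carrier (coproduct_frame A B) = {I. C_ideal A B I}"
  "le (coproduct_frame A B) = (\<subseteq>)"
  "eq (coproduct_frame A B) = (=)"
  by (simp_all add: coproduct_frame_def)

lemma C_idealI:
  assumes "I \<subseteq> carrier A \<times> carrier B"
    and "\<And>a b a' b'. \<lbrakk>(a, b) \<in> I; a' \<in> carrier A; b' \<in> carrier B; a' \<sqsubseteq>\<^bsub>A\<^esub> a; b' \<sqsubseteq>\<^bsub>B\<^esub> b\<rbrakk> \<Longrightarrow> (a', b') \<in> I"
    and "\<And>S b. \<lbrakk>S \<subseteq> carrier A; b \<in> carrier B; \<And>s. s \<in> S \<Longrightarrow> (s, b) \<in> I\<rbrakk> \<Longrightarrow> (\<Squnion>\<^bsub>A\<^esub> S, b) \<in> I"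
    and "\<And>a T. \<lbrakk>a \<in> carrier A; T \<subseteq> carrier B; \<And>t. t \<in> T \<Longrightarrow> (a, t) \<in> I\<rbrakk> \<Longrightarrow> (a, \<Squnion>\<^bsub>B\<^esub> T) \<in> I"
  shows "C_ideal A B I"
  unfolding C_ideal_def
proof (intro conjI allI impI ballI, goal_cases)
  case 1 show ?case by (rule assms(1))
next
  case (2 x)
  then show ?case using assms(2) by (cases x) simp
next
  case (3 S b)
  then show ?case by (intro assms(3)) auto
next
  case (4 a T)
  then show ?case by (intro assms(4)) auto
qed

lemma C_ideal_subset: "C_ideal A B I \<Longrightarrow> I \<subseteq> carrier A \<times> carrier B"
  by (simp add: C_ideal_def)

lemma C_ideal_down:
  assumes "C_ideal A B I" "(a, b) \<in> I" "a' \<in> carrier A" "b' \<in> carrier B" "a' \<sqsubseteq>\<^bsub>A\<^esub> a" "b' \<sqsubseteq>\<^bsub>B\<^esub> b"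
  shows "(a', b') \<in> I"
proof -
  have "\<forall>(a, b) \<in> I. \<forall>a' \<in> carrier A. \<forall>b' \<in> carrier B.
        a' \<sqsubseteq>\<^bsub>A\<^esub> a \<longrightarrow> b' \<sqsubseteq>\<^bsub>B\<^esub> b \<longrightarrow> (a', b') \<in> I"
    using assms(1) by (simp add: C_ideal_def)
  then show ?thesis using assms(2-) by fastforce
qed

lemma C_ideal_Sup_left:
  assumes "C_ideal A B I" "S \<subseteq> carrier A" "b \<in> carrier B" "\<And>s. s \<in> S \<Longrightarrow> (s, b) \<in> I"
  shows "(\<Squnion>\<^bsub>A\<^esub> S, b) \<in> I"
proof -
  have "S \<times> {b} \<subseteq> I" using assms(4) by auto
  then show ?thesis using assms(1-3) by (simp add: C_ideal_def)
qed

lemma C_ideal_Sup_right: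
  assumes "C_ideal A B I" "a \<in> carrier A" "T \<subseteq> carrier B" "\<And>t. t \<in> T \<Longrightarrow> (a, t) \<in> I"
  shows "(a, \<Squnion>\<^bsub>B\<^esub> T) \<in> I"
proof -
  have "{a} \<times> T \<subseteq> I" using assms(4) by auto
  then show ?thesis using assms(1-3) by (simp add: C_ideal_def)
qed

text \<open>Nonemptiness keeps the intersection inside \<open>carrier A \<times> carrier B\<close>;
  the empty family would give the whole type.\<close>

lemma C_ideal_Inter:
  assumes "\<I> \<noteq> {}" "\<And>I. I \<in> \<I> \<Longrightarrow> C_ideal A B I"
  shows "C_ideal A B (\<Inter> \<I>)"
proof (rule C_idealI)
  show "\<Inter> \<I> \<subseteq> carrier A \<times> carrier B" using assms C_ideal_subset by blast
next
  fix a b a' b'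
  assume "(a, b) \<in> \<Inter> \<I>" "a' \<in> carrier A" "b' \<in> carrier B" "a' \<sqsubseteq>\<^bsub>A\<^esub> a" "b' \<sqsubseteq>\<^bsub>B\<^esub> b"
  then show "(a', b') \<in> \<Inter> \<I>"
    using C_ideal_down[OF assms(2)] by blast
next
  fix S b assume "S \<subseteq> carrier A" "b \<in> carrier B" "\<And>s. s \<in> S \<Longrightarrow> (s, b) \<in> \<Inter> \<I>"
  then show "(\<Squnion>\<^bsub>A\<^esub> S, b) \<in> \<Inter> \<I>"
    using C_ideal_Sup_left[OF assms(2)] by blast
next
  fix a T assume "a \<in> carrier A" "T \<subseteq> carrier B" "\<And>t. t \<in> T \<Longrightarrow> (a, t) \<in> \<Inter> \<I>"
  then show "(a, \<Squnion>\<^bsub>B\<^esub> T) \<in> \<Inter> \<I>"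
    using C_ideal_Sup_right[OF assms(2)] by blast
qed

lemma C_ideal_Int: "\<lbrakk>C_ideal A B I; C_ideal A B J\<rbrakk> \<Longrightarrow> C_ideal A B (I \<inter> J)"
  using C_ideal_Inter[of "{I, J}" A B] by auto

locale frame_pair = A: frame A + B: frame B for A :: "'a gorder" and B :: "'b gorder"
begin

abbreviation "AB \<equiv> coproduct_frame A B"
abbreviation "inl \<equiv> coproduct_inl A B"
abbreviation "inr \<equiv> coproduct_inr A B"

lemma C_ideal_full: "C_ideal A B (carrier A \<times> carrier B)"
  by (rule C_idealI) auto

lemma C_ideal_bottom:
  assumes "C_ideal A B I"
  shows "a \<in> carrier A \<Longrightarrow> (a, \<bottom>\<^bsub>B\<^esub>) \<in> I" "b \<in> carrier B \<Longrightarrow> (\<bottom>\<^bsub>A\<^esub>, b) \<in> I"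
  using C_ideal_Sup_right[OF assms, of a "{}"] C_ideal_Sup_left[OF assms, of "{}" b]
  by (simp_all add: A.Sup_empty B.Sup_empty)

text \<open>This \<open>C\<close>-ideal is the Heyting implication \<open>I \<rightarrow> K\<close>; its existence yields distributivity.\<close>

lemma C_ideal_residual:
  assumes I: "I \<subseteq> carrier A \<times> carrier B" and K: "C_ideal A B K"
  shows "C_ideal A B {(x, y). x \<in> carrier A \<and> y \<in> carrier B \<and>
    (\<forall>c d. (c, d) \<in> I \<longrightarrow> (x \<sqinter>\<^bsub>A\<^esub> c, y \<sqinter>\<^bsub>B\<^esub> d) \<in> K)}" (is "C_ideal A B ?J")
proof (rule C_idealI)
  show "?J \<subseteq> carrier A \<times> carrier B" by auto
next
  fix a b a' b'
  assume *: "(a, b) \<in> ?J" "a' \<in> carrier A" "b' \<in> carrier B" "a' \<sqsubseteq>\<^bsub>A\<^esub> a" "b' \<sqsubseteq>\<^bsub>B\<^esub> b"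
  have "(a' \<sqinter>\<^bsub>A\<^esub> c, b' \<sqinter>\<^bsub>B\<^esub> d) \<in> K" if cd: "(c, d) \<in> I" for c d
  proof -
    have cc: "c \<in> carrier A" "d \<in> carrier B" using cd I by auto
    have "(a \<sqinter>\<^bsub>A\<^esub> c, b \<sqinter>\<^bsub>B\<^esub> d) \<in> K" using *(1) cd by simp
    then show ?thesis
      by (rule C_ideal_down[OF K]) (use * cc in
        \<open>simp_all add: A.meet_mono B.meet_mono\<close>)
  qed
  then show "(a', b') \<in> ?J" using *(2,3) by simp
next
  fix S b assume *: "S \<subseteq> carrier A" "b \<in> carrier B" "\<And>s. s \<in> S \<Longrightarrow> (s, b) \<in> ?J"
  have "(\<Squnion>\<^bsub>A\<^esub> S \<sqinter>\<^bsub>A\<^esub> c, b \<sqinter>\<^bsub>B\<^esub> d) \<in> K" if cd: "(c, d) \<in> I" for c d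
  proof -
    have c: "c \<in> carrier A" "d \<in> carrier B" using cd I by auto
    have "(\<Squnion>\<^bsub>A\<^esub> ((\<lambda>s. s \<sqinter>\<^bsub>A\<^esub> c) ` S), b \<sqinter>\<^bsub>B\<^esub> d) \<in> K"
      using * c cd by (intro C_ideal_Sup_left[OF K]) auto
    then show ?thesis by (simp add: A.Sup_meet_distrib[OF c(1) *(1)])
  qed
  then show "(\<Squnion>\<^bsub>A\<^esub> S, b) \<in> ?J" using *(1,2) by simp
next
  fix a T assume *: "a \<in> carrier A" "T \<subseteq> carrier B" "\<And>t. t \<in> T \<Longrightarrow> (a, t) \<in> ?J"
  have "(a \<sqinter>\<^bsub>A\<^esub> c, \<Squnion>\<^bsub>B\<^esub> T \<sqinter>\<^bsub>B\<^esub> d) \<in> K" if cd: "(c, d) \<in> I" for c d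
  proof -
    have c: "c \<in> carrier A" "d \<in> carrier B" using cd I by auto
    have "(a \<sqinter>\<^bsub>A\<^esub> c, \<Squnion>\<^bsub>B\<^esub> ((\<lambda>t. t \<sqinter>\<^bsub>B\<^esub> d) ` T)) \<in> K"
      using * c cd by (intro C_ideal_Sup_right[OF K]) auto
    then show ?thesis by (simp add: B.Sup_meet_distrib[OF c(2) *(2)])
  qed
  then show "(a, \<Squnion>\<^bsub>B\<^esub> T) \<in> ?J" using *(1,2) by simp
qed

lemma coproduct_frame: "frame AB"
proof (rule frameI[where \<sigma> = "\<lambda>\<S>. \<Inter> {I. C_ideal A B I \<and> \<Union> \<S> \<subseteq> I}"])
  fix \<S> assume S: "\<S> \<subseteq> carrier AB"
  have "X \<subseteq> carrier A \<times> carrier B" if "X \<in> \<S>" for X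
    using that S by (intro C_ideal_subset) auto
  then have "carrier A \<times> carrier B \<in> {I. C_ideal A B I \<and> \<Union> \<S> \<subseteq> I}"
    using C_ideal_full Union_least[of \<S> "carrier A \<times> carrier B"] by simp
  then have "C_ideal A B (\<Inter> {I. C_ideal A B I \<and> \<Union> \<S> \<subseteq> I})"
    by (intro C_ideal_Inter) auto
  then show "is_lub AB (\<Inter> {I. C_ideal A B I \<and> \<Union> \<S> \<subseteq> I}) \<S>"
    using S unfolding least_def Upper_def by auto
next
  fix I \<S> M K
  assume "I \<in> carrier AB" "\<S> \<subseteq> carrier AB" "M \<in> carrier AB" "K \<in> carrier AB"
    and M: "M \<sqsubseteq>\<^bsub>AB\<^esub> I" "M \<sqsubseteq>\<^bsub>AB\<^esub> \<Inter> {I. C_ideal A B I \<and> \<Union> \<S> \<subseteq> I}"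
    and K: "\<And>s y. \<lbrakk>s \<in> \<S>; y \<in> carrier AB; y \<sqsubseteq>\<^bsub>AB\<^esub> I; y \<sqsubseteq>\<^bsub>AB\<^esub> s\<rbrakk> \<Longrightarrow> y \<sqsubseteq>\<^bsub>AB\<^esub> K"
  then have C: "C_ideal A B I" "C_ideal A B M" "C_ideal A B K" "\<And>s. s \<in> \<S> \<Longrightarrow> C_ideal A B s" by auto
  note sub = C_ideal_subset[OF C(1)] C_ideal_subset[OF C(2)]
  have IK: "I \<inter> s \<subseteq> K" if "s \<in> \<S>" for s
    using K[OF that, of "I \<inter> s"] C_ideal_Int[OF C(1) C(4)[OF that]] by simp
  \<comment> \<open>\<open>J\<close> is the implication \<open>I \<rightarrow> K\<close>. Every
    \<open>s\<close> of the family lies below it because \<open>I \<inter> s \<subseteq> K\<close>,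
    and being a \<open>C\<close>-ideal it then contains their join, which is the least
    \<open>C\<close>-ideal above the union.\<close>
  define J where "J = {(x, y). x \<in> carrier A \<and> y \<in> carrier B \<and>
    (\<forall>c d. (c, d) \<in> I \<longrightarrow> (x \<sqinter>\<^bsub>A\<^esub> c, y \<sqinter>\<^bsub>B\<^esub> d) \<in> K)}"
  have J: "C_ideal A B J" unfolding J_def by (rule C_ideal_residual[OF sub(1) C(3)])
  have "s \<subseteq> J" if s: "s \<in> \<S>" for s
  proof clarify
    fix x y assume xy: "(x, y) \<in> s"
    then have xyc: "x \<in> carrier A" "y \<in> carrier B" using C_ideal_subset[OF C(4)[OF s]] by auto
    have "(x \<sqinter>\<^bsub>A\<^esub> c, y \<sqinter>\<^bsub>B\<^esub> d) \<in> I \<inter> s" if cd: "(c, d) \<in> I" for c d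
    proof -
      have cc: "c \<in> carrier A" "d \<in> carrier B" using cd sub by auto
      show ?thesis
        using C_ideal_down[OF C(1) cd, of "x \<sqinter>\<^bsub>A\<^esub> c" "y \<sqinter>\<^bsub>B\<^esub> d"]
          C_ideal_down[OF C(4)[OF s] xy, of "x \<sqinter>\<^bsub>A\<^esub> c" "y \<sqinter>\<^bsub>B\<^esub> d"] xyc cc
        by (simp add: A.meet_left A.meet_right B.meet_left B.meet_right)
    qed
    then show "(x, y) \<in> J" using IK[OF s] xyc by (auto simp: J_def)
  qed
  then have "\<Union> \<S> \<subseteq> J" by (rule Union_least)
  then have "\<Inter> {I. C_ideal A B I \<and> \<Union> \<S> \<subseteq> I} \<subseteq> J" using J by (intro Inter_lower) simp
  then have MJ: "M \<subseteq> J" using M(2) by simp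
  have "M \<subseteq> K"
  proof clarify
    \<comment> \<open>The pair lies in \<open>I\<close> and in \<open>I \<rightarrow> K\<close>.
      Testing the implication on the pair itself and using idempotency of meets puts it into
      \<open>K\<close>.\<close>
    fix x y assume xy: "(x, y) \<in> M"
    then have "x \<in> carrier A" "y \<in> carrier B" using sub by auto
    moreover have "(x, y) \<in> I" "(x, y) \<in> J" using xy M(1) MJ by auto
    then have "(x \<sqinter>\<^bsub>A\<^esub> x, y \<sqinter>\<^bsub>B\<^esub> y) \<in> K" by (simp add: J_def)
    ultimately show "(x, y) \<in> K" by (simp add: A.meet_idem B.meet_idem)
  qed
  then show "M \<sqsubseteq>\<^bsub>AB\<^esub> K" by simp
qed auto

sublocale AB: frame AB by (rule coproduct_frame)

lemma coproduct_top: "\<top>\<^bsub>AB\<^esub> = carrier A \<times> carrier B"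
  by (rule AB.top_eqI) (auto simp: C_ideal_full dest: C_ideal_subset)

lemma coproduct_meet: "\<lbrakk>C_ideal A B I; C_ideal A B J\<rbrakk> \<Longrightarrow> I \<sqinter>\<^bsub>AB\<^esub> J = I \<inter> J"
  by (rule AB.meet_eqI) (auto simp: C_ideal_Int)

text \<open>The set is the box below \<open>(a, b)\<close> together with the two axes, which the
  empty joins force into every \<open>C\<close>-ideal. With one of \<open>a\<close>,
  \<open>b\<close> taken to be the top it bounds \<open>inl\<close> or \<open>inr\<close> from
  above.\<close>

lemma C_ideal_principal:
  assumes a: "a \<in> carrier A" and b: "b \<in> carrier B"
  shows "C_ideal A B {(x, y). x \<in> carrier A \<and> y \<in> carrier B \<and> (x \<sqsubseteq>\<^bsub>A\<^esub> a \<or> y = \<bottom>\<^bsub>B\<^esub>) \<and> (y \<sqsubseteq>\<^bsub>B\<^esub> b \<or> x = \<bottom>\<^bsub>A\<^esub>)}"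
    (is "C_ideal A B ?J")
proof (rule C_idealI)
  show "?J \<subseteq> carrier A \<times> carrier B" by auto
next
  fix x y x' y'
  assume *: "(x, y) \<in> ?J" "x' \<in> carrier A" "y' \<in> carrier B" "x' \<sqsubseteq>\<^bsub>A\<^esub> x" "y' \<sqsubseteq>\<^bsub>B\<^esub> y"
  then have "x = \<bottom>\<^bsub>A\<^esub> \<Longrightarrow> x' = \<bottom>\<^bsub>A\<^esub>" "y = \<bottom>\<^bsub>B\<^esub> \<Longrightarrow> y' = \<bottom>\<^bsub>B\<^esub>"
    by (auto intro!: A.le_antisym B.le_antisym A.bottom_lower B.bottom_lower)
  then show "(x', y') \<in> ?J"
    using * a b A.le_trans[of x' x a] B.le_trans[of y' y b] by auto
next
  fix S y assume *: "S \<subseteq> carrier A" "y \<in> carrier B" "\<And>s. s \<in> S \<Longrightarrow> (s, y) \<in> ?J"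
  have "\<Squnion>\<^bsub>A\<^esub> S \<sqsubseteq>\<^bsub>A\<^esub> a" if "y \<noteq> \<bottom>\<^bsub>B\<^esub>" using that * a by (intro A.sup_least) auto
  moreover have "\<Squnion>\<^bsub>A\<^esub> S = \<bottom>\<^bsub>A\<^esub>" if "\<not> y \<sqsubseteq>\<^bsub>B\<^esub> b"
    using that * by (intro A.Sup_eqI) (auto simp: A.bottom_lower)
  ultimately show "(\<Squnion>\<^bsub>A\<^esub> S, y) \<in> ?J" using * by auto
next
  fix x T assume *: "x \<in> carrier A" "T \<subseteq> carrier B" "\<And>t. t \<in> T \<Longrightarrow> (x, t) \<in> ?J"
  have "\<Squnion>\<^bsub>B\<^esub> T \<sqsubseteq>\<^bsub>B\<^esub> b" if "x \<noteq> \<bottom>\<^bsub>A\<^esub>" using that * b by (intro B.sup_least) auto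
  moreover have "\<Squnion>\<^bsub>B\<^esub> T = \<bottom>\<^bsub>B\<^esub>" if "\<not> x \<sqsubseteq>\<^bsub>A\<^esub> a"
    using that * by (intro B.Sup_eqI) (auto simp: B.bottom_lower)
  ultimately show "(x, \<Squnion>\<^bsub>B\<^esub> T) \<in> ?J" using * by auto
qed

text \<open>One direction compares with a particular \<open>C\<close>-ideal containing
  \<open>(a, \<top>)\<close>. The other holds in every such \<open>C\<close>-ideal, by closure
  downwards for \<open>x \<sqsubseteq> a\<close> and by the empty join for
  \<open>y = \<bottom>\<close>.\<close>

lemma mem_coproduct_inl:
  assumes a: "a \<in> carrier A"
  shows "(x, y) \<in> inl a \<longleftrightarrow> x \<in> carrier A \<and> y \<in> carrier B \<and> (x \<sqsubseteq>\<^bsub>A\<^esub> a \<or> y = \<bottom>\<^bsub>B\<^esub>)"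
proof
  let ?J = "{(x, y). x \<in> carrier A \<and> y \<in> carrier B \<and> (x \<sqsubseteq>\<^bsub>A\<^esub> a \<or> y = \<bottom>\<^bsub>B\<^esub>) \<and> (y \<sqsubseteq>\<^bsub>B\<^esub> \<top>\<^bsub>B\<^esub> \<or> x = \<bottom>\<^bsub>A\<^esub>)}"
  assume "(x, y) \<in> inl a"
  moreover have "inl a \<subseteq> ?J"
    unfolding coproduct_inl_def
    using a C_ideal_principal[OF a B.top_closed] by (intro Inter_lower) auto
  ultimately show "x \<in> carrier A \<and> y \<in> carrier B \<and> (x \<sqsubseteq>\<^bsub>A\<^esub> a \<or> y = \<bottom>\<^bsub>B\<^esub>)" by auto
next
  assume "x \<in> carrier A \<and> y \<in> carrier B \<and> (x \<sqsubseteq>\<^bsub>A\<^esub> a \<or> y = \<bottom>\<^bsub>B\<^esub>)"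
  then show "(x, y) \<in> inl a"
    using C_ideal_bottom C_ideal_down[where a' = x and b' = y] unfolding coproduct_inl_def
    by (auto simp: B.top_higher)
qed

lemma mem_coproduct_inr:
  assumes b: "b \<in> carrier B"
  shows "(x, y) \<in> inr b \<longleftrightarrow> x \<in> carrier A \<and> y \<in> carrier B \<and> (y \<sqsubseteq>\<^bsub>B\<^esub> b \<or> x = \<bottom>\<^bsub>A\<^esub>)"
proof
  let ?J = "{(x, y). x \<in> carrier A \<and> y \<in> carrier B \<and> (x \<sqsubseteq>\<^bsub>A\<^esub> \<top>\<^bsub>A\<^esub> \<or> y = \<bottom>\<^bsub>B\<^esub>) \<and> (y \<sqsubseteq>\<^bsub>B\<^esub> b \<or> x = \<bottom>\<^bsub>A\<^esub>)}"
  assume "(x, y) \<in> inr b"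
  moreover have "inr b \<subseteq> ?J"
    unfolding coproduct_inr_def
    using b C_ideal_principal[OF A.top_closed b] by (intro Inter_lower) auto
  ultimately show "x \<in> carrier A \<and> y \<in> carrier B \<and> (y \<sqsubseteq>\<^bsub>B\<^esub> b \<or> x = \<bottom>\<^bsub>A\<^esub>)" by auto
next
  assume "x \<in> carrier A \<and> y \<in> carrier B \<and> (y \<sqsubseteq>\<^bsub>B\<^esub> b \<or> x = \<bottom>\<^bsub>A\<^esub>)"
  then show "(x, y) \<in> inr b"
    using C_ideal_bottom C_ideal_down[where a' = x and b' = y] unfolding coproduct_inr_def
    by (auto simp: A.top_higher)
qed

lemma C_ideal_inl: "a \<in> carrier A \<Longrightarrow> C_ideal A B (inl a)"
  unfolding coproduct_inl_def using C_ideal_full by (intro C_ideal_Inter) auto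

lemma C_ideal_inr: "b \<in> carrier B \<Longrightarrow> C_ideal A B (inr b)"
  unfolding coproduct_inr_def using C_ideal_full by (intro C_ideal_Inter) auto

lemma frame_map_inl: "frame_map A AB inl"
  unfolding frame_map_def
proof (intro conjI ballI allI impI)
  show "inl \<in> carrier A \<rightarrow> carrier AB" by (simp add: C_ideal_inl)
  show "inl \<top>\<^bsub>A\<^esub> = \<top>\<^bsub>AB\<^esub>"
    by (auto simp: coproduct_top mem_coproduct_inl A.top_higher)
next
  fix a b assume ab: "a \<in> carrier A" "b \<in> carrier A"
  have "x \<sqsubseteq>\<^bsub>A\<^esub> a \<sqinter>\<^bsub>A\<^esub> b \<longleftrightarrow> x \<sqsubseteq>\<^bsub>A\<^esub> a \<and> x \<sqsubseteq>\<^bsub>A\<^esub> b" if "x \<in> carrier A" for x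
    using that ab A.meet_left[of a b] A.meet_right[of a b] A.meet_closed[of a b]
    by (meson A.le_trans A.meet_le)
  then show "inl (a \<sqinter>\<^bsub>A\<^esub> b) = inl a \<sqinter>\<^bsub>AB\<^esub> inl b"
    using ab by (auto simp: coproduct_meet C_ideal_inl mem_coproduct_inl)
next
  fix S assume S: "S \<subseteq> carrier A"
  show "inl (\<Squnion>\<^bsub>A\<^esub> S) = \<Squnion>\<^bsub>AB\<^esub> (inl ` S)"
  proof (rule AB.Sup_eqI[symmetric])
    show "inl (\<Squnion>\<^bsub>A\<^esub> S) \<in> carrier AB" "inl ` S \<subseteq> carrier AB"
      using S by (auto simp: C_ideal_inl)
    fix I assume "I \<in> inl ` S"
    then obtain s where s: "s \<in> S" "I = inl s" "s \<in> carrier A" using S by auto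
    have "x \<sqsubseteq>\<^bsub>A\<^esub> \<Squnion>\<^bsub>A\<^esub> S" if "x \<in> carrier A" "x \<sqsubseteq>\<^bsub>A\<^esub> s" for x
      using that S s A.sup_upper[OF S s(1)] A.sup_closed[OF S] by (meson A.le_trans)
    then show "I \<sqsubseteq>\<^bsub>AB\<^esub> inl (\<Squnion>\<^bsub>A\<^esub> S)"
      using s S by (auto simp: mem_coproduct_inl)
  next
    fix I assume I: "I \<in> carrier AB" and up: "\<And>J. J \<in> inl ` S \<Longrightarrow> J \<sqsubseteq>\<^bsub>AB\<^esub> I"
    \<comment> \<open>Lying above \<open>inl s\<close> amounts to containing
      \<open>(s, \<top>)\<close>, so closure of \<open>I\<close> under joins in the first coordinate
      yields \<open>(\<Squnion>S, \<top>)\<close> and hence \<open>inl\<close> of the join.\<close>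
    have "(s, \<top>\<^bsub>B\<^esub>) \<in> I" if "s \<in> S" for s
      using up[of "inl s"] that S by (auto simp: mem_coproduct_inl subset_iff)
    then have "(\<Squnion>\<^bsub>A\<^esub> S, \<top>\<^bsub>B\<^esub>) \<in> I"
      using I S by (intro C_ideal_Sup_left) auto
    then show "inl (\<Squnion>\<^bsub>A\<^esub> S) \<sqsubseteq>\<^bsub>AB\<^esub> I"
      using I by (auto simp: coproduct_inl_def)
  qed
qed

lemma frame_map_inr: "frame_map B AB inr"
  unfolding frame_map_def
proof (intro conjI ballI allI impI)
  show "inr \<in> carrier B \<rightarrow> carrier AB" by (simp add: C_ideal_inr)
  show "inr \<top>\<^bsub>B\<^esub> = \<top>\<^bsub>AB\<^esub>"
    by (auto simp: coproduct_top mem_coproduct_inr B.top_higher)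
next
  fix a b assume ab: "a \<in> carrier B" "b \<in> carrier B"
  have "x \<sqsubseteq>\<^bsub>B\<^esub> a \<sqinter>\<^bsub>B\<^esub> b \<longleftrightarrow> x \<sqsubseteq>\<^bsub>B\<^esub> a \<and> x \<sqsubseteq>\<^bsub>B\<^esub> b" if "x \<in> carrier B" for x
    using that ab B.meet_left[of a b] B.meet_right[of a b] B.meet_closed[of a b]
    by (meson B.le_trans B.meet_le)
  then show "inr (a \<sqinter>\<^bsub>B\<^esub> b) = inr a \<sqinter>\<^bsub>AB\<^esub> inr b"
    using ab by (auto simp: coproduct_meet C_ideal_inr mem_coproduct_inr)
next
  fix S assume S: "S \<subseteq> carrier B"
  show "inr (\<Squnion>\<^bsub>B\<^esub> S) = \<Squnion>\<^bsub>AB\<^esub> (inr ` S)"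
  proof (rule AB.Sup_eqI[symmetric])
    show "inr (\<Squnion>\<^bsub>B\<^esub> S) \<in> carrier AB" "inr ` S \<subseteq> carrier AB"
      using S by (auto simp: C_ideal_inr)
    fix I assume "I \<in> inr ` S"
    then obtain s where s: "s \<in> S" "I = inr s" "s \<in> carrier B" using S by auto
    have "x \<sqsubseteq>\<^bsub>B\<^esub> \<Squnion>\<^bsub>B\<^esub> S" if "x \<in> carrier B" "x \<sqsubseteq>\<^bsub>B\<^esub> s" for x
      using that S s B.sup_upper[OF S s(1)] B.sup_closed[OF S] by (meson B.le_trans)
    then show "I \<sqsubseteq>\<^bsub>AB\<^esub> inr (\<Squnion>\<^bsub>B\<^esub> S)"
      using s S by (auto simp: mem_coproduct_inr)
  next
    fix I assume I: "I \<in> carrier AB" and up: "\<And>J. J \<in> inr ` S \<Longrightarrow> J \<sqsubseteq>\<^bsub>AB\<^esub> I"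
    have "(\<top>\<^bsub>A\<^esub>, s) \<in> I" if "s \<in> S" for s
      using up[of "inr s"] that S by (auto simp: mem_coproduct_inr subset_iff)
    then have "(\<top>\<^bsub>A\<^esub>, \<Squnion>\<^bsub>B\<^esub> S) \<in> I"
      using I S by (intro C_ideal_Sup_right) auto
    then show "inr (\<Squnion>\<^bsub>B\<^esub> S) \<sqsubseteq>\<^bsub>AB\<^esub> I"
      using I by (auto simp: coproduct_inr_def)
  qed
qed

lemma mem_rectangle:
  assumes "a \<in> carrier A" "b \<in> carrier B"
  shows "(a, b) \<in> inl a \<sqinter>\<^bsub>AB\<^esub> inr b"
  using assms by (simp add: coproduct_meet C_ideal_inl C_ideal_inr mem_coproduct_inl mem_coproduct_inr)

lemma rectangle_closed:
  assumes "a \<in> carrier A" "b \<in> carrier B"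
  shows "inl a \<sqinter>\<^bsub>AB\<^esub> inr b \<in> carrier AB"
  by (rule AB.meet_closed) (simp_all add: C_ideal_inl C_ideal_inr assms)

text \<open>Together with \<open>mem_rectangle\<close> this makes the rectangle of \<open>a\<close>
  and \<open>b\<close> the least \<open>C\<close>-ideal containing the pair \<open>(a, b)\<close>;
  every \<open>C\<close>-ideal is then the join of the rectangles of its pairs.\<close>

lemma rectangle_subset:
  assumes I: "C_ideal A B I" and ab: "(a, b) \<in> I"
  shows "inl a \<sqinter>\<^bsub>AB\<^esub> inr b \<subseteq> I"
proof -
  have "a \<in> carrier A" "b \<in> carrier B" using C_ideal_subset[OF I] ab by auto
  then show ?thesis
    using C_ideal_bottom[OF I] C_ideal_down[OF I ab]
    by (auto simp: coproduct_meet C_ideal_inl C_ideal_inr mem_coproduct_inl mem_coproduct_inr)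
qed

lemma C_ideal_eq_Sup:
  assumes I: "C_ideal A B I"
  shows "I = \<Squnion>\<^bsub>AB\<^esub> {inl a \<sqinter>\<^bsub>AB\<^esub> inr b | a b. (a, b) \<in> I}"
proof (rule AB.Sup_eqI[symmetric])
  have "inl a \<sqinter>\<^bsub>AB\<^esub> inr b \<in> carrier AB" if "(a, b) \<in> I" for a b
    by (rule rectangle_closed) (use C_ideal_subset[OF I] that in auto)
  then show "{inl a \<sqinter>\<^bsub>AB\<^esub> inr b | a b. (a, b) \<in> I} \<subseteq> carrier AB" by blast
next
  fix J assume "\<And>s. s \<in> {inl a \<sqinter>\<^bsub>AB\<^esub> inr b | a b. (a, b) \<in> I} \<Longrightarrow> s \<sqsubseteq>\<^bsub>AB\<^esub> J"
  then have J: "inl a \<sqinter>\<^bsub>AB\<^esub> inr b \<subseteq> J" if "(a, b) \<in> I" for a b using that by auto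
  have "I \<subseteq> J"
  proof clarify
    fix a b assume ab: "(a, b) \<in> I"
    then have "a \<in> carrier A" "b \<in> carrier B" using C_ideal_subset[OF I] by auto
    from mem_rectangle[OF this] J[OF ab] show "(a, b) \<in> J" by blast
  qed
  then show "I \<sqsubseteq>\<^bsub>AB\<^esub> J" by simp
qed (use I rectangle_subset in auto)

text \<open>Frame maps that agree on both injections agree on rectangles, and these generate by
  \<open>C_ideal_eq_Sup\<close>. The lemma later identifies the canonical map of
  \<open>bOmega_fin X\<close> with the quotient map.\<close>

lemma frame_map_coproduct_unique:
  assumes h: "frame_map AB C h" and k: "frame_map AB C k"
    and inl: "\<And>a. a \<in> carrier A \<Longrightarrow> h (inl a) = k (inl a)"
    and inr: "\<And>b. b \<in> carrier B \<Longrightarrow> h (inr b) = k (inr b)"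
    and I: "I \<in> carrier AB"
  shows "h I = k I"
proof -
  let ?R = "{inl a \<sqinter>\<^bsub>AB\<^esub> inr b | a b. (a, b) \<in> I}"
  have sub: "I \<subseteq> carrier A \<times> carrier B" using I C_ideal_subset[of A B I] by simp
  have "inl a \<sqinter>\<^bsub>AB\<^esub> inr b \<in> carrier AB" if "(a, b) \<in> I" for a b
    by (rule rectangle_closed) (use sub that in auto)
  then have R: "?R \<subseteq> carrier AB" by blast
  have "h r = k r" if "r \<in> ?R" for r
  proof -
    obtain a b where r: "r = inl a \<sqinter>\<^bsub>AB\<^esub> inr b" and "(a, b) \<in> I"
      using \<open>r \<in> ?R\<close> by blast
    then have "a \<in> carrier A" "b \<in> carrier B" using sub by auto
    with r show ?thesis
      by (simp add: frame_map_meet[OF h] frame_map_meet[OF k] C_ideal_inl C_ideal_inr inl inr)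
  qed
  then have "h ` ?R = k ` ?R" by (rule image_cong[OF refl])
  then have "h (\<Squnion>\<^bsub>AB\<^esub> ?R) = k (\<Squnion>\<^bsub>AB\<^esub> ?R)"
    by (simp only: frame_map_Sup[OF h R] frame_map_Sup[OF k R])
  moreover have "I = \<Squnion>\<^bsub>AB\<^esub> ?R" using I by (intro C_ideal_eq_Sup) simp
  ultimately show ?thesis by simp
qed

end

section \<open>Copairing: the universal property of the coproduct\<close>

locale frame_cospan = frame_pair A B + C: frame C
  for A :: "'a gorder" and B :: "'b gorder" and C :: "'c gorder" +
  fixes f :: "'a \<Rightarrow> 'c" and g :: "'b \<Rightarrow> 'c"
  assumes f: "frame_map A C f" and g: "frame_map B C g"
begin

lemma rect_closed: "\<lbrakk>a \<in> carrier A; b \<in> carrier B\<rbrakk> \<Longrightarrow> f a \<sqinter>\<^bsub>C\<^esub> g b \<in> carrier C"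
  by (simp add: frame_map_closed[OF f] frame_map_closed[OF g])

lemma copairing_set_closed:
  "C_ideal A B I \<Longrightarrow> {f a \<sqinter>\<^bsub>C\<^esub> g b | a b. (a, b) \<in> I} \<subseteq> carrier C"
  using C_ideal_subset rect_closed by blast

lemma copairing_closed: "C_ideal A B I \<Longrightarrow> copairing C f g I \<in> carrier C"
  unfolding copairing_def by (rule C.sup_closed[OF copairing_set_closed])

lemma copairing_le_iff:
  assumes I: "C_ideal A B I" and z: "z \<in> carrier C"
  shows "copairing C f g I \<sqsubseteq>\<^bsub>C\<^esub> z \<longleftrightarrow> (\<forall>a b. (a, b) \<in> I \<longrightarrow> f a \<sqinter>\<^bsub>C\<^esub> g b \<sqsubseteq>\<^bsub>C\<^esub> z)"
proof
  assume le: "copairing C f g I \<sqsubseteq>\<^bsub>C\<^esub> z"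
  show "\<forall>a b. (a, b) \<in> I \<longrightarrow> f a \<sqinter>\<^bsub>C\<^esub> g b \<sqsubseteq>\<^bsub>C\<^esub> z"
  proof (intro allI impI)
    fix a b assume ab: "(a, b) \<in> I"
    then have "f a \<sqinter>\<^bsub>C\<^esub> g b \<sqsubseteq>\<^bsub>C\<^esub> copairing C f g I"
      unfolding copairing_def by (intro C.sup_upper[OF copairing_set_closed[OF I]]) blast
    then show "f a \<sqinter>\<^bsub>C\<^esub> g b \<sqsubseteq>\<^bsub>C\<^esub> z"
      using le ab z C_ideal_subset[OF I] copairing_closed[OF I]
      by (auto intro: C.le_trans[of _ "copairing C f g I"] rect_closed)
  qed
next
  assume "\<forall>a b. (a, b) \<in> I \<longrightarrow> f a \<sqinter>\<^bsub>C\<^esub> g b \<sqsubseteq>\<^bsub>C\<^esub> z"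
  then show "copairing C f g I \<sqsubseteq>\<^bsub>C\<^esub> z"
    unfolding copairing_def by (intro C.sup_least[OF copairing_set_closed[OF I] z]) blast
qed

lemma le_copairing: "\<lbrakk>C_ideal A B I; (a, b) \<in> I\<rbrakk> \<Longrightarrow> f a \<sqinter>\<^bsub>C\<^esub> g b \<sqsubseteq>\<^bsub>C\<^esub> copairing C f g I"
  using copairing_le_iff[of I "copairing C f g I"] copairing_closed[of I] by simp

text \<open>This is the value at \<open>z\<close> of the right adjoint of the copairing, as
  \<open>copairing_le_iff\<close> shows. Closure under joins in each coordinate combines
  preservation of joins by \<open>f\<close> and \<open>g\<close> with distributivity in
  \<open>C\<close>.\<close>

lemma C_ideal_adjoint:
  assumes z: "z \<in> carrier C"
  shows "C_ideal A B {(a, b). a \<in> carrier A \<and> b \<in> carrier B \<and> f a \<sqinter>\<^bsub>C\<^esub> g b \<sqsubseteq>\<^bsub>C\<^esub> z}"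
proof (rule C_idealI, goal_cases)
  case 1 show ?case by auto
next
  case (2 a b a' b')
  then have "f a' \<sqinter>\<^bsub>C\<^esub> g b' \<sqsubseteq>\<^bsub>C\<^esub> f a \<sqinter>\<^bsub>C\<^esub> g b"
    using frame_map_mono[OF A.frame_axioms C.frame_axioms f, of a' a]
      frame_map_mono[OF B.frame_axioms C.frame_axioms g, of b' b]
    by (intro C.meet_mono) (auto simp: frame_map_closed[OF f] frame_map_closed[OF g])
  then show ?case
    using 2 z by (auto intro: C.le_trans[of _ "f a \<sqinter>\<^bsub>C\<^esub> g b"] rect_closed)
next
  case (3 S b)
  have "f (\<Squnion>\<^bsub>A\<^esub> S) \<sqinter>\<^bsub>C\<^esub> g b = \<Squnion>\<^bsub>C\<^esub> ((\<lambda>s. f s \<sqinter>\<^bsub>C\<^esub> g b) ` S)"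
    using 3 by (simp add: frame_map_Sup[OF f] C.Sup_meet_distrib frame_map_image[OF f]
        frame_map_closed[OF g] image_image)
  also have "\<dots> \<sqsubseteq>\<^bsub>C\<^esub> z" using 3 z by (intro C.sup_least) (auto intro: rect_closed)
  finally show ?case using 3 by simp
next
  case (4 a T)
  have "f a \<sqinter>\<^bsub>C\<^esub> g (\<Squnion>\<^bsub>B\<^esub> T) = \<Squnion>\<^bsub>C\<^esub> ((\<lambda>t. f a \<sqinter>\<^bsub>C\<^esub> g t) ` T)"
    using 4 by (simp add: frame_map_Sup[OF g] C.meet_Sup_distrib frame_map_image[OF g]
        frame_map_closed[OF f] image_image)
  also have "\<dots> \<sqsubseteq>\<^bsub>C\<^esub> z" using 4 z by (intro C.sup_least) (auto intro: rect_closed)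
  finally show ?case using 4 by simp
qed

text \<open>Pairs of \<open>inl a\<close> with second coordinate \<open>\<bottom>\<close> contribute
  only \<open>\<bottom>\<close>, since \<open>g\<close> preserves the empty join. All other pairs
  stay below \<open>f a\<close>, and \<open>(a, \<top>)\<close> attains it.\<close>

lemma copairing_inl:
  assumes a: "a \<in> carrier A"
  shows "copairing C f g (inl a) = f a"
proof (rule C.le_antisym)
  note fa = frame_map_closed[OF f a]
  show "copairing C f g (inl a) \<sqsubseteq>\<^bsub>C\<^esub> f a"
    unfolding copairing_le_iff[OF C_ideal_inl[OF a] fa]
  proof (intro allI impI)
    fix x y assume "(x, y) \<in> inl a"
    then have xy: "x \<in> carrier A" "y \<in> carrier B" "x \<sqsubseteq>\<^bsub>A\<^esub> a \<or> y = \<bottom>\<^bsub>B\<^esub>"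
      by (auto simp: mem_coproduct_inl a)
    note cl = frame_map_closed[OF f xy(1)] frame_map_closed[OF g xy(2)]
    from xy(3) show "f x \<sqinter>\<^bsub>C\<^esub> g y \<sqsubseteq>\<^bsub>C\<^esub> f a"
    proof
      assume "x \<sqsubseteq>\<^bsub>A\<^esub> a"
      then have "f x \<sqsubseteq>\<^bsub>C\<^esub> f a"
        using frame_map_mono[OF A.frame_axioms C.frame_axioms f] xy a by blast
      then show ?thesis using C.meet_left[OF cl] cl fa by (meson C.le_trans C.meet_closed)
    next
      assume "y = \<bottom>\<^bsub>B\<^esub>"
      then have "f x \<sqinter>\<^bsub>C\<^esub> g y = \<bottom>\<^bsub>C\<^esub>"
        using cl by (simp add: frame_map_bottom[OF B.frame_axioms C.frame_axioms g]
            meet_comm[of C _ "\<bottom>\<^bsub>C\<^esub>"] C.meet_absorb C.bottom_lower)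
      then show ?thesis using fa by (simp add: C.bottom_lower)
    qed
  qed
  have "(a, \<top>\<^bsub>B\<^esub>) \<in> inl a" using a by (simp add: mem_coproduct_inl)
  then show "f a \<sqsubseteq>\<^bsub>C\<^esub> copairing C f g (inl a)"
    using le_copairing[OF C_ideal_inl[OF a]] fa by (fastforce simp: frame_map_top[OF g] C.meet_top)
qed (use a in \<open>auto simp: frame_map_closed[OF f] copairing_closed C_ideal_inl\<close>)

lemma copairing_inr:
  assumes b: "b \<in> carrier B"
  shows "copairing C f g (inr b) = g b"
proof (rule C.le_antisym)
  note gb = frame_map_closed[OF g b]
  show "copairing C f g (inr b) \<sqsubseteq>\<^bsub>C\<^esub> g b"
    unfolding copairing_le_iff[OF C_ideal_inr[OF b] gb]
  proof (intro allI impI)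
    fix x y assume "(x, y) \<in> inr b"
    then have xy: "x \<in> carrier A" "y \<in> carrier B" "y \<sqsubseteq>\<^bsub>B\<^esub> b \<or> x = \<bottom>\<^bsub>A\<^esub>"
      by (auto simp: mem_coproduct_inr b)
    note cl = frame_map_closed[OF f xy(1)] frame_map_closed[OF g xy(2)]
    from xy(3) show "f x \<sqinter>\<^bsub>C\<^esub> g y \<sqsubseteq>\<^bsub>C\<^esub> g b"
    proof
      assume "y \<sqsubseteq>\<^bsub>B\<^esub> b"
      then have "g y \<sqsubseteq>\<^bsub>C\<^esub> g b"
        using frame_map_mono[OF B.frame_axioms C.frame_axioms g] xy b by blast
      then show ?thesis using C.meet_right[OF cl] cl gb by (meson C.le_trans C.meet_closed)
    next
      assume "x = \<bottom>\<^bsub>A\<^esub>"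
      then have "f x \<sqinter>\<^bsub>C\<^esub> g y = \<bottom>\<^bsub>C\<^esub>"
        using cl by (simp add: frame_map_bottom[OF A.frame_axioms C.frame_axioms f]
            C.meet_absorb C.bottom_lower)
      then show ?thesis using gb by (simp add: C.bottom_lower)
    qed
  qed
  have "(\<top>\<^bsub>A\<^esub>, b) \<in> inr b" using b by (simp add: mem_coproduct_inr)
  then show "g b \<sqsubseteq>\<^bsub>C\<^esub> copairing C f g (inr b)"
    using le_copairing[OF C_ideal_inr[OF b]] gb
    by (fastforce simp: frame_map_top[OF f] C.top_meet_eq)
qed (use b in \<open>auto simp: frame_map_closed[OF g] copairing_closed C_ideal_inr\<close>)

lemma copairing_mono:
  "\<lbrakk>C_ideal A B I; C_ideal A B J; I \<subseteq> J\<rbrakk> \<Longrightarrow> copairing C f g I \<sqsubseteq>\<^bsub>C\<^esub> copairing C f g J"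
  by (subst copairing_le_iff) (auto simp: copairing_closed le_copairing)

lemma frame_map_copairing: "frame_map AB C (copairing C f g)"
  unfolding frame_map_def
proof (intro conjI ballI allI impI)
  let ?h = "copairing C f g"
  show "?h \<in> carrier AB \<rightarrow> carrier C" by (simp add: copairing_closed)
  show "?h \<top>\<^bsub>AB\<^esub> = \<top>\<^bsub>C\<^esub>"
    using copairing_inl[OF A.top_closed] by (simp add: frame_map_top[OF frame_map_inl] frame_map_top[OF f])
next
  let ?h = "copairing C f g"
  fix I J assume "I \<in> carrier AB" "J \<in> carrier AB"
  then have I: "C_ideal A B I" and J: "C_ideal A B J" by auto
  note IJ = C_ideal_Int[OF I J]
  note cl = copairing_closed[OF I] copairing_closed[OF J] copairing_closed[OF IJ]
  show "?h (I \<sqinter>\<^bsub>AB\<^esub> J) = ?h I \<sqinter>\<^bsub>C\<^esub> ?h J"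
    unfolding coproduct_meet[OF I J]
  proof (rule C.le_antisym)
    show "?h (I \<inter> J) \<sqsubseteq>\<^bsub>C\<^esub> ?h I \<sqinter>\<^bsub>C\<^esub> ?h J"
      using cl I J IJ by (intro C.meet_le copairing_mono) auto
    let ?RI = "{f a \<sqinter>\<^bsub>C\<^esub> g b | a b. (a, b) \<in> I}" and ?RJ = "{f a \<sqinter>\<^bsub>C\<^esub> g b | a b. (a, b) \<in> J}"
    \<comment> \<open>A meet of two rectangles is the rectangle of the coordinatewise meets, and
      that pair lies in both ideals because they are closed downwards.\<close>
    have "x \<sqinter>\<^bsub>C\<^esub> y \<sqsubseteq>\<^bsub>C\<^esub> ?h (I \<inter> J)" if x: "x \<in> ?RI" and y: "y \<in> ?RJ" for x y
    proof -
      from x y obtain a b c d where xy: "x = f a \<sqinter>\<^bsub>C\<^esub> g b" "(a, b) \<in> I" "y = f c \<sqinter>\<^bsub>C\<^esub> g d" "(c, d) \<in> J"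
        by blast
      then have c: "a \<in> carrier A" "b \<in> carrier B" "c \<in> carrier A" "d \<in> carrier B"
        using C_ideal_subset I J by blast+
      have "(a \<sqinter>\<^bsub>A\<^esub> c, b \<sqinter>\<^bsub>B\<^esub> d) \<in> I \<inter> J"
        using c C_ideal_down[OF I xy(2)] C_ideal_down[OF J xy(4)]
        by (simp add: A.meet_left A.meet_right B.meet_left B.meet_right)
      from le_copairing[OF IJ this]
      have le: "(f a \<sqinter>\<^bsub>C\<^esub> f c) \<sqinter>\<^bsub>C\<^esub> (g b \<sqinter>\<^bsub>C\<^esub> g d) \<sqsubseteq>\<^bsub>C\<^esub> ?h (I \<inter> J)"
        using c by (simp add: frame_map_meet[OF f] frame_map_meet[OF g])
      have fc: "f a \<in> carrier C" "g b \<in> carrier C" "f c \<in> carrier C" "g d \<in> carrier C"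
        using c by (auto simp: frame_map_closed[OF f] frame_map_closed[OF g])
      have "x \<sqinter>\<^bsub>C\<^esub> y = (f a \<sqinter>\<^bsub>C\<^esub> f c) \<sqinter>\<^bsub>C\<^esub> (g b \<sqinter>\<^bsub>C\<^esub> g d)"
        unfolding xy by (rule C.meet_interchange[OF fc])
      with le show ?thesis by simp
    qed
    then show "?h I \<sqinter>\<^bsub>C\<^esub> ?h J \<sqsubseteq>\<^bsub>C\<^esub> ?h (I \<inter> J)"
      unfolding copairing_def[of C f g I] copairing_def[of C f g J]
      by (rule C.Sup_meet_Sup_le[OF copairing_set_closed[OF I] copairing_set_closed[OF J] cl(3)])
  qed (use cl in auto)
next
  let ?h = "copairing C f g"
  fix \<S> assume S: "\<S> \<subseteq> carrier AB"
  then have SC: "\<And>I. I \<in> \<S> \<Longrightarrow> C_ideal A B I" by auto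
  have Sup: "C_ideal A B (\<Squnion>\<^bsub>AB\<^esub> \<S>)" using AB.sup_closed[OF S] by simp
  show "?h (\<Squnion>\<^bsub>AB\<^esub> \<S>) = \<Squnion>\<^bsub>C\<^esub> (?h ` \<S>)"
  proof (rule C.Sup_eqI[symmetric])
    show "?h (\<Squnion>\<^bsub>AB\<^esub> \<S>) \<in> carrier C" "?h ` \<S> \<subseteq> carrier C"
      using Sup SC by (auto simp: copairing_closed)
    show "s \<sqsubseteq>\<^bsub>C\<^esub> ?h (\<Squnion>\<^bsub>AB\<^esub> \<S>)" if "s \<in> ?h ` \<S>" for s
      using that SC Sup AB.sup_upper[OF S] by (auto intro!: copairing_mono)
    fix z assume z: "z \<in> carrier C" and up: "\<And>s. s \<in> ?h ` \<S> \<Longrightarrow> s \<sqsubseteq>\<^bsub>C\<^esub> z"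
    \<comment> \<open>Preservation of joins is that of a left adjoint: \<open>z\<close> bounds the
      images of all members exactly when they lie in the \<open>C\<close>-ideal \<open>?J\<close>,
      which then contains their join.\<close>
    let ?J = "{(a, b). a \<in> carrier A \<and> b \<in> carrier B \<and> f a \<sqinter>\<^bsub>C\<^esub> g b \<sqsubseteq>\<^bsub>C\<^esub> z}"
    have "I \<subseteq> ?J" if "I \<in> \<S>" for I
      using up[of "?h I"] that SC[OF that] z C_ideal_subset[OF SC[OF that]]
      by (auto simp: copairing_le_iff)
    then have "\<Squnion>\<^bsub>AB\<^esub> \<S> \<subseteq> ?J"
      using AB.sup_least[OF S, of ?J] C_ideal_adjoint[OF z] by simp
    then show "?h (\<Squnion>\<^bsub>AB\<^esub> \<S>) \<sqsubseteq>\<^bsub>C\<^esub> z"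
      using Sup z by (auto simp: copairing_le_iff)
  qed
qed

end

section \<open>Congruences and quotients\<close>

lemma frame_congruence_carrier: "frame_congruence A \<theta> \<Longrightarrow> \<theta> \<subseteq> carrier A \<times> carrier A"
  by (simp add: frame_congruence_def equiv_type)

lemma frame_congruence_refl: "\<lbrakk>frame_congruence A \<theta>; a \<in> carrier A\<rbrakk> \<Longrightarrow> (a, a) \<in> \<theta>"
  by (simp add: frame_congruence_def equiv_def refl_on_def)

lemma frame_congruence_sym: "\<lbrakk>frame_congruence A \<theta>; (a, b) \<in> \<theta>\<rbrakk> \<Longrightarrow> (b, a) \<in> \<theta>"
  by (auto simp: frame_congruence_def equiv_def dest: symD)

lemma frame_congruence_trans: "\<lbrakk>frame_congruence A \<theta>; (a, b) \<in> \<theta>; (b, c) \<in> \<theta>\<rbrakk> \<Longrightarrow> (a, c) \<in> \<theta>"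
  by (auto simp: frame_congruence_def equiv_def dest: transD)

lemma frame_congruence_meet:
  assumes "frame_congruence A \<theta>" "(a, b) \<in> \<theta>" "(c, d) \<in> \<theta>"
  shows "(a \<sqinter>\<^bsub>A\<^esub> c, b \<sqinter>\<^bsub>A\<^esub> d) \<in> \<theta>"
proof -
  have "\<forall>(a, b) \<in> \<theta>. \<forall>(c, d) \<in> \<theta>. (a \<sqinter>\<^bsub>A\<^esub> c, b \<sqinter>\<^bsub>A\<^esub> d) \<in> \<theta>"
    using assms(1) by (simp add: frame_congruence_def)
  from bspec[OF this assms(2)] show ?thesis using assms(3) by auto
qed

lemma frame_congruence_Sup:
  assumes "frame_congruence A \<theta>" "\<And>s. s \<in> S \<Longrightarrow> (f s, g s) \<in> \<theta>"
  shows "(\<Squnion>\<^bsub>A\<^esub> (f ` S), \<Squnion>\<^bsub>A\<^esub> (g ` S)) \<in> \<theta>"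
proof -
  have "(\<lambda>s. (f s, g s)) ` S \<subseteq> \<theta>" using assms(2) by auto
  then have "(\<Squnion>\<^bsub>A\<^esub> (fst ` (\<lambda>s. (f s, g s)) ` S), \<Squnion>\<^bsub>A\<^esub> (snd ` (\<lambda>s. (f s, g s)) ` S)) \<in> \<theta>"
    using assms(1) by (simp only: frame_congruence_def)
  then show ?thesis by (simp add: image_image)
qed

lemma frame_kernel_congruence:
  assumes "frame A" "frame_map A B f"
  shows "frame_congruence A (frame_kernel A f)"
proof -
  interpret A: frame A by fact
  note f = assms(2)
  show ?thesis
    unfolding frame_congruence_def
  proof (intro conjI allI impI)
    show "equiv (carrier A) (frame_kernel A f)"
      by (rule equivI) (auto simp: frame_kernel_def refl_on_def intro: symI transI)
    show "\<forall>(a, b) \<in> frame_kernel A f. \<forall>(c, d) \<in> frame_kernel A f. (a \<sqinter>\<^bsub>A\<^esub> c, b \<sqinter>\<^bsub>A\<^esub> d) \<in> frame_kernel A f"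
      by (auto simp: frame_kernel_def frame_map_meet[OF f])
    fix S assume S: "S \<subseteq> frame_kernel A f"
    then have "fst ` S \<subseteq> carrier A" "snd ` S \<subseteq> carrier A" by (auto simp: frame_kernel_def)
    moreover have "f ` fst ` S = f ` snd ` S"
      unfolding image_image using S by (intro image_cong) (auto simp: frame_kernel_def)
    ultimately show "(\<Squnion>\<^bsub>A\<^esub> (fst ` S), \<Squnion>\<^bsub>A\<^esub> (snd ` S)) \<in> frame_kernel A f"
      by (simp add: frame_kernel_def frame_map_Sup[OF f])
  qed
qed

lemma frame_congruence_full: "frame A \<Longrightarrow> frame_congruence A (carrier A \<times> carrier A)"
proof -
  assume "frame A"
  then interpret A: frame A .
  show ?thesis
    unfolding frame_congruence_def
  proof (intro conjI allI impI)
    show "equiv (carrier A) (carrier A \<times> carrier A)"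
      by (rule equivI) (auto simp: refl_on_def intro: symI transI)
    show "\<forall>(a, b) \<in> carrier A \<times> carrier A. \<forall>(c, d) \<in> carrier A \<times> carrier A.
        (a \<sqinter>\<^bsub>A\<^esub> c, b \<sqinter>\<^bsub>A\<^esub> d) \<in> carrier A \<times> carrier A"
      by auto
    fix S assume "S \<subseteq> carrier A \<times> carrier A"
    then have "fst ` S \<subseteq> carrier A" "snd ` S \<subseteq> carrier A" by auto
    then show "(\<Squnion>\<^bsub>A\<^esub> (fst ` S), \<Squnion>\<^bsub>A\<^esub> (snd ` S)) \<in> carrier A \<times> carrier A" by simp
  qed
qed

lemma generated_congruence:
  assumes A: "frame A" and R: "R \<subseteq> carrier A \<times> carrier A"
  shows "frame_congruence A (generated_congruence A R)"
proof -
  interpret A: frame A by (rule A)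
  define \<Theta> where "\<Theta> = {\<theta>. frame_congruence A \<theta> \<and> (\<forall>(a, b) \<in> R. (a \<sqinter>\<^bsub>A\<^esub> b, a) \<in> \<theta>)}"
  \<comment> \<open>The full congruence makes the family nonempty and so confines its intersection
    to the carrier.\<close>
  have full: "carrier A \<times> carrier A \<in> \<Theta>"
    using frame_congruence_full[OF A] R by (auto simp: \<Theta>_def)
  have cong: "frame_congruence A \<theta>" if "\<theta> \<in> \<Theta>" for \<theta> using that by (simp add: \<Theta>_def)
  have "frame_congruence A (\<Inter> \<Theta>)"
    unfolding frame_congruence_def
  proof (intro conjI allI impI)
    show "equiv (carrier A) (\<Inter> \<Theta>)"
    proof (rule equivI)
      show "\<Inter> \<Theta> \<subseteq> carrier A \<times> carrier A" using full by (rule Inter_lower)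
      show "refl_on (carrier A) (\<Inter> \<Theta>)"
        using frame_congruence_refl[OF cong] by (simp add: refl_on_def)
      show "sym (\<Inter> \<Theta>)" 
        by (intro symI InterI) (rule frame_congruence_sym[OF cong], auto)
      show "trans (\<Inter> \<Theta>)" 
        by (intro transI InterI) (rule frame_congruence_trans[OF cong], auto)
    qed
    show "\<forall>(a, b) \<in> \<Inter> \<Theta>. \<forall>(c, d) \<in> \<Inter> \<Theta>. (a \<sqinter>\<^bsub>A\<^esub> c, b \<sqinter>\<^bsub>A\<^esub> d) \<in> \<Inter> \<Theta>"
      by (auto intro!: frame_congruence_meet[OF cong])
    fix S assume S: "S \<subseteq> \<Inter> \<Theta>"
    have "(\<Squnion>\<^bsub>A\<^esub> (fst ` S), \<Squnion>\<^bsub>A\<^esub> (snd ` S)) \<in> \<theta>" if "\<theta> \<in> \<Theta>" for \<theta>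
      using S that by (intro frame_congruence_Sup[OF cong]) auto
    then show "(\<Squnion>\<^bsub>A\<^esub> (fst ` S), \<Squnion>\<^bsub>A\<^esub> (snd ` S)) \<in> \<Inter> \<Theta>" by blast
  qed
  then show ?thesis by (simp add: generated_congruence_def \<Theta>_def)
qed

lemma generated_congruence_contains:
  "(a, b) \<in> R \<Longrightarrow> (a \<sqinter>\<^bsub>A\<^esub> b, a) \<in> generated_congruence A R"
  by (auto simp: generated_congruence_def)

text \<open>The kernel of \<open>f\<close> is itself a congruence imposing \<open>R\<close>, so
  minimality applies. To map out of a presented frame it thus suffices to check the generating
  inequalities.\<close>

lemma generated_congruence_subset_kernel:
  assumes A: "frame A" and B: "frame B" and R: "R \<subseteq> carrier A \<times> carrier A"
    and f: "frame_map A B f" and le: "\<And>a b. (a, b) \<in> R \<Longrightarrow> f a \<sqsubseteq>\<^bsub>B\<^esub> f b"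
  shows "generated_congruence A R \<subseteq> frame_kernel A f"
proof -
  interpret A: frame A by (rule A)
  interpret B: frame B by (rule B)
  have "(a \<sqinter>\<^bsub>A\<^esub> b, a) \<in> frame_kernel A f" if ab: "(a, b) \<in> R" for a b
  proof -
    have c: "a \<in> carrier A" "b \<in> carrier A" using R ab by auto
    then show ?thesis
      using le[OF ab] by (simp add: frame_kernel_def frame_map_meet[OF f] frame_map_closed[OF f] B.meet_absorb)
  qed
  then have "frame_kernel A f \<in> {\<theta>. frame_congruence A \<theta> \<and> (\<forall>(a, b) \<in> R. (a \<sqinter>\<^bsub>A\<^esub> b, a) \<in> \<theta>)}"
    using frame_kernel_congruence[OF A f] by auto
  then show ?thesis unfolding generated_congruence_def by (rule Inter_lower)
qed

section \<open>Quotients of a frame by a set of inequalities\<close>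

locale presented_frame = A: frame A for A :: "'a gorder" +
  fixes R :: "('a \<times> 'a) set"
  assumes R: "R \<subseteq> carrier A \<times> carrier A"
begin

abbreviation "\<theta> \<equiv> generated_congruence A R"
abbreviation "Q \<equiv> quotient_frame A R"
abbreviation "q \<equiv> quotient_map A R"

lemma cong: "frame_congruence A \<theta>"
  by (rule generated_congruence[OF A.frame_axioms R])

lemma equiv_theta: "equiv (carrier A) \<theta>"
  using cong by (simp add: frame_congruence_def)

lemmas cong_refl = frame_congruence_refl[OF cong]
  and cong_sym = frame_congruence_sym[OF cong]
  and cong_trans = frame_congruence_trans[OF cong]
  and cong_meet = frame_congruence_meet[OF cong]
  and cong_Sup = frame_congruence_Sup[OF cong]

lemma carrier_Q: "carrier Q = q ` carrier A"
  by (auto simp: quotient_frame_def quotient_map_def quotient_def)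

lemma q_eq_iff: "\<lbrakk>a \<in> carrier A; b \<in> carrier A\<rbrakk> \<Longrightarrow> q a = q b \<longleftrightarrow> (a, b) \<in> \<theta>"
  unfolding quotient_map_def by (rule eq_equiv_class_iff[OF equiv_theta])

lemma q_closed: "a \<in> carrier A \<Longrightarrow> q a \<in> carrier Q"
  by (simp add: carrier_Q)

text \<open>The order on classes asks for some pair of representatives. Since congruent elements
  have congruent meets, the witnesses can be exchanged for \<open>a\<close> and
  \<open>b\<close>.\<close>

lemma q_le_iff:
  assumes a: "a \<in> carrier A" and b: "b \<in> carrier A"
  shows "q a \<sqsubseteq>\<^bsub>Q\<^esub> q b \<longleftrightarrow> (a \<sqinter>\<^bsub>A\<^esub> b, a) \<in> \<theta>"
proof
  assume "q a \<sqsubseteq>\<^bsub>Q\<^esub> q b"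
  then obtain x y where xy: "(a, x) \<in> \<theta>" "(b, y) \<in> \<theta>" "(x \<sqinter>\<^bsub>A\<^esub> y, x) \<in> \<theta>"
    by (auto simp: quotient_frame_def quotient_map_def)
  from cong_trans[OF cong_trans[OF cong_meet[OF xy(1,2)] xy(3)] cong_sym[OF xy(1)]]
  show "(a \<sqinter>\<^bsub>A\<^esub> b, a) \<in> \<theta>" .
next
  assume "(a \<sqinter>\<^bsub>A\<^esub> b, a) \<in> \<theta>"
  then show "q a \<sqsubseteq>\<^bsub>Q\<^esub> q b"
    using cong_refl[OF a] cong_refl[OF b] by (auto simp: quotient_frame_def quotient_map_def)
qed

lemma q_mono: "\<lbrakk>a \<in> carrier A; b \<in> carrier A; a \<sqsubseteq>\<^bsub>A\<^esub> b\<rbrakk> \<Longrightarrow> q a \<sqsubseteq>\<^bsub>Q\<^esub> q b"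
  by (simp add: q_le_iff A.meet_absorb cong_refl)

lemma q_meet_le:
  assumes "a \<in> carrier A" "b \<in> carrier A"
  shows "q (a \<sqinter>\<^bsub>A\<^esub> b) \<sqsubseteq>\<^bsub>Q\<^esub> q a" "q (a \<sqinter>\<^bsub>A\<^esub> b) \<sqsubseteq>\<^bsub>Q\<^esub> q b"
  by (simp_all add: assms q_mono A.meet_left A.meet_right)

lemma q_le_trans:
  assumes c: "a \<in> carrier A" "b \<in> carrier A" "c \<in> carrier A"
    and "q a \<sqsubseteq>\<^bsub>Q\<^esub> q b" "q b \<sqsubseteq>\<^bsub>Q\<^esub> q c"
  shows "q a \<sqsubseteq>\<^bsub>Q\<^esub> q c"
proof -
  have ab: "(a \<sqinter>\<^bsub>A\<^esub> b, a) \<in> \<theta>" and bc: "(b \<sqinter>\<^bsub>A\<^esub> c, b) \<in> \<theta>"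
    using assms by (simp_all add: q_le_iff)
  have "(a \<sqinter>\<^bsub>A\<^esub> c, (a \<sqinter>\<^bsub>A\<^esub> b) \<sqinter>\<^bsub>A\<^esub> c) \<in> \<theta>"
    by (rule cong_meet[OF cong_sym[OF ab] cong_refl[OF c(3)]])
  moreover have "((a \<sqinter>\<^bsub>A\<^esub> b) \<sqinter>\<^bsub>A\<^esub> c, a \<sqinter>\<^bsub>A\<^esub> b) \<in> \<theta>"
    using cong_meet[OF cong_refl[OF c(1)] bc] c by (simp add: A.meet_assoc)
  ultimately show ?thesis
    using ab c by (simp add: q_le_iff) (blast intro: cong_trans)
qed

lemma q_Sup_le:
  assumes T: "T \<subseteq> carrier A" and u: "u \<in> carrier A" and le: "\<And>t. t \<in> T \<Longrightarrow> q t \<sqsubseteq>\<^bsub>Q\<^esub> q u"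
  shows "q (\<Squnion>\<^bsub>A\<^esub> T) \<sqsubseteq>\<^bsub>Q\<^esub> q u"
proof -
  have "(t \<sqinter>\<^bsub>A\<^esub> u, t) \<in> \<theta>" if "t \<in> T" for t
    using le[OF that] T u that by (simp add: q_le_iff subset_iff)
  then have "(\<Squnion>\<^bsub>A\<^esub> ((\<lambda>t. t \<sqinter>\<^bsub>A\<^esub> u) ` T), \<Squnion>\<^bsub>A\<^esub> ((\<lambda>t. t) ` T)) \<in> \<theta>"
    by (rule cong_Sup)
  then show ?thesis using T u by (simp add: q_le_iff A.Sup_meet_distrib)
qed

lemma q_le_meet:
  assumes c: "a \<in> carrier A" "b \<in> carrier A" "m \<in> carrier A"
    and "q m \<sqsubseteq>\<^bsub>Q\<^esub> q a" "q m \<sqsubseteq>\<^bsub>Q\<^esub> q b"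
  shows "q m \<sqsubseteq>\<^bsub>Q\<^esub> q (a \<sqinter>\<^bsub>A\<^esub> b)"
proof -
  have ma: "(m \<sqinter>\<^bsub>A\<^esub> a, m) \<in> \<theta>" and mb: "(m \<sqinter>\<^bsub>A\<^esub> b, m) \<in> \<theta>"
    using assms by (simp_all add: q_le_iff)
  have "((m \<sqinter>\<^bsub>A\<^esub> a) \<sqinter>\<^bsub>A\<^esub> b, m) \<in> \<theta>"
    by (rule cong_trans[OF cong_meet[OF ma cong_refl[OF c(2)]] mb])
  then show ?thesis using c by (simp add: q_le_iff A.meet_assoc)
qed

text \<open>Taking all representatives at once avoids choosing one per class; the join of a set of
  classes is the class of the join of its lift.\<close>

definition lift :: "'a set set \<Rightarrow> 'a set" where
  "lift S = {a \<in> carrier A. q a \<in> S}"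

lemma lift: "lift S \<subseteq> carrier A" "S \<subseteq> carrier Q \<Longrightarrow> q ` lift S = S"
  by (auto simp: lift_def carrier_Q)

lemma quotient_frame: "frame Q"
proof (rule frameI[where \<sigma> = "\<lambda>S. q (\<Squnion>\<^bsub>A\<^esub> (lift S))"])
  show "eq Q = (=)" by (simp add: quotient_frame_def)
  show "x \<sqsubseteq>\<^bsub>Q\<^esub> x" if "x \<in> carrier Q" for x
    using that by (auto simp: carrier_Q q_mono)
  show "x = y" if xy: "x \<in> carrier Q" "y \<in> carrier Q" and le: "x \<sqsubseteq>\<^bsub>Q\<^esub> y" "y \<sqsubseteq>\<^bsub>Q\<^esub> x" for x y
  proof -
    obtain a b where ab: "x = q a" "y = q b" "a \<in> carrier A" "b \<in> carrier A"
      using xy by (auto simp: carrier_Q)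
    then have "(a \<sqinter>\<^bsub>A\<^esub> b, a) \<in> \<theta>" "(a \<sqinter>\<^bsub>A\<^esub> b, b) \<in> \<theta>"
      using le q_le_iff[of a b] q_le_iff[of b a] by (auto simp: meet_comm[of A b a])
    then have "(a, b) \<in> \<theta>" by (rule cong_trans[OF cong_sym])
    then show ?thesis using ab by (simp add: q_eq_iff)
  qed
  show "x \<sqsubseteq>\<^bsub>Q\<^esub> z"
    if "x \<in> carrier Q" "y \<in> carrier Q" "z \<in> carrier Q" "x \<sqsubseteq>\<^bsub>Q\<^esub> y" "y \<sqsubseteq>\<^bsub>Q\<^esub> z" for x y z
  proof -
    from that(1-3) obtain a b c where "x = q a" "y = q b" "z = q c"
      "a \<in> carrier A" "b \<in> carrier A" "c \<in> carrier A"
      by (auto simp: carrier_Q)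
    then show ?thesis using that q_le_trans[of a b c] by simp
  qed
next
  fix S assume S: "S \<subseteq> carrier Q"
  show "is_lub Q (q (\<Squnion>\<^bsub>A\<^esub> (lift S))) S"
  proof (rule least_UpperI)
    fix x assume "x \<in> S"
    then obtain a where a: "x = q a" "a \<in> lift S" using lift(2)[OF S] by blast
    then have "a \<in> carrier A" using lift(1) by blast
    then show "x \<sqsubseteq>\<^bsub>Q\<^esub> q (\<Squnion>\<^bsub>A\<^esub> (lift S))"
      unfolding a(1) by (intro q_mono A.sup_upper[OF lift(1) a(2)] A.sup_closed[OF lift(1)])
  next
    fix y assume y: "y \<in> Upper Q S"
    then have "y \<in> carrier Q" using Upper_closed[of Q S] by blast
    then obtain u where u: "y = q u" "u \<in> carrier A" by (auto simp: carrier_Q)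
    have "q t \<sqsubseteq>\<^bsub>Q\<^esub> y" if "t \<in> lift S" for t
      using Upper_memD[OF y _ S, of "q t"] that by (simp add: lift_def)
    then show "q (\<Squnion>\<^bsub>A\<^esub> (lift S)) \<sqsubseteq>\<^bsub>Q\<^esub> y"
      unfolding u(1) by (rule q_Sup_le[OF lift(1) u(2)])
  qed (simp_all add: S q_closed A.sup_closed lift(1))
next
  fix a S m z
  assume a: "a \<in> carrier Q" and S: "S \<subseteq> carrier Q" and m: "m \<in> carrier Q" and z: "z \<in> carrier Q"
    and ma: "m \<sqsubseteq>\<^bsub>Q\<^esub> a" and mS: "m \<sqsubseteq>\<^bsub>Q\<^esub> q (\<Squnion>\<^bsub>A\<^esub> (lift S))"
    and le: "\<And>s y. \<lbrakk>s \<in> S; y \<in> carrier Q; y \<sqsubseteq>\<^bsub>Q\<^esub> a; y \<sqsubseteq>\<^bsub>Q\<^esub> s\<rbrakk> \<Longrightarrow> y \<sqsubseteq>\<^bsub>Q\<^esub> z"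
  obtain a' m' z' where [simp]: "a = q a'" "m = q m'" "z = q z'"
    and c [simp]: "a' \<in> carrier A" "m' \<in> carrier A" "z' \<in> carrier A"
    using a m z by (auto simp: carrier_Q)
  note Sup = A.sup_closed[OF lift(1), of S]
  \<comment> \<open>Distributivity is inherited from \<open>A\<close>: the hypothesis is applied to
    the class of \<open>a' \<sqinter> t\<close> for each representative \<open>t\<close>, and the
    join of these meets in \<open>A\<close> is \<open>a'\<close> met with the join of the
    lift.\<close>
  have "q (a' \<sqinter>\<^bsub>A\<^esub> t) \<sqsubseteq>\<^bsub>Q\<^esub> q z'" if t: "t \<in> lift S" for t
  proof -
    have tc: "t \<in> carrier A" "q t \<in> S" using t by (auto simp: lift_def)
    have "q (a' \<sqinter>\<^bsub>A\<^esub> t) \<sqsubseteq>\<^bsub>Q\<^esub> z"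
    proof (rule le[OF tc(2)])
      show "q (a' \<sqinter>\<^bsub>A\<^esub> t) \<in> carrier Q" using tc by (simp add: q_closed)
      show "q (a' \<sqinter>\<^bsub>A\<^esub> t) \<sqsubseteq>\<^bsub>Q\<^esub> a" "q (a' \<sqinter>\<^bsub>A\<^esub> t) \<sqsubseteq>\<^bsub>Q\<^esub> q t"
        using q_meet_le[OF c(1) tc(1)] by simp_all
    qed
    then show ?thesis by simp
  qed
  then have "q (\<Squnion>\<^bsub>A\<^esub> ((\<lambda>t. a' \<sqinter>\<^bsub>A\<^esub> t) ` lift S)) \<sqsubseteq>\<^bsub>Q\<^esub> q z'"
    by (intro q_Sup_le) (auto simp: lift_def)
  moreover have "q m' \<sqsubseteq>\<^bsub>Q\<^esub> q (a' \<sqinter>\<^bsub>A\<^esub> \<Squnion>\<^bsub>A\<^esub> (lift S))"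
    using ma mS Sup by (intro q_le_meet) auto
  ultimately show "m \<sqsubseteq>\<^bsub>Q\<^esub> z"
    using q_le_trans[of m' "a' \<sqinter>\<^bsub>A\<^esub> \<Squnion>\<^bsub>A\<^esub> (lift S)" z'] Sup
    by (simp add: A.meet_Sup_distrib[OF c(1) lift(1)] A.meet_closed[OF c(1) Sup, unfolded A.meet_Sup_distrib[OF c(1) lift(1)]])
qed

sublocale Q: frame Q by (rule quotient_frame)

lemma frame_map_q: "frame_map A Q q"
  unfolding frame_map_def
proof (intro conjI ballI allI impI)
  show "q \<in> carrier A \<rightarrow> carrier Q" by (simp add: q_closed)
  show "q \<top>\<^bsub>A\<^esub> = \<top>\<^bsub>Q\<^esub>"
    by (rule Q.top_eqI[symmetric]) (auto simp: carrier_Q q_mono A.top_higher)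
next
  fix a b assume c: "a \<in> carrier A" "b \<in> carrier A"
  show "q (a \<sqinter>\<^bsub>A\<^esub> b) = q a \<sqinter>\<^bsub>Q\<^esub> q b"
  proof (rule Q.meet_eqI[symmetric])
    show "q (a \<sqinter>\<^bsub>A\<^esub> b) \<sqsubseteq>\<^bsub>Q\<^esub> q a" "q (a \<sqinter>\<^bsub>A\<^esub> b) \<sqsubseteq>\<^bsub>Q\<^esub> q b"
      by (rule q_meet_le[OF c])+
    show "y \<sqsubseteq>\<^bsub>Q\<^esub> q (a \<sqinter>\<^bsub>A\<^esub> b)" if "y \<in> carrier Q" "y \<sqsubseteq>\<^bsub>Q\<^esub> q a" "y \<sqsubseteq>\<^bsub>Q\<^esub> q b" for y
      using that c by (auto simp: carrier_Q intro: q_le_meet)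
  qed (use c in \<open>auto simp: q_closed\<close>)
next
  fix S assume S: "S \<subseteq> carrier A"
  show "q (\<Squnion>\<^bsub>A\<^esub> S) = \<Squnion>\<^bsub>Q\<^esub> (q ` S)"
  proof (rule Q.Sup_eqI[symmetric])
    show "s \<sqsubseteq>\<^bsub>Q\<^esub> q (\<Squnion>\<^bsub>A\<^esub> S)" if "s \<in> q ` S" for s
      using that S A.sup_upper[OF S] by (auto intro!: q_mono)
    show "q (\<Squnion>\<^bsub>A\<^esub> S) \<sqsubseteq>\<^bsub>Q\<^esub> y" if y: "y \<in> carrier Q" "\<And>s. s \<in> q ` S \<Longrightarrow> s \<sqsubseteq>\<^bsub>Q\<^esub> y" for y
    proof -
      obtain u where "u \<in> carrier A" "y = q u" using y(1) by (auto simp: carrier_Q)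
      then show ?thesis using y(2) S by (auto intro: q_Sup_le)
    qed
  qed (use S in \<open>auto simp: q_closed\<close>)
qed

text \<open>This is what allows the kernel of a canonical map to be recognised as a generated
  congruence.\<close>

lemma frame_kernel_q: "frame_kernel A q = \<theta>"
proof -
  have "(a, b) \<in> frame_kernel A q \<longleftrightarrow> (a, b) \<in> \<theta>" for a b
    using frame_congruence_carrier[OF cong]
    by (cases "a \<in> carrier A \<and> b \<in> carrier A") (simp add: frame_kernel_def q_eq_iff, auto simp: frame_kernel_def)
  then show ?thesis by auto
qed

lemma q_relation: "(a, b) \<in> R \<Longrightarrow> q a \<sqsubseteq>\<^bsub>Q\<^esub> q b"
  using R generated_congruence_contains[of a b R A] by (subst q_le_iff) auto

lemma quotient_universal:
  assumes B: "frame B" and h: "frame_map A B h" and le: "\<And>a b. (a, b) \<in> R \<Longrightarrow> h a \<sqsubseteq>\<^bsub>B\<^esub> h b"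
  obtains k where "frame_map Q B k" "\<And>a. a \<in> carrier A \<Longrightarrow> k (q a) = h a"
proof (rule frame_map_factor[OF A.frame_axioms frame_map_q _ h])
  show "q ` carrier A = carrier Q" by (simp add: carrier_Q)
  show "h x = h y" if "x \<in> carrier A" "y \<in> carrier A" "q x = q y" for x y
    using that generated_congruence_subset_kernel[OF A.frame_axioms B R h le]
    by (auto simp: q_eq_iff frame_kernel_def)
qed (rule that)

end

section \<open>Extending maps out of finitary biframes\<close>

text \<open>Induction on \<open>F\<close> with \<open>u\<close> and \<open>v\<close> left free. In
  \<open>C\<close> a rectangle is enlarged to one of its factors, which joins the positive term
  \<open>u\<close> or the negative term \<open>v\<close>; two uses of the induction hypothesis give
  the corresponding inequalities in \<open>K\<close>, and \<open>le_join_meetI\<close> recombines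
  them. When \<open>F\<close> is exhausted only the simple shape of \<open>hyp\<close> is
  left.\<close>

lemma finite_join_le_transfer:
  assumes "frame_cospan A B C e d" and "frame_cospan A B K f g"
    and hyp: "\<And>a b u v. \<lbrakk>a \<in> carrier A; b \<in> carrier B; u \<in> carrier A; v \<in> carrier B;
      e a \<sqinter>\<^bsub>C\<^esub> d b \<sqsubseteq>\<^bsub>C\<^esub> e u \<squnion>\<^bsub>C\<^esub> d v\<rbrakk> \<Longrightarrow> f a \<sqinter>\<^bsub>K\<^esub> g b \<sqsubseteq>\<^bsub>K\<^esub> f u \<squnion>\<^bsub>K\<^esub> g v"
    and F: "finite F" "F \<subseteq> carrier A \<times> carrier B"
    and ab: "a \<in> carrier A" "b \<in> carrier B" and uv: "u \<in> carrier A" "v \<in> carrier B"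
    and le: "e a \<sqinter>\<^bsub>C\<^esub> d b \<sqsubseteq>\<^bsub>C\<^esub> (e u \<squnion>\<^bsub>C\<^esub> d v) \<squnion>\<^bsub>C\<^esub> \<Squnion>\<^bsub>C\<^esub> ((\<lambda>(p, q). e p \<sqinter>\<^bsub>C\<^esub> d q) ` F)"
  shows "f a \<sqinter>\<^bsub>K\<^esub> g b \<sqsubseteq>\<^bsub>K\<^esub> (f u \<squnion>\<^bsub>K\<^esub> g v) \<squnion>\<^bsub>K\<^esub> \<Squnion>\<^bsub>K\<^esub> ((\<lambda>(p, q). f p \<sqinter>\<^bsub>K\<^esub> g q) ` F)"
proof -
  interpret c: frame_cospan A B C e d by fact
  interpret h: frame_cospan A B K f g by fact
  show ?thesis
    using F uv le
  proof (induction F arbitrary: u v rule: finite_induct)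
    case empty
    have cl: "e u \<in> carrier C" "d v \<in> carrier C" "f u \<in> carrier K" "g v \<in> carrier K"
      using empty by (auto simp: frame_map_closed[OF c.f] frame_map_closed[OF c.g]
          frame_map_closed[OF h.f] frame_map_closed[OF h.g])
    have "x \<squnion>\<^bsub>C\<^esub> \<bottom>\<^bsub>C\<^esub> = x" if "x \<in> carrier C" for x
      using that c.C.le_iff_meet[of "\<bottom>\<^bsub>C\<^esub>" x] by (simp add: join_comm[of C x] c.C.bottom_lower)
    moreover have "x \<squnion>\<^bsub>K\<^esub> \<bottom>\<^bsub>K\<^esub> = x" if "x \<in> carrier K" for x
      using that h.C.le_iff_meet[of "\<bottom>\<^bsub>K\<^esub>" x] by (simp add: join_comm[of K x] h.C.bottom_lower)
    ultimately show ?case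
      using empty cl hyp[OF ab empty(2,3)] by (simp add: c.C.Sup_empty h.C.Sup_empty)
  next
    case (insert x F)
    obtain p q where x: "x = (p, q)" and pq: "p \<in> carrier A" "q \<in> carrier B"
      using insert.prems by (cases x) auto
    define Y where "Y = \<Squnion>\<^bsub>C\<^esub> ((\<lambda>(p, q). e p \<sqinter>\<^bsub>C\<^esub> d q) ` F)"
    define Z where "Z = \<Squnion>\<^bsub>K\<^esub> ((\<lambda>(p, q). f p \<sqinter>\<^bsub>K\<^esub> g q) ` F)"
    have F: "F \<subseteq> carrier A \<times> carrier B" using insert.prems by simp
    have YS: "(\<lambda>(p, q). e p \<sqinter>\<^bsub>C\<^esub> d q) ` F \<subseteq> carrier C"
      and ZS: "(\<lambda>(p, q). f p \<sqinter>\<^bsub>K\<^esub> g q) ` F \<subseteq> carrier K"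
      using F by (auto intro: c.rect_closed h.rect_closed)
    have ccl: "e u \<in> carrier C" "d v \<in> carrier C" "e p \<in> carrier C" "d q \<in> carrier C"
      "e a \<in> carrier C" "d b \<in> carrier C"
      using ab pq insert.prems by (auto simp: frame_map_closed[OF c.f] frame_map_closed[OF c.g])
    have hcl: "f u \<in> carrier K" "g v \<in> carrier K" "f p \<in> carrier K" "g q \<in> carrier K"
      "f a \<in> carrier K" "g b \<in> carrier K"
      using ab pq insert.prems by (auto simp: frame_map_closed[OF h.f] frame_map_closed[OF h.g])
    have Y: "Y \<in> carrier C" and Z: "Z \<in> carrier K"
      unfolding Y_def Z_def by (rule c.C.sup_closed[OF YS] h.C.sup_closed[OF ZS])+
    let ?W = "(f u \<squnion>\<^bsub>K\<^esub> g v) \<squnion>\<^bsub>K\<^esub> Z" and ?V = "(e u \<squnion>\<^bsub>C\<^esub> d v) \<squnion>\<^bsub>C\<^esub> Y"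
    have W: "?W \<in> carrier K" and V: "?V \<in> carrier C" using hcl Z ccl Y by simp_all
    have "\<Squnion>\<^bsub>C\<^esub> ((\<lambda>(p, q). e p \<sqinter>\<^bsub>C\<^esub> d q) ` insert x F) = (e p \<sqinter>\<^bsub>C\<^esub> d q) \<squnion>\<^bsub>C\<^esub> Y"
      unfolding Y_def x image_insert prod.case by (rule c.C.Sup_insert[OF _ YS]) (simp add: ccl)
    then have le: "e a \<sqinter>\<^bsub>C\<^esub> d b \<sqsubseteq>\<^bsub>C\<^esub> ?V \<squnion>\<^bsub>C\<^esub> (e p \<sqinter>\<^bsub>C\<^esub> d q)"
      using insert.prems(4) ccl Y by (simp add: c.C.join_rearrange(3))
    \<comment> \<open>Only monotonicity is used on the side of \<open>C\<close>: \<open>z\<close>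
      will be either factor of the rectangle.\<close>
    have le': "e a \<sqinter>\<^bsub>C\<^esub> d b \<sqsubseteq>\<^bsub>C\<^esub> ?V \<squnion>\<^bsub>C\<^esub> z"
      if z: "e p \<sqinter>\<^bsub>C\<^esub> d q \<sqsubseteq>\<^bsub>C\<^esub> z" "z \<in> carrier C" for z
    proof (rule c.C.le_trans[OF le])
      show "?V \<squnion>\<^bsub>C\<^esub> (e p \<sqinter>\<^bsub>C\<^esub> d q) \<sqsubseteq>\<^bsub>C\<^esub> ?V \<squnion>\<^bsub>C\<^esub> z"
        using V Y ccl z by (intro c.C.join_mono) simp_all
    qed (use V Y ccl z in simp_all)
    have "f a \<sqinter>\<^bsub>K\<^esub> g b \<sqsubseteq>\<^bsub>K\<^esub> (f (u \<squnion>\<^bsub>A\<^esub> p) \<squnion>\<^bsub>K\<^esub> g v) \<squnion>\<^bsub>K\<^esub> Z"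
      unfolding Z_def
    proof (rule insert.IH[OF F])
      have "e a \<sqinter>\<^bsub>C\<^esub> d b \<sqsubseteq>\<^bsub>C\<^esub> ?V \<squnion>\<^bsub>C\<^esub> e p"
        by (rule le'[OF c.C.meet_left]) (simp_all add: ccl)
      then show "e a \<sqinter>\<^bsub>C\<^esub> d b \<sqsubseteq>\<^bsub>C\<^esub> (e (u \<squnion>\<^bsub>A\<^esub> p) \<squnion>\<^bsub>C\<^esub> d v) \<squnion>\<^bsub>C\<^esub> \<Squnion>\<^bsub>C\<^esub> ((\<lambda>(p, q). e p \<sqinter>\<^bsub>C\<^esub> d q) ` F)"
        unfolding Y_def[symmetric] frame_map_join[OF c.f insert.prems(2) pq(1)]
          c.C.join_rearrange(1)[OF ccl(1-3) Y] .
    qed (use insert.prems pq in simp_all)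
    then have 1: "f a \<sqinter>\<^bsub>K\<^esub> g b \<sqsubseteq>\<^bsub>K\<^esub> ?W \<squnion>\<^bsub>K\<^esub> f p"
      unfolding frame_map_join[OF h.f insert.prems(2) pq(1)] h.C.join_rearrange(1)[OF hcl(1-3) Z] .
    have "f a \<sqinter>\<^bsub>K\<^esub> g b \<sqsubseteq>\<^bsub>K\<^esub> (f u \<squnion>\<^bsub>K\<^esub> g (v \<squnion>\<^bsub>B\<^esub> q)) \<squnion>\<^bsub>K\<^esub> Z"
      unfolding Z_def
    proof (rule insert.IH[OF F])
      have "e a \<sqinter>\<^bsub>C\<^esub> d b \<sqsubseteq>\<^bsub>C\<^esub> ?V \<squnion>\<^bsub>C\<^esub> d q"
        by (rule le'[OF c.C.meet_right]) (simp_all add: ccl)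
      then show "e a \<sqinter>\<^bsub>C\<^esub> d b \<sqsubseteq>\<^bsub>C\<^esub> (e u \<squnion>\<^bsub>C\<^esub> d (v \<squnion>\<^bsub>B\<^esub> q)) \<squnion>\<^bsub>C\<^esub> \<Squnion>\<^bsub>C\<^esub> ((\<lambda>(p, q). e p \<sqinter>\<^bsub>C\<^esub> d q) ` F)"
        unfolding Y_def[symmetric] frame_map_join[OF c.g insert.prems(3) pq(2)]
          c.C.join_rearrange(2)[OF ccl(1,2,4) Y] .
    qed (use insert.prems pq in simp_all)
    then have 2: "f a \<sqinter>\<^bsub>K\<^esub> g b \<sqsubseteq>\<^bsub>K\<^esub> ?W \<squnion>\<^bsub>K\<^esub> g q"
      unfolding frame_map_join[OF h.g insert.prems(3) pq(2)] h.C.join_rearrange(2)[OF hcl(1,2,4) Z] .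
    \<comment> \<open>Distributivity of \<open>K\<close> reassembles the rectangle from its factors;
      this is the step that handles one rectangle at a time.\<close>
    have "f a \<sqinter>\<^bsub>K\<^esub> g b \<sqsubseteq>\<^bsub>K\<^esub> ?W \<squnion>\<^bsub>K\<^esub> (f p \<sqinter>\<^bsub>K\<^esub> g q)"
      by (rule h.C.le_join_meetI[OF _ W hcl(3,4) 1 2]) (simp add: hcl)
    moreover have "\<Squnion>\<^bsub>K\<^esub> ((\<lambda>(p, q). f p \<sqinter>\<^bsub>K\<^esub> g q) ` insert x F) = (f p \<sqinter>\<^bsub>K\<^esub> g q) \<squnion>\<^bsub>K\<^esub> Z"
      unfolding Z_def x image_insert prod.case by (rule h.C.Sup_insert[OF _ ZS]) (simp add: hcl)
    ultimately show ?case
      using hcl Z by (simp add: h.C.join_rearrange(3))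
  qed
qed

locale biframe_struct =
  fixes L :: "('p, 'n, 'm) biframe"
  assumes biframe: "L \<in> BiFrm"

text \<open>Seen as a cospan of its two embeddings, a biframe obtains its canonical map from the
  coproduct as a copairing. In this locale the facts \<open>f\<close> and \<open>g\<close> say that
  the embeddings are frame maps.\<close>

sublocale biframe_struct \<subseteq> frame_cospan "pos_part L" "neg_part L" "main_part L" "pos_emb L" "neg_emb L"
  using biframe by (simp add: frame_cospan_def frame_pair_def frame_cospan_axioms_def BiFrm_def)

context biframe_struct
begin

lemma rectangles_generate:
  "x \<in> carrier (main_part L) \<Longrightarrow> \<exists>S. S \<subseteq> rectangles L \<and> x = \<Squnion>\<^bsub>main_part L\<^esub> S"
  using biframe by (simp add: BiFrm_def)

abbreviation "canonical \<equiv> copairing (main_part L) (pos_emb L) (neg_emb L)"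

lemma canonical_rectangle:
  assumes "a \<in> carrier (pos_part L)" "b \<in> carrier (neg_part L)"
  shows "canonical (inl a \<sqinter>\<^bsub>AB\<^esub> inr b) = pos_emb L a \<sqinter>\<^bsub>main_part L\<^esub> neg_emb L b"
  using assms
  by (simp add: frame_map_meet[OF frame_map_copairing] C_ideal_inl C_ideal_inr copairing_inl copairing_inr)

text \<open>Generation of the main part by rectangles enters here. The set \<open>G\<close> collects
  every pair whose rectangle belongs to \<open>S\<close>, so no choice of indices is made.\<close>

lemma canonical_surj: "canonical ` carrier AB = carrier (main_part L)"
proof
  show "canonical ` carrier AB \<subseteq> carrier (main_part L)"
    using frame_map_closed[OF frame_map_copairing] by blast
  show "carrier (main_part L) \<subseteq> canonical ` carrier AB"
  proof
    fix x assume "x \<in> carrier (main_part L)"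
    then obtain S where S: "S \<subseteq> rectangles L" "x = \<Squnion>\<^bsub>main_part L\<^esub> S"
      using rectangles_generate by blast
    let ?P = "carrier (pos_part L) \<times> carrier (neg_part L)"
    define G where "G = {(a, b) \<in> ?P. pos_emb L a \<sqinter>\<^bsub>main_part L\<^esub> neg_emb L b \<in> S}"
    let ?r = "\<lambda>(a, b). inl a \<sqinter>\<^bsub>AB\<^esub> inr b"
    have G: "?r ` G \<subseteq> carrier AB" by (auto simp only: G_def intro!: rectangle_closed)
    have "canonical ` ?r ` G = (\<lambda>(a, b). pos_emb L a \<sqinter>\<^bsub>main_part L\<^esub> neg_emb L b) ` G"
      unfolding image_image by (rule image_cong) (auto simp: G_def canonical_rectangle)
    also have "\<dots> = S" using S(1) by (force simp: G_def rectangles_def)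
    finally have "x = canonical (\<Squnion>\<^bsub>AB\<^esub> (?r ` G))"
      by (simp only: frame_map_Sup[OF frame_map_copairing G] S(2))
    then show "x \<in> canonical ` carrier AB" using AB.sup_closed[OF G] by blast
  qed
qed

text \<open>Finitely many rectangles are re-indexed by finitely many pairs. The same pairs then name
  rectangles in the coproduct, in the main part of \<open>L\<close> and in a target frame, as the
  transfer of inequalities requires.\<close>

lemma fin_elements_coproductE:
  assumes "x \<in> fin_elements (coproduct_biframe (pos_part L) (neg_part L))"
  obtains G where "finite G" "G \<subseteq> carrier (pos_part L) \<times> carrier (neg_part L)"
    "x = \<Squnion>\<^bsub>AB\<^esub> ((\<lambda>(a, b). inl a \<sqinter>\<^bsub>AB\<^esub> inr b) ` G)"
proof -
  have "rectangles (coproduct_biframe (pos_part L) (neg_part L)) =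
      (\<lambda>(a, b). inl a \<sqinter>\<^bsub>AB\<^esub> inr b) ` (carrier (pos_part L) \<times> carrier (neg_part L))"
    by (force simp: rectangles_def coproduct_biframe_def)
  with assms obtain F where F: "finite F" "x = \<Squnion>\<^bsub>AB\<^esub> F"
    "F \<subseteq> (\<lambda>(a, b). inl a \<sqinter>\<^bsub>AB\<^esub> inr b) ` (carrier (pos_part L) \<times> carrier (neg_part L))"
    by (auto simp: fin_elements_def coproduct_biframe_def)
  from finite_subset_image[OF F(1,3)] obtain G
    where "G \<subseteq> carrier (pos_part L) \<times> carrier (neg_part L)" "finite G"
      "F = (\<lambda>(a, b). inl a \<sqinter>\<^bsub>AB\<^esub> inr b) ` G"
    by blast
  then show thesis using that F(2) by simp
qed

lemma rectangles_pairs_closed: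
  "G \<subseteq> carrier (pos_part L) \<times> carrier (neg_part L) \<Longrightarrow> (\<lambda>(a, b). inl a \<sqinter>\<^bsub>AB\<^esub> inr b) ` G \<subseteq> carrier AB"
  by (auto simp only: intro!: rectangle_closed)

end

lemma (in frame_cospan) copairing_Sup_rectangles:
  assumes G: "G \<subseteq> carrier A \<times> carrier B"
  shows "copairing C f g (\<Squnion>\<^bsub>AB\<^esub> ((\<lambda>(a, b). inl a \<sqinter>\<^bsub>AB\<^esub> inr b) ` G)) = \<Squnion>\<^bsub>C\<^esub> ((\<lambda>(a, b). f a \<sqinter>\<^bsub>C\<^esub> g b) ` G)"
proof -
  let ?r = "\<lambda>(a, b). inl a \<sqinter>\<^bsub>AB\<^esub> inr b"
  have "?r ` G \<subseteq> carrier AB" using G by (auto simp only: intro!: rectangle_closed)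
  moreover have "copairing C f g ` ?r ` G = (\<lambda>(a, b). f a \<sqinter>\<^bsub>C\<^esub> g b) ` G"
    unfolding image_image using G
    by (intro image_cong) (auto simp: frame_map_meet[OF frame_map_copairing]
        C_ideal_inl C_ideal_inr copairing_inl copairing_inr)
  ultimately show ?thesis by (simp add: frame_map_Sup[OF frame_map_copairing])
qed

text \<open>Supplies the starting values \<open>u = \<bottom>\<close> and
  \<open>v = \<bottom>\<close> that bring an inequality into the shape of
  \<open>finite_join_le_transfer\<close>.\<close>

lemma (in frame_cospan) join_bottoms:
  assumes x: "x \<in> carrier C"
  shows "(f \<bottom>\<^bsub>A\<^esub> \<squnion>\<^bsub>C\<^esub> g \<bottom>\<^bsub>B\<^esub>) \<squnion>\<^bsub>C\<^esub> x = x"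
proof -
  have "\<bottom>\<^bsub>C\<^esub> \<squnion>\<^bsub>C\<^esub> y = y" if "y \<in> carrier C" for y
    using that C.le_iff_meet[of "\<bottom>\<^bsub>C\<^esub>" y] by (simp add: C.bottom_lower)
  then show ?thesis
    using x by (simp add: frame_map_bottom[OF A.frame_axioms C.frame_axioms f]
        frame_map_bottom[OF B.frame_axioms C.frame_axioms g])
qed

text \<open>The copairing of \<open>f\<close> and \<open>g\<close> always exists on the coproduct.
  The question is whether its kernel contains that of the canonical map, and finitariness allows
  this to be tested on a relation between finite joins of rectangles.\<close>

lemma (in biframe_struct) finitary_extension:
  assumes fin: "L \<in> BiFrm_fin" and "frame K"
    and f: "frame_map (pos_part L) K f" and g: "frame_map (neg_part L) K g"
    and hyp: "\<And>a b u v. \<lbrakk>a \<in> carrier (pos_part L); b \<in> carrier (neg_part L);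
      u \<in> carrier (pos_part L); v \<in> carrier (neg_part L);
      pos_emb L a \<sqinter>\<^bsub>main_part L\<^esub> neg_emb L b \<sqsubseteq>\<^bsub>main_part L\<^esub> pos_emb L u \<squnion>\<^bsub>main_part L\<^esub> neg_emb L v\<rbrakk>
      \<Longrightarrow> f a \<sqinter>\<^bsub>K\<^esub> g b \<sqsubseteq>\<^bsub>K\<^esub> f u \<squnion>\<^bsub>K\<^esub> g v"
  obtains k where "frame_map (main_part L) K k"
    "\<And>a. a \<in> carrier (pos_part L) \<Longrightarrow> k (pos_emb L a) = f a"
    "\<And>b. b \<in> carrier (neg_part L) \<Longrightarrow> k (neg_emb L b) = g b"
proof -
  interpret K: frame K by fact
  interpret h: frame_cospan "pos_part L" "neg_part L" K f g
    by unfold_locales (rule f g)+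
  have cospan: "frame_cospan (pos_part L) (neg_part L) (main_part L) (pos_emb L) (neg_emb L)"
    "frame_cospan (pos_part L) (neg_part L) K f g"
    by (rule frame_cospan_axioms h.frame_cospan_axioms)+
  let ?h = "copairing K f g"
  obtain R where R: "R \<subseteq> fin_elements (coproduct_biframe (pos_part L) (neg_part L)) \<times>
      fin_elements (coproduct_biframe (pos_part L) (neg_part L))"
    and gen: "canonical_congruence L = generated_congruence AB R"
    using fin by (auto simp: BiFrm_fin_def finitary_congruence_def coproduct_biframe_def)
  have finc: "fin_elements (coproduct_biframe (pos_part L) (neg_part L)) \<subseteq> carrier AB"
  proof
    fix x assume "x \<in> fin_elements (coproduct_biframe (pos_part L) (neg_part L))"
    then show "x \<in> carrier AB"
      by (rule fin_elements_coproductE) (simp only: AB.sup_closed[OF rectangles_pairs_closed])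
  qed
  have RAB: "R \<subseteq> carrier AB \<times> carrier AB" using R finc by auto
  have "?h r \<sqsubseteq>\<^bsub>K\<^esub> ?h s" if rs: "(r, s) \<in> R" for r s
  proof -
    have rfin: "r \<in> fin_elements (coproduct_biframe (pos_part L) (neg_part L))"
      and sfin: "s \<in> fin_elements (coproduct_biframe (pos_part L) (neg_part L))"
      using rs R by auto
    from rfin obtain G where G: "finite G" "G \<subseteq> carrier (pos_part L) \<times> carrier (neg_part L)"
      and r: "r = \<Squnion>\<^bsub>AB\<^esub> ((\<lambda>(a, b). inl a \<sqinter>\<^bsub>AB\<^esub> inr b) ` G)"
      by (rule fin_elements_coproductE)
    from sfin obtain H where H: "finite H" "H \<subseteq> carrier (pos_part L) \<times> carrier (neg_part L)"
      and s: "s = \<Squnion>\<^bsub>AB\<^esub> ((\<lambda>(a, b). inl a \<sqinter>\<^bsub>AB\<^esub> inr b) ` H)"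
      by (rule fin_elements_coproductE)
    have rsc: "r \<in> carrier AB" "s \<in> carrier AB" using rs RAB by auto
    \<comment> \<open>The relation generates the kernel of the canonical map, so each of its
      inequalities holds in \<open>L\<close>; there it can be split into rectangles and transferred
      to \<open>K\<close>.\<close>
    have "(r \<sqinter>\<^bsub>AB\<^esub> s, r) \<in> frame_kernel AB canonical"
      using generated_congruence_contains[OF rs, of AB] gen by (simp add: canonical_congruence_def)
    then have cle: "canonical r \<sqsubseteq>\<^bsub>main_part L\<^esub> canonical s"
      using rsc frame_map_meet[OF frame_map_copairing rsc]
      by (simp add: frame_kernel_def C.le_iff_meet_eq copairing_closed)
    show ?thesis
      unfolding r h.copairing_Sup_rectangles[OF G(2)]
    proof (rule K.sup_least)
      show "(\<lambda>(a, b). f a \<sqinter>\<^bsub>K\<^esub> g b) ` G \<subseteq> carrier K" using G(2) by (auto intro: h.rect_closed)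
      show "?h s \<in> carrier K" using rsc by (simp add: h.copairing_closed)
      fix x assume "x \<in> (\<lambda>(a, b). f a \<sqinter>\<^bsub>K\<^esub> g b) ` G"
      then obtain a b where ab: "(a, b) \<in> G" "x = f a \<sqinter>\<^bsub>K\<^esub> g b" by auto
      then have abc: "a \<in> carrier (pos_part L)" "b \<in> carrier (neg_part L)" using G(2) by auto
      have "pos_emb L a \<sqinter>\<^bsub>main_part L\<^esub> neg_emb L b \<sqsubseteq>\<^bsub>main_part L\<^esub> canonical r"
        unfolding r copairing_Sup_rectangles[OF G(2)]
        using G(2) ab(1) by (intro C.sup_upper) (auto intro: rect_closed)
      then have "pos_emb L a \<sqinter>\<^bsub>main_part L\<^esub> neg_emb L b \<sqsubseteq>\<^bsub>main_part L\<^esub> canonical s"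
        by (rule C.le_trans[OF _ cle]) (use rsc abc in \<open>simp_all add: rect_closed copairing_closed\<close>)
      \<comment> \<open>No factor has been absorbed yet, so both accumulating terms start at
        bottom.\<close>
      then have "pos_emb L a \<sqinter>\<^bsub>main_part L\<^esub> neg_emb L b \<sqsubseteq>\<^bsub>main_part L\<^esub>
          (pos_emb L \<bottom>\<^bsub>pos_part L\<^esub> \<squnion>\<^bsub>main_part L\<^esub> neg_emb L \<bottom>\<^bsub>neg_part L\<^esub>) \<squnion>\<^bsub>main_part L\<^esub>
          \<Squnion>\<^bsub>main_part L\<^esub> ((\<lambda>(a, b). pos_emb L a \<sqinter>\<^bsub>main_part L\<^esub> neg_emb L b) ` H)"
        using rsc(2) by (simp add: copairing_Sup_rectangles[OF H(2), folded s, symmetric]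
            join_bottoms copairing_closed)
      then have "f a \<sqinter>\<^bsub>K\<^esub> g b \<sqsubseteq>\<^bsub>K\<^esub> (f \<bottom>\<^bsub>pos_part L\<^esub> \<squnion>\<^bsub>K\<^esub> g \<bottom>\<^bsub>neg_part L\<^esub>) \<squnion>\<^bsub>K\<^esub>
          \<Squnion>\<^bsub>K\<^esub> ((\<lambda>(a, b). f a \<sqinter>\<^bsub>K\<^esub> g b) ` H)"
        by (intro finite_join_le_transfer[OF cospan hyp H abc]) simp_all
      then show "x \<sqsubseteq>\<^bsub>K\<^esub> ?h s"
        using rsc(2) by (simp add: ab(2) h.copairing_Sup_rectangles[OF H(2), folded s, symmetric]
            h.join_bottoms h.copairing_closed)
    qed
  qed
  then have ker: "generated_congruence AB R \<subseteq> frame_kernel AB ?h"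
    by (intro generated_congruence_subset_kernel[OF AB.frame_axioms K.frame_axioms RAB
          h.frame_map_copairing])
  \<comment> \<open>The canonical map is onto and its kernel is contained in that of the copairing,
    so the copairing factors through the main part of \<open>L\<close>.\<close>
  obtain k where k: "frame_map (main_part L) K k" "\<And>x. x \<in> carrier AB \<Longrightarrow> k (canonical x) = ?h x"
  proof (rule frame_map_factor[OF AB.frame_axioms frame_map_copairing canonical_surj h.frame_map_copairing])
    fix x y assume xy: "x \<in> carrier AB" "y \<in> carrier AB" "canonical x = canonical y"
    then have "(x, y) \<in> canonical_congruence L"
      by (simp add: canonical_congruence_def frame_kernel_def)
    then show "?h x = ?h y" using ker gen by (auto simp: frame_kernel_def)
  qed (rule that)
  show thesis
  proof (rule that[OF k(1)])
    show "k (pos_emb L a) = f a" if "a \<in> carrier (pos_part L)" for a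
      using k(2)[of "inl a"] that by (simp add: C_ideal_inl copairing_inl h.copairing_inl)
    show "k (neg_emb L b) = g b" if "b \<in> carrier (neg_part L)" for b
      using k(2)[of "inr b"] that by (simp add: C_ideal_inr copairing_inr h.copairing_inr)
  qed
qed

section \<open>The biframe of a bispace\<close>

lemma frame_map_preimage:
  assumes f: "continuous_map T S f"
  shows "frame_map (opens_frame S) (opens_frame T) (\<lambda>U \<in> {U. openin S U}. {x \<in> topspace T. f x \<in> U})"
  unfolding frame_map_def
proof (intro conjI ballI allI impI)
  let ?p = "\<lambda>U \<in> {U. openin S U}. {x \<in> topspace T. f x \<in> U}"
  show "?p \<in> carrier (opens_frame S) \<rightarrow> carrier (opens_frame T)"
    using f by (auto intro: openin_continuous_map_preimage)
  show "?p \<top>\<^bsub>opens_frame S\<^esub> = \<top>\<^bsub>opens_frame T\<^esub>"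
    using continuous_map_image_subset_topspace[OF f] by (auto simp: opens_frame_ops)
  show "?p (U \<sqinter>\<^bsub>opens_frame S\<^esub> V) = ?p U \<sqinter>\<^bsub>opens_frame T\<^esub> ?p V"
    if "U \<in> carrier (opens_frame S)" "V \<in> carrier (opens_frame S)" for U V
    using that f openin_continuous_map_preimage[OF f] by (auto simp: opens_frame_ops openin_Int)
next
  let ?p = "\<lambda>U \<in> {U. openin S U}. {x \<in> topspace T. f x \<in> U}"
  fix \<U> assume U: "\<U> \<subseteq> carrier (opens_frame S)"
  then have "openin S (\<Union> \<U>)" by auto
  moreover have "\<forall>V \<in> ?p ` \<U>. openin T V"
    using U openin_continuous_map_preimage[OF f] by auto
  ultimately show "?p (\<Squnion>\<^bsub>opens_frame S\<^esub> \<U>) = \<Squnion>\<^bsub>opens_frame T\<^esub> (?p ` \<U>)"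
    using U by (auto simp: opens_frame_ops subset_iff)
qed

lemma frame_map_point: "x \<in> topspace T \<Longrightarrow> frame_map (opens_frame T) two_frame (\<lambda>U. x \<in> U)"
  by (auto simp: frame_map_two_iff opens_frame_ops subset_iff)

locale bispace_struct =
  fixes X :: "'x bispace"
  assumes bispace: "X \<in> BiTop"

sublocale bispace_struct \<subseteq> frame_pair "opens_frame (pos_top X)" "opens_frame (neg_top X)"
  by (simp add: frame_pair_def opens_frame)

context bispace_struct
begin

lemma topspace_pos: "topspace (pos_top X) = points X"
  and topspace_neg: "topspace (neg_top X) = points X"
  using bispace by (simp_all add: BiTop_def points_def)

lemma Omega_fin_simps:
  "Omega_fin_coproduct X = AB" "open_inl X = inl" "open_inr X = inr"
  by (simp_all add: Omega_fin_coproduct_def open_inl_def open_inr_def)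

lemma Omega_fin_relI:
  "\<lbrakk>openin (pos_top X) U; openin (neg_top X) U'; openin (pos_top X) V; openin (neg_top X) V';
    U \<inter> U' \<subseteq> V \<union> V'\<rbrakk> \<Longrightarrow> (inl U \<sqinter>\<^bsub>AB\<^esub> inr U', inl V \<squnion>\<^bsub>AB\<^esub> inr V') \<in> Omega_fin_rel X"
  unfolding Omega_fin_rel_def Omega_fin_simps by blast

lemma Omega_fin_relE:
  assumes "(r, s) \<in> Omega_fin_rel X"
  obtains U U' V V' where "openin (pos_top X) U" "openin (neg_top X) U'"
    "openin (pos_top X) V" "openin (neg_top X) V'" "U \<inter> U' \<subseteq> V \<union> V'"
    "r = inl U \<sqinter>\<^bsub>AB\<^esub> inr U'" "s = inl V \<squnion>\<^bsub>AB\<^esub> inr V'"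
  using assms unfolding Omega_fin_rel_def Omega_fin_simps by blast

lemma inl_closed: "openin (pos_top X) U \<Longrightarrow> inl U \<in> carrier AB"
  and inr_closed: "openin (neg_top X) V \<Longrightarrow> inr V \<in> carrier AB"
  by (simp_all add: C_ideal_inl C_ideal_inr)

lemma Omega_fin_rel_closed: "Omega_fin_rel X \<subseteq> carrier AB \<times> carrier AB"
proof clarify
  fix r s assume "(r, s) \<in> Omega_fin_rel X"
  then show "r \<in> carrier AB \<and> s \<in> carrier AB"
    by (rule Omega_fin_relE) (simp only: AB.meet_closed AB.join_closed inl_closed inr_closed)
qed

lemma fin_elements_coproductI:
  assumes "finite F" "F \<subseteq> {inl U \<sqinter>\<^bsub>AB\<^esub> inr V | U V. openin (pos_top X) U \<and> openin (neg_top X) V}"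
  shows "\<Squnion>\<^bsub>AB\<^esub> F \<in> fin_elements (coproduct_biframe (opens_frame (pos_top X)) (opens_frame (neg_top X)))"
  using assms by (auto simp: fin_elements_def coproduct_biframe_def rectangles_def)

text \<open>Each left side is a single rectangle. Each right side becomes a join of two rectangles
  after its summands are met with the top of the opposite part.\<close>

lemma Omega_fin_rel_fin:
  "Omega_fin_rel X \<subseteq> fin_elements (coproduct_biframe (opens_frame (pos_top X)) (opens_frame (neg_top X))) \<times>
     fin_elements (coproduct_biframe (opens_frame (pos_top X)) (opens_frame (neg_top X)))"
    (is "_ \<subseteq> ?F \<times> ?F")
proof clarify
  fix r s assume "(r, s) \<in> Omega_fin_rel X"
  then obtain U U' V V' where o: "openin (pos_top X) U" "openin (neg_top X) U'"
    "openin (pos_top X) V" "openin (neg_top X) V'"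
    and r: "r = inl U \<sqinter>\<^bsub>AB\<^esub> inr U'" and s: "s = inl V \<squnion>\<^bsub>AB\<^esub> inr V'"
    by (rule Omega_fin_relE)
  have "r \<in> carrier AB" unfolding r by (simp only: AB.meet_closed inl_closed inr_closed o)
  then have "r = \<Squnion>\<^bsub>AB\<^esub> {r}" by (rule AB.sup_of_singleton[symmetric])
  moreover have "\<Squnion>\<^bsub>AB\<^esub> {r} \<in> ?F" by (rule fin_elements_coproductI) (use o r in auto)
  ultimately have rF: "r \<in> ?F" by simp
  note top = openin_topspace[of "pos_top X"] openin_topspace[of "neg_top X"]
  have "s = \<Squnion>\<^bsub>AB\<^esub> {inl V \<sqinter>\<^bsub>AB\<^esub> inr (topspace (neg_top X)), inl (topspace (pos_top X)) \<sqinter>\<^bsub>AB\<^esub> inr V'}"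
    using frame_map_top[OF frame_map_inl] frame_map_top[OF frame_map_inr] inl_closed[OF o(3)] inr_closed[OF o(4)]
    by (simp add: s opens_frame_ops AB.meet_top AB.top_meet_eq join_def)
  also have "\<dots> \<in> ?F" by (rule fin_elements_coproductI) (use o top in auto)
  finally show "r \<in> ?F \<and> s \<in> ?F" using rF by simp
qed

end

sublocale bispace_struct \<subseteq> presented_frame AB "Omega_fin_rel X"
  by unfold_locales (rule Omega_fin_rel_closed)

context bispace_struct
begin

lemma bOmega_fin_simps:
  "pos_part (bOmega_fin X) = opens_frame (pos_top X)"
  "neg_part (bOmega_fin X) = opens_frame (neg_top X)"
  "main_part (bOmega_fin X) = Q"
  "pos_emb (bOmega_fin X) = (\<lambda>U. q (inl U))"
  "neg_emb (bOmega_fin X) = (\<lambda>V. q (inr V))"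
  by (simp_all add: bOmega_fin_def Omega_fin_simps)

text \<open>Membership of \<open>x\<close> defines a map from the coproduct to truth values, and it
  descends to the quotient because an inclusion
  \<open>U \<inter> U' \<subseteq> V \<union> V'\<close> is in particular an implication at
  \<open>x\<close>. These evaluations detect which opens and inequalities stay distinct in the
  quotient.\<close>

lemma point_evaluation:
  assumes x: "x \<in> points X"
  obtains k where "frame_map Q two_frame k"
    "\<And>U. openin (pos_top X) U \<Longrightarrow> k (q (inl U)) \<longleftrightarrow> x \<in> U"
    "\<And>V. openin (neg_top X) V \<Longrightarrow> k (q (inr V)) \<longleftrightarrow> x \<in> V"
proof -
  have xx: "x \<in> topspace (pos_top X)" "x \<in> topspace (neg_top X)"
    using x by (simp_all add: topspace_pos topspace_neg)
  interpret e: frame_cospan "opens_frame (pos_top X)" "opens_frame (neg_top X)" two_frame "\<lambda>U. x \<in> U" "\<lambda>U. x \<in> U"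
    using frame_map_point[OF xx(1)] frame_map_point[OF xx(2)] frame_pair_axioms
    by (simp add: frame_cospan_def frame_cospan_axioms_def two_frame)
  let ?h = "copairing two_frame (\<lambda>U. x \<in> U) (\<lambda>U. x \<in> U)"
  have inl: "?h (inl U) \<longleftrightarrow> x \<in> U" if "openin (pos_top X) U" for U
    using that by (simp add: e.copairing_inl)
  have inr: "?h (inr U) \<longleftrightarrow> x \<in> U" if "openin (neg_top X) U" for U
    using that by (simp add: e.copairing_inr)
  have le: "?h r \<sqsubseteq>\<^bsub>two_frame\<^esub> ?h s" if "(r, s) \<in> Omega_fin_rel X" for r s
    using that
  proof (rule Omega_fin_relE)
    fix U U' V V'
    assume o: "openin (pos_top X) U" "openin (neg_top X) U'" "openin (pos_top X) V" "openin (neg_top X) V'"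
      and sub: "U \<inter> U' \<subseteq> V \<union> V'" and rs: "r = inl U \<sqinter>\<^bsub>AB\<^esub> inr U'" "s = inl V \<squnion>\<^bsub>AB\<^esub> inr V'"
    have "?h r \<longleftrightarrow> x \<in> U \<and> x \<in> U'"
      unfolding rs frame_map_meet[OF e.frame_map_copairing inl_closed[OF o(1)] inr_closed[OF o(2)]]
      by (simp add: two_frame_ops inl inr o)
    moreover have "?h s \<longleftrightarrow> x \<in> V \<or> x \<in> V'"
      unfolding rs frame_map_join[OF e.frame_map_copairing inl_closed[OF o(3)] inr_closed[OF o(4)]]
      by (simp add: two_frame_ops inl inr o)
    ultimately show ?thesis using sub by auto
  qed
  obtain k where k: "frame_map Q two_frame k" "\<And>I. I \<in> carrier AB \<Longrightarrow> k (q I) = ?h I"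
    by (rule quotient_universal[OF two_frame e.frame_map_copairing le]) auto
  show thesis
    by (rule that[OF k(1)]) (simp_all only: k(2) inl_closed inr_closed inl inr)
qed

lemma bOmega_fin_BiFrm: "bOmega_fin X \<in> BiFrm"
proof -
  \<comment> \<open>Evaluation at \<open>x\<close> depends only on the class of
    \<open>inl U\<close>, so opens with equal classes have the same points.\<close>
  have inj_l: "U \<subseteq> V" if "openin (pos_top X) U" "openin (pos_top X) V" "q (inl U) = q (inl V)" for U V
  proof
    fix x assume "x \<in> U"
    then have "x \<in> points X" using openin_subset[OF that(1)] by (auto simp: topspace_pos)
    then obtain k where "frame_map Q two_frame k"
      and "\<And>U. openin (pos_top X) U \<Longrightarrow> k (q (inl U)) \<longleftrightarrow> x \<in> U"
      and "\<And>U. openin (neg_top X) U \<Longrightarrow> k (q (inr U)) \<longleftrightarrow> x \<in> U"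
      by (rule point_evaluation) (rule that)
    from this(2)[OF that(1)] this(2)[OF that(2)] show "x \<in> V" using that(3) \<open>x \<in> U\<close> by simp
  qed
  have inj_r: "U \<subseteq> V" if "openin (neg_top X) U" "openin (neg_top X) V" "q (inr U) = q (inr V)" for U V
  proof
    fix x assume "x \<in> U"
    then have "x \<in> points X" using openin_subset[OF that(1)] by (auto simp: topspace_neg)
    then obtain k where "frame_map Q two_frame k"
      and "\<And>U. openin (pos_top X) U \<Longrightarrow> k (q (inl U)) \<longleftrightarrow> x \<in> U"
      and "\<And>U. openin (neg_top X) U \<Longrightarrow> k (q (inr U)) \<longleftrightarrow> x \<in> U"
      by (rule point_evaluation) (rule that)
    from this(3)[OF that(1)] this(3)[OF that(2)] show "x \<in> V" using that(3) \<open>x \<in> U\<close> by simp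
  qed
  \<comment> \<open>Every element is the class of a \<open>C\<close>-ideal, which is a join of
    rectangles; the quotient map preserves that join and each rectangle in it.\<close>
  have gen: "\<exists>S. S \<subseteq> rectangles (bOmega_fin X) \<and> x = \<Squnion>\<^bsub>Q\<^esub> S" if x: "x \<in> carrier Q" for x
  proof -
    obtain I where I: "C_ideal (opens_frame (pos_top X)) (opens_frame (neg_top X)) I" "x = q I"
      using x by (auto simp: carrier_Q)
    let ?S = "{inl U \<sqinter>\<^bsub>AB\<^esub> inr V | U V. (U, V) \<in> I}"
    have mem: "openin (pos_top X) U \<and> openin (neg_top X) V" if "(U, V) \<in> I" for U V
      using C_ideal_subset[OF I(1)] that by auto
    then have S: "?S \<subseteq> carrier AB"
      using AB.meet_closed[OF inl_closed inr_closed] by blast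
    have "x = \<Squnion>\<^bsub>Q\<^esub> (q ` ?S)"
      using C_ideal_eq_Sup[OF I(1)] I(2) frame_map_Sup[OF frame_map_q S] by simp
    moreover have "q ` ?S \<subseteq> rectangles (bOmega_fin X)"
    proof clarify
      fix U V assume UV: "(U, V) \<in> I"
      show "q (inl U \<sqinter>\<^bsub>AB\<^esub> inr V) \<in> rectangles (bOmega_fin X)"
        unfolding rectangles_def bOmega_fin_simps
        using mem[OF UV] frame_map_meet[OF frame_map_q inl_closed[of U] inr_closed[of V]] by auto
    qed
    ultimately show ?thesis by blast
  qed
  show ?thesis
    unfolding BiFrm_def
  proof (intro CollectI conjI ballI)
    show "frame_map (pos_part (bOmega_fin X)) (main_part (bOmega_fin X)) (pos_emb (bOmega_fin X))"
      unfolding bOmega_fin_simps by (rule frame_map_comp[OF frame_map_inl frame_map_q])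
    show "frame_map (neg_part (bOmega_fin X)) (main_part (bOmega_fin X)) (neg_emb (bOmega_fin X))"
      unfolding bOmega_fin_simps by (rule frame_map_comp[OF frame_map_inr frame_map_q])
    show "inj_on (pos_emb (bOmega_fin X)) (carrier (pos_part (bOmega_fin X)))"
      using inj_l by (intro inj_onI equalityI) (simp_all add: bOmega_fin_simps)
    show "inj_on (neg_emb (bOmega_fin X)) (carrier (neg_part (bOmega_fin X)))"
      using inj_r by (intro inj_onI equalityI) (simp_all add: bOmega_fin_simps)
  qed (use gen in \<open>simp_all add: bOmega_fin_simps opens_frame quotient_frame\<close>)
qed

end

sublocale bispace_struct \<subseteq> bO: biframe_struct "bOmega_fin X"
  by unfold_locales (rule bOmega_fin_BiFrm)

context bispace_struct
begin

text \<open>By uniqueness of maps out of the coproduct the canonical map is the quotient map itself.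
  Its kernel is therefore the congruence generated by \<open>Omega_fin_rel X\<close>, whose entries
  are finite joins of rectangles.\<close>

lemma bOmega_fin_BiFrm_fin: "bOmega_fin X \<in> BiFrm_fin"
proof -
  have "copairing Q (\<lambda>U. q (inl U)) (\<lambda>V. q (inr V)) I = q I" if "I \<in> carrier AB" for I
  proof (rule frame_map_coproduct_unique[OF bO.frame_map_copairing[unfolded bOmega_fin_simps] frame_map_q _ _ that])
    show "copairing Q (\<lambda>U. q (inl U)) (\<lambda>V. q (inr V)) (inl U) = q (inl U)"
      if "U \<in> carrier (opens_frame (pos_top X))" for U
      using bO.copairing_inl[unfolded bOmega_fin_simps, OF that] .
    show "copairing Q (\<lambda>U. q (inl U)) (\<lambda>V. q (inr V)) (inr U) = q (inr U)"
      if "U \<in> carrier (opens_frame (neg_top X))" for U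
      using bO.copairing_inr[unfolded bOmega_fin_simps, OF that] .
  qed
  then have "canonical_congruence (bOmega_fin X) = frame_kernel AB q"
    unfolding canonical_congruence_def frame_kernel_def bOmega_fin_simps by auto
  then have "canonical_congruence (bOmega_fin X) = generated_congruence AB (Omega_fin_rel X)"
    by (simp add: frame_kernel_q)
  moreover have "main_part (coproduct_biframe A B) = coproduct_frame A B" for A :: "'x set gorder" and B :: "'x set gorder"
    by (simp add: coproduct_biframe_def)
  ultimately show ?thesis
    unfolding BiFrm_fin_def finitary_congruence_def bOmega_fin_simps
    by (intro CollectI conjI exI[of _ "Omega_fin_rel X"] bOmega_fin_BiFrm)
      (simp_all add: bOmega_fin_simps Omega_fin_rel_fin)
qed

text \<open>The relation imposes the inequality for every such inclusion, and evaluation at a point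
  refutes it when the inclusion fails. The hypothesis of \<open>finitary_extension\<close> thereby
  turns into a statement about sets.\<close>

lemma bOmega_fin_le_iff:
  assumes o: "openin (pos_top X) U" "openin (neg_top X) U'" "openin (pos_top X) V" "openin (neg_top X) V'"
  shows "q (inl U) \<sqinter>\<^bsub>Q\<^esub> q (inr U') \<sqsubseteq>\<^bsub>Q\<^esub> q (inl V) \<squnion>\<^bsub>Q\<^esub> q (inr V') \<longleftrightarrow> U \<inter> U' \<subseteq> V \<union> V'"
proof
  note cl = q_closed[OF inl_closed[OF o(1)]] q_closed[OF inr_closed[OF o(2)]]
    q_closed[OF inl_closed[OF o(3)]] q_closed[OF inr_closed[OF o(4)]]
  assume le: "q (inl U) \<sqinter>\<^bsub>Q\<^esub> q (inr U') \<sqsubseteq>\<^bsub>Q\<^esub> q (inl V) \<squnion>\<^bsub>Q\<^esub> q (inr V')"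
  show "U \<inter> U' \<subseteq> V \<union> V'"
  proof
    fix x assume x: "x \<in> U \<inter> U'"
    then have "x \<in> points X" using openin_subset[OF o(1)] by (auto simp: topspace_pos)
    then obtain k where k: "frame_map Q two_frame k"
      and kl: "\<And>U. openin (pos_top X) U \<Longrightarrow> k (q (inl U)) \<longleftrightarrow> x \<in> U"
      and kr: "\<And>U. openin (neg_top X) U \<Longrightarrow> k (q (inr U)) \<longleftrightarrow> x \<in> U"
      by (rule point_evaluation) (rule that)
    have "k (q (inl U) \<sqinter>\<^bsub>Q\<^esub> q (inr U')) \<sqsubseteq>\<^bsub>two_frame\<^esub> k (q (inl V) \<squnion>\<^bsub>Q\<^esub> q (inr V'))"
      by (rule frame_map_mono[OF Q.frame_axioms two_frame k _ _ le]) (simp_all add: cl)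
    then show "x \<in> V \<union> V'"
      using x by (simp add: frame_map_meet[OF k] frame_map_join[OF k] cl two_frame_ops kl kr o)
  qed
next
  assume "U \<inter> U' \<subseteq> V \<union> V'"
  from q_relation[OF Omega_fin_relI[OF o this]]
  show "q (inl U) \<sqinter>\<^bsub>Q\<^esub> q (inr U') \<sqsubseteq>\<^bsub>Q\<^esub> q (inl V) \<squnion>\<^bsub>Q\<^esub> q (inr V')"
    by (simp only: frame_map_meet[OF frame_map_q] frame_map_join[OF frame_map_q] inl_closed inr_closed o)
qed

end

section \<open>Homomorphisms, points and the counit\<close>

lemma biframe_homI:
  assumes "fp \<in> extensional (carrier (pos_part L))" "frame_map (pos_part L) (pos_part M) fp"
    "fn \<in> extensional (carrier (neg_part L))" "frame_map (neg_part L) (neg_part M) fn"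
    "frame_map (main_part L) (main_part M) k"
    "\<And>a. a \<in> carrier (pos_part L) \<Longrightarrow> k (pos_emb L a) = pos_emb M (fp a)"
    "\<And>b. b \<in> carrier (neg_part L) \<Longrightarrow> k (neg_emb L b) = neg_emb M (fn b)"
  shows "(fp, fn) \<in> biframe_hom L M"
  using assms by (auto simp: biframe_hom_def)

lemma biframe_homE:
  assumes "f \<in> biframe_hom L M"
  obtains k where "fst f \<in> extensional (carrier (pos_part L))" "frame_map (pos_part L) (pos_part M) (fst f)"
    "snd f \<in> extensional (carrier (neg_part L))" "frame_map (neg_part L) (neg_part M) (snd f)"
    "frame_map (main_part L) (main_part M) k"
    "\<And>a. a \<in> carrier (pos_part L) \<Longrightarrow> k (pos_emb L a) = pos_emb M (fst f a)"
    "\<And>b. b \<in> carrier (neg_part L) \<Longrightarrow> k (neg_emb L b) = neg_emb M (snd f b)"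
  using assms by (auto simp: biframe_hom_def)

lemma biframe_hom_maps:
  assumes "f \<in> biframe_hom L M"
  shows "fst f \<in> extensional (carrier (pos_part L))" "frame_map (pos_part L) (pos_part M) (fst f)"
    "snd f \<in> extensional (carrier (neg_part L))" "frame_map (neg_part L) (neg_part M) (snd f)"
  using assms by (auto simp: biframe_hom_def)

lemma biframe_hom_closed:
  assumes "f \<in> biframe_hom L M"
  shows "a \<in> carrier (pos_part L) \<Longrightarrow> fst f a \<in> carrier (pos_part M)"
    "b \<in> carrier (neg_part L) \<Longrightarrow> snd f b \<in> carrier (neg_part M)"
  by (simp_all add: frame_map_closed[OF biframe_hom_maps(2)[OF assms]]
      frame_map_closed[OF biframe_hom_maps(4)[OF assms]])

lemma biframe_comp_simps [simp]:
  "a \<in> carrier (pos_part L) \<Longrightarrow> fst (biframe_comp L g f) a = fst g (fst f a)"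
  "b \<in> carrier (neg_part L) \<Longrightarrow> snd (biframe_comp L g f) b = snd g (snd f b)"
  by (simp_all add: biframe_comp_def compose_def)

text \<open>Equality of arrows is decided on the two parts alone, as main components are not
  recorded. Extensionality reduces it further to values on the carriers.\<close>

lemma biframe_comp_eqI:
  assumes "fst h \<in> extensional (carrier (pos_part L))" "snd h \<in> extensional (carrier (neg_part L))"
    and "\<And>a. a \<in> carrier (pos_part L) \<Longrightarrow> fst g (fst f a) = fst h a"
    and "\<And>b. b \<in> carrier (neg_part L) \<Longrightarrow> snd g (snd f b) = snd h b"
  shows "biframe_comp L g f = h"
proof (rule prod_eqI)
  show "fst (biframe_comp L g f) = fst h"
    by (rule extensionalityI[where A = "carrier (pos_part L)"])
      (simp_all add: biframe_comp_def compose_def assms)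
  show "snd (biframe_comp L g f) = snd h"
    by (rule extensionalityI[where A = "carrier (neg_part L)"])
      (simp_all add: biframe_comp_def compose_def assms)
qed

lemma frame_map_compose:
  assumes A: "frame A" and f: "frame_map A B f" and g: "frame_map B C g"
  shows "frame_map A C (compose (carrier A) g f)"
  using frame_map_comp[OF f g] frame_map_cong[OF A, of "compose (carrier A) g f" "\<lambda>x. g (f x)" C]
  by (simp add: compose_def)

lemma (in biframe_struct) biframe_comp_hom:
  assumes f: "f \<in> biframe_hom L M" and g: "g \<in> biframe_hom M N"
  shows "biframe_comp L g f \<in> biframe_hom L N"
proof -
  from f obtain k where k: "frame_map (main_part L) (main_part M) k"
    "\<And>a. a \<in> carrier (pos_part L) \<Longrightarrow> k (pos_emb L a) = pos_emb M (fst f a)"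
    "\<And>b. b \<in> carrier (neg_part L) \<Longrightarrow> k (neg_emb L b) = neg_emb M (snd f b)"
    by (rule biframe_homE) (rule that)
  from g obtain l where l: "frame_map (main_part M) (main_part N) l"
    "\<And>a. a \<in> carrier (pos_part M) \<Longrightarrow> l (pos_emb M a) = pos_emb N (fst g a)"
    "\<And>b. b \<in> carrier (neg_part M) \<Longrightarrow> l (neg_emb M b) = neg_emb N (snd g b)"
    by (rule biframe_homE) (rule that)
  show ?thesis
    unfolding biframe_comp_def
  proof (rule biframe_homI)
    show "frame_map (main_part L) (main_part N) (\<lambda>x. l (k x))"
      by (rule frame_map_comp[OF k(1) l(1)])
    show "frame_map (pos_part L) (pos_part N) (compose (carrier (pos_part L)) (fst g) (fst f))"
      by (rule frame_map_compose[OF A.frame_axioms biframe_hom_maps(2)[OF f] biframe_hom_maps(2)[OF g]])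
    show "frame_map (neg_part L) (neg_part N) (compose (carrier (neg_part L)) (snd g) (snd f))"
      by (rule frame_map_compose[OF B.frame_axioms biframe_hom_maps(4)[OF f] biframe_hom_maps(4)[OF g]])
  qed (simp_all add: k l biframe_hom_closed[OF f] compose_def)
qed

text \<open>Taking preimages preserves inclusions
  \<open>a \<inter> b \<subseteq> u \<union> v\<close>, which on both sides are the simple
  inequalities by \<open>bOmega_fin_le_iff\<close>. As \<open>bOmega_fin Y\<close> is finitary, the
  pair of preimage maps extends.\<close>

lemma bOmega_fin_map_hom:
  assumes "X \<in> BiTop" "Y \<in> BiTop" and f: "f \<in> bitop_hom X Y"
  shows "bOmega_fin_map X Y f \<in> biframe_hom (bOmega_fin Y) (bOmega_fin X)"
proof -
  interpret X: bispace_struct X by unfold_locales fact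
  interpret Y: bispace_struct Y by unfold_locales fact
  let ?p = "\<lambda>U \<in> {U. openin (pos_top Y) U}. {x \<in> points X. f x \<in> U}"
  let ?n = "\<lambda>U \<in> {U. openin (neg_top Y) U}. {x \<in> points X. f x \<in> U}"
  have p: "frame_map (opens_frame (pos_top Y)) (opens_frame (pos_top X)) ?p"
    using frame_map_preimage[of "pos_top X" "pos_top Y" f] f by (simp add: bitop_hom_def X.topspace_pos)
  have n: "frame_map (opens_frame (neg_top Y)) (opens_frame (neg_top X)) ?n"
    using frame_map_preimage[of "neg_top X" "neg_top Y" f] f by (simp add: bitop_hom_def X.topspace_neg)
  have po: "openin (pos_top X) {x \<in> points X. f x \<in> U}" if "openin (pos_top Y) U" for U
    using frame_map_closed[OF p, of U] that by simp
  have no: "openin (neg_top X) {x \<in> points X. f x \<in> U}" if "openin (neg_top Y) U" for U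
    using frame_map_closed[OF n, of U] that by simp
  have hyp: "X.q (X.inl (?p a)) \<sqinter>\<^bsub>X.Q\<^esub> X.q (X.inr (?n b)) \<sqsubseteq>\<^bsub>X.Q\<^esub> X.q (X.inl (?p u)) \<squnion>\<^bsub>X.Q\<^esub> X.q (X.inr (?n v))"
    if c: "a \<in> carrier (opens_frame (pos_top Y))" "b \<in> carrier (opens_frame (neg_top Y))"
      "u \<in> carrier (opens_frame (pos_top Y))" "v \<in> carrier (opens_frame (neg_top Y))"
      and le: "Y.q (Y.inl a) \<sqinter>\<^bsub>Y.Q\<^esub> Y.q (Y.inr b) \<sqsubseteq>\<^bsub>Y.Q\<^esub> Y.q (Y.inl u) \<squnion>\<^bsub>Y.Q\<^esub> Y.q (Y.inr v)" for a b u v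
  proof -
    have o: "openin (pos_top Y) a" "openin (neg_top Y) b" "openin (pos_top Y) u" "openin (neg_top Y) v"
      using c by simp_all
    have "a \<inter> b \<subseteq> u \<union> v" using le by (simp only: Y.bOmega_fin_le_iff[OF o])
    then have "{x \<in> points X. f x \<in> a} \<inter> {x \<in> points X. f x \<in> b} \<subseteq>
        {x \<in> points X. f x \<in> u} \<union> {x \<in> points X. f x \<in> v}"
      by auto
    then show ?thesis
      using o by (simp add: X.bOmega_fin_le_iff[OF po no po no])
  qed
  obtain k where "frame_map Y.Q X.Q k"
    and "\<And>U. U \<in> carrier (opens_frame (pos_top Y)) \<Longrightarrow> k (Y.q (Y.inl U)) = X.q (X.inl (?p U))"
    and "\<And>V. V \<in> carrier (opens_frame (neg_top Y)) \<Longrightarrow> k (Y.q (Y.inr V)) = X.q (X.inr (?n V))"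
  proof (rule Y.bO.finitary_extension[OF Y.bOmega_fin_BiFrm_fin X.quotient_frame, unfolded Y.bOmega_fin_simps])
    show "frame_map (opens_frame (pos_top Y)) X.Q (\<lambda>U. X.q (X.inl (?p U)))"
      by (rule frame_map_comp[OF p frame_map_comp[OF X.frame_map_inl X.frame_map_q]])
    show "frame_map (opens_frame (neg_top Y)) X.Q (\<lambda>U. X.q (X.inr (?n U)))"
      by (rule frame_map_comp[OF n frame_map_comp[OF X.frame_map_inr X.frame_map_q]])
  qed (erule (4) hyp, rule that)
  moreover have "?p \<in> extensional (carrier (opens_frame (pos_top Y)))"
    "?n \<in> extensional (carrier (opens_frame (neg_top Y)))"
    by simp_all
  ultimately show ?thesis
    unfolding bOmega_fin_map_def using p n
    by (intro biframe_homI[where k = k]) (simp_all only: X.bOmega_fin_simps Y.bOmega_fin_simps)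
qed

lemma two_biframe_simps [simp]:
  "pos_part two_biframe = two_frame" "neg_part two_biframe = two_frame"
  "main_part two_biframe = two_frame" "pos_emb two_biframe = id" "neg_emb two_biframe = id"
  by (simp_all add: two_biframe_def)

text \<open>The evaluation from \<open>point_evaluation\<close> serves as the main component of this
  point.\<close>

lemma (in bispace_struct) psi_bpoints:
  assumes x: "x \<in> points X"
  shows "psi X x \<in> bpoints (bOmega_fin X)"
proof -
  from x obtain k where k: "frame_map Q two_frame k"
    "\<And>U. openin (pos_top X) U \<Longrightarrow> k (q (inl U)) \<longleftrightarrow> x \<in> U"
    "\<And>V. openin (neg_top X) V \<Longrightarrow> k (q (inr V)) \<longleftrightarrow> x \<in> V"
    by (rule point_evaluation) (rule that)
  have "frame_map (opens_frame T) two_frame (\<lambda>U \<in> {U. openin T U}. x \<in> U)" if "x \<in> topspace T" for T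
    using frame_map_point[OF that] frame_map_cong[OF opens_frame, of T "\<lambda>U \<in> {U. openin T U}. x \<in> U" "\<lambda>U. x \<in> U"]
    by simp
  then have "frame_map (opens_frame (pos_top X)) two_frame (\<lambda>U \<in> {U. openin (pos_top X) U}. x \<in> U)"
    "frame_map (opens_frame (neg_top X)) two_frame (\<lambda>U \<in> {U. openin (neg_top X) U}. x \<in> U)"
    using x by (simp_all add: topspace_pos topspace_neg)
  then have "(\<lambda>U \<in> {U. openin (pos_top X) U}. x \<in> U, \<lambda>U \<in> {U. openin (neg_top X) U}. x \<in> U)
      \<in> biframe_hom (bOmega_fin X) two_biframe"
    by (intro biframe_homI[where k = k]) (simp_all add: bOmega_fin_simps k)
  then show ?thesis using x by (simp add: bpoints_def psi_def)
qed

section \<open>The bispace of points and the counit\<close>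

lemma bpointsD:
  assumes "h \<in> bpoints L"
  shows "fst h \<in> extensional (carrier (pos_part L))" "frame_map (pos_part L) two_frame (fst h)"
    "snd h \<in> extensional (carrier (neg_part L))" "frame_map (neg_part L) two_frame (snd h)"
  using biframe_hom_maps[OF assms[unfolded bpoints_def]] by simp_all

lemma mem_phi:
  "a \<in> carrier (pos_part L) \<Longrightarrow> h \<in> phi_pos L a \<longleftrightarrow> h \<in> bpoints L \<and> fst h a"
  "b \<in> carrier (neg_part L) \<Longrightarrow> h \<in> phi_neg L b \<longleftrightarrow> h \<in> bpoints L \<and> snd h b"
  by (auto simp: phi_pos_def phi_neg_def)

lemma phi_extensional:
  "phi_pos L \<in> extensional (carrier (pos_part L))" "phi_neg L \<in> extensional (carrier (neg_part L))"
  by (simp_all add: phi_pos_def phi_neg_def)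

text \<open>A family of image sets is lifted to the set of all frame elements mapped into it; the
  join of that set is mapped to the union of the family.\<close>

lemma istopology_frame_image:
  assumes "frame A"
    and meet: "\<And>a b. \<lbrakk>a \<in> carrier A; b \<in> carrier A\<rbrakk> \<Longrightarrow> \<Phi> (a \<sqinter>\<^bsub>A\<^esub> b) = \<Phi> a \<inter> \<Phi> b"
    and Sup: "\<And>S. S \<subseteq> carrier A \<Longrightarrow> \<Phi> (\<Squnion>\<^bsub>A\<^esub> S) = \<Union> (\<Phi> ` S)"
  shows "istopology (\<lambda>U. U \<in> \<Phi> ` carrier A)"
proof -
  interpret A: frame A by fact
  have "U \<inter> V \<in> \<Phi> ` carrier A" if "U \<in> \<Phi> ` carrier A" "V \<in> \<Phi> ` carrier A" for U V
    using that by (auto simp: meet[symmetric])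
  moreover have "\<Union> \<K> \<in> \<Phi> ` carrier A" if K: "\<forall>K \<in> \<K>. K \<in> \<Phi> ` carrier A" for \<K>
  proof -
    define S where "S = {a \<in> carrier A. \<Phi> a \<in> \<K>}"
    have S: "S \<subseteq> carrier A" by (auto simp: S_def)
    have "\<K> = \<Phi> ` S" using K by (auto simp: S_def)
    then have "\<Union> \<K> = \<Phi> (\<Squnion>\<^bsub>A\<^esub> S)" by (simp add: Sup[OF S])
    then show ?thesis using A.sup_closed[OF S] by (rule image_eqI)
  qed
  ultimately show ?thesis by (simp add: istopology_def)
qed

context biframe_struct
begin

text \<open>Each clause is a preservation property of points, read for all points
  simultaneously.\<close>

lemma phi_pos_ops:
  shows "phi_pos L \<top>\<^bsub>pos_part L\<^esub> = bpoints L"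
    and "\<lbrakk>a \<in> carrier (pos_part L); b \<in> carrier (pos_part L)\<rbrakk> \<Longrightarrow>
      phi_pos L (a \<sqinter>\<^bsub>pos_part L\<^esub> b) = phi_pos L a \<inter> phi_pos L b"
    and "S \<subseteq> carrier (pos_part L) \<Longrightarrow> phi_pos L (\<Squnion>\<^bsub>pos_part L\<^esub> S) = \<Union> (phi_pos L ` S)"
proof -
  have h: "fst h \<top>\<^bsub>pos_part L\<^esub>"
    "\<lbrakk>a \<in> carrier (pos_part L); b \<in> carrier (pos_part L)\<rbrakk> \<Longrightarrow> fst h (a \<sqinter>\<^bsub>pos_part L\<^esub> b) \<longleftrightarrow> fst h a \<and> fst h b"
    "S \<subseteq> carrier (pos_part L) \<Longrightarrow> fst h (\<Squnion>\<^bsub>pos_part L\<^esub> S) \<longleftrightarrow> (\<exists>s \<in> S. fst h s)"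
    if "h \<in> bpoints L" for h a b S
    using bpointsD(2)[OF that] by (simp_all add: frame_map_two_iff)
  show "phi_pos L \<top>\<^bsub>pos_part L\<^esub> = bpoints L"
    by (rule Set.set_eqI) (auto simp only: mem_phi A.top_closed h(1))
  show "phi_pos L (a \<sqinter>\<^bsub>pos_part L\<^esub> b) = phi_pos L a \<inter> phi_pos L b"
    if "a \<in> carrier (pos_part L)" "b \<in> carrier (pos_part L)"
    by (rule Set.set_eqI) (auto simp only: mem_phi A.meet_closed Int_iff h(2) that)
  show "phi_pos L (\<Squnion>\<^bsub>pos_part L\<^esub> S) = \<Union> (phi_pos L ` S)" if S: "S \<subseteq> carrier (pos_part L)"
  proof (rule Set.set_eqI)
    fix x
    have "x \<in> \<Union> (phi_pos L ` S) \<longleftrightarrow> x \<in> bpoints L \<and> (\<exists>s \<in> S. fst x s)"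
      using S by (auto simp: mem_phi subset_iff)
    then show "x \<in> phi_pos L (\<Squnion>\<^bsub>pos_part L\<^esub> S) \<longleftrightarrow> x \<in> \<Union> (phi_pos L ` S)"
      using h(3)[OF _ S, of x] by (simp only: mem_phi A.sup_closed[OF S]) blast
  qed
qed

lemma phi_neg_ops:
  shows "phi_neg L \<top>\<^bsub>neg_part L\<^esub> = bpoints L"
    and "\<lbrakk>a \<in> carrier (neg_part L); b \<in> carrier (neg_part L)\<rbrakk> \<Longrightarrow>
      phi_neg L (a \<sqinter>\<^bsub>neg_part L\<^esub> b) = phi_neg L a \<inter> phi_neg L b"
    and "S \<subseteq> carrier (neg_part L) \<Longrightarrow> phi_neg L (\<Squnion>\<^bsub>neg_part L\<^esub> S) = \<Union> (phi_neg L ` S)"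
proof -
  have h: "snd h \<top>\<^bsub>neg_part L\<^esub>"
    "\<lbrakk>a \<in> carrier (neg_part L); b \<in> carrier (neg_part L)\<rbrakk> \<Longrightarrow> snd h (a \<sqinter>\<^bsub>neg_part L\<^esub> b) \<longleftrightarrow> snd h a \<and> snd h b"
    "S \<subseteq> carrier (neg_part L) \<Longrightarrow> snd h (\<Squnion>\<^bsub>neg_part L\<^esub> S) \<longleftrightarrow> (\<exists>s \<in> S. snd h s)"
    if "h \<in> bpoints L" for h a b S
    using bpointsD(4)[OF that] by (simp_all add: frame_map_two_iff)
  show "phi_neg L \<top>\<^bsub>neg_part L\<^esub> = bpoints L"
    by (rule Set.set_eqI) (auto simp only: mem_phi B.top_closed h(1))
  show "phi_neg L (a \<sqinter>\<^bsub>neg_part L\<^esub> b) = phi_neg L a \<inter> phi_neg L b"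
    if "a \<in> carrier (neg_part L)" "b \<in> carrier (neg_part L)"
    by (rule Set.set_eqI) (auto simp only: mem_phi B.meet_closed Int_iff h(2) that)
  show "phi_neg L (\<Squnion>\<^bsub>neg_part L\<^esub> S) = \<Union> (phi_neg L ` S)" if S: "S \<subseteq> carrier (neg_part L)"
  proof (rule Set.set_eqI)
    fix x
    have "x \<in> \<Union> (phi_neg L ` S) \<longleftrightarrow> x \<in> bpoints L \<and> (\<exists>s \<in> S. snd x s)"
      using S by (auto simp: mem_phi subset_iff)
    then show "x \<in> phi_neg L (\<Squnion>\<^bsub>neg_part L\<^esub> S) \<longleftrightarrow> x \<in> \<Union> (phi_neg L ` S)"
      using h(3)[OF _ S, of x] by (simp only: mem_phi B.sup_closed[OF S]) blast
  qed
qed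

lemma openin_bpt:
  "openin (pos_top (bpt L)) U \<longleftrightarrow> U \<in> phi_pos L ` carrier (pos_part L)"
  "openin (neg_top (bpt L)) U \<longleftrightarrow> U \<in> phi_neg L ` carrier (neg_part L)"
  using istopology_frame_image[OF A.frame_axioms phi_pos_ops(2,3)]
    istopology_frame_image[OF B.frame_axioms phi_neg_ops(2,3)]
  by (simp_all add: bpt_def topology_inverse')

lemma topspace_bpt:
  "topspace (pos_top (bpt L)) = bpoints L" "topspace (neg_top (bpt L)) = bpoints L"
proof -
  have "\<Union> (phi_pos L ` carrier (pos_part L)) = bpoints L"
  proof
    show "\<Union> (phi_pos L ` carrier (pos_part L)) \<subseteq> bpoints L" by (auto simp: mem_phi)
    show "bpoints L \<subseteq> \<Union> (phi_pos L ` carrier (pos_part L))"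
      unfolding phi_pos_ops(1)[symmetric] by (rule Union_upper[OF imageI[OF A.top_closed]])
  qed
  then show "topspace (pos_top (bpt L)) = bpoints L" by (simp add: topspace_def openin_bpt)
  have "\<Union> (phi_neg L ` carrier (neg_part L)) = bpoints L"
  proof
    show "\<Union> (phi_neg L ` carrier (neg_part L)) \<subseteq> bpoints L" by (auto simp: mem_phi)
    show "bpoints L \<subseteq> \<Union> (phi_neg L ` carrier (neg_part L))"
      unfolding phi_neg_ops(1)[symmetric] by (rule Union_upper[OF imageI[OF B.top_closed]])
  qed
  then show "topspace (neg_top (bpt L)) = bpoints L" by (simp add: topspace_def openin_bpt)
qed

lemma points_bpt: "points (bpt L) = bpoints L"
  by (simp add: points_def topspace_bpt)

lemma bpt_BiTop: "bpt L \<in> BiTop"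
  by (simp add: BiTop_def topspace_bpt)

lemma openin_phi:
  "a \<in> carrier (pos_part L) \<Longrightarrow> openin (pos_top (bpt L)) (phi_pos L a)"
  "b \<in> carrier (neg_part L) \<Longrightarrow> openin (neg_top (bpt L)) (phi_neg L b)"
  by (simp_all add: openin_bpt)

lemma frame_map_phi_pos: "frame_map (pos_part L) (opens_frame (pos_top (bpt L))) (phi_pos L)"
  unfolding frame_map_def
  by (auto simp: opens_frame_ops openin_phi phi_pos_ops topspace_bpt subset_iff)

lemma frame_map_phi_neg: "frame_map (neg_part L) (opens_frame (neg_top (bpt L))) (phi_neg L)"
  unfolding frame_map_def
  by (auto simp: opens_frame_ops openin_phi phi_neg_ops topspace_bpt subset_iff)

lemma phi_hom:
  assumes fin: "L \<in> BiFrm_fin"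
  shows "phi L \<in> biframe_hom L (bOmega_fin (bpt L))"
proof -
  interpret X: bispace_struct "bpt L" by unfold_locales (rule bpt_BiTop)
  have hyp: "X.q (X.inl (phi_pos L a)) \<sqinter>\<^bsub>X.Q\<^esub> X.q (X.inr (phi_neg L b)) \<sqsubseteq>\<^bsub>X.Q\<^esub>
      X.q (X.inl (phi_pos L u)) \<squnion>\<^bsub>X.Q\<^esub> X.q (X.inr (phi_neg L v))"
    if c: "a \<in> carrier (pos_part L)" "b \<in> carrier (neg_part L)" "u \<in> carrier (pos_part L)" "v \<in> carrier (neg_part L)"
      and le: "pos_emb L a \<sqinter>\<^bsub>main_part L\<^esub> neg_emb L b \<sqsubseteq>\<^bsub>main_part L\<^esub> pos_emb L u \<squnion>\<^bsub>main_part L\<^esub> neg_emb L v" for a b u v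
  proof -
    have "phi_pos L a \<inter> phi_neg L b \<subseteq> phi_pos L u \<union> phi_neg L v"
    proof
      fix h assume h: "h \<in> phi_pos L a \<inter> phi_neg L b"
      then have hb: "h \<in> bpoints L" using c by (simp add: mem_phi)
      \<comment> \<open>The main component of the point \<open>h\<close> is what links its two
        halves: it carries the inequality in \<open>L\<close> to an implication between the truth
        values of \<open>h\<close>.\<close>
      from hb[unfolded bpoints_def] obtain k where k: "frame_map (main_part L) (main_part two_biframe) k"
        "\<And>a. a \<in> carrier (pos_part L) \<Longrightarrow> k (pos_emb L a) = pos_emb two_biframe (fst h a)"
        "\<And>b. b \<in> carrier (neg_part L) \<Longrightarrow> k (neg_emb L b) = neg_emb two_biframe (snd h b)"
        by (rule biframe_homE) (rule that)
      have k1: "frame_map (main_part L) two_frame k" using k(1) by simp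
      note cl = frame_map_closed[OF f c(1)] frame_map_closed[OF f c(3)]
        frame_map_closed[OF g c(2)] frame_map_closed[OF g c(4)]
      have "k (pos_emb L a \<sqinter>\<^bsub>main_part L\<^esub> neg_emb L b) \<sqsubseteq>\<^bsub>two_frame\<^esub> k (pos_emb L u \<squnion>\<^bsub>main_part L\<^esub> neg_emb L v)"
        by (rule frame_map_mono[OF C.frame_axioms two_frame k1 _ _ le]) (simp_all add: cl)
      then show "h \<in> phi_pos L u \<union> phi_neg L v"
        using h hb by (simp add: frame_map_meet[OF k1] frame_map_join[OF k1] cl two_frame_ops k(2,3) c mem_phi)
    qed
    then show ?thesis
      by (simp only: X.bOmega_fin_le_iff openin_phi c)
  qed
  obtain k where "frame_map (main_part L) X.Q k"
    and "\<And>a. a \<in> carrier (pos_part L) \<Longrightarrow> k (pos_emb L a) = X.q (X.inl (phi_pos L a))"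
    and "\<And>b. b \<in> carrier (neg_part L) \<Longrightarrow> k (neg_emb L b) = X.q (X.inr (phi_neg L b))"
  proof (rule finitary_extension[OF fin X.quotient_frame])
    show "frame_map (pos_part L) X.Q (\<lambda>a. X.q (X.inl (phi_pos L a)))"
      by (rule frame_map_comp[OF frame_map_phi_pos frame_map_comp[OF X.frame_map_inl X.frame_map_q]])
    show "frame_map (neg_part L) X.Q (\<lambda>b. X.q (X.inr (phi_neg L b)))"
      by (rule frame_map_comp[OF frame_map_phi_neg frame_map_comp[OF X.frame_map_inr X.frame_map_q]])
  qed (rule hyp, assumption+, rule that)
  then show ?thesis
    unfolding phi_def
    by (intro biframe_homI[where k = k]) (simp_all only: X.bOmega_fin_simps
        frame_map_phi_pos frame_map_phi_neg phi_extensional)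
qed

lemma bpt_map_apply: "h \<in> bpoints M \<Longrightarrow> bpt_map L M f h = biframe_comp L h f"
  by (simp add: bpt_map_def)

lemma bpt_map_bpoints:
  "\<lbrakk>f \<in> biframe_hom L M; h \<in> bpoints M\<rbrakk> \<Longrightarrow> bpt_map L M f h \<in> bpoints L"
  unfolding bpt_map_apply by (simp add: bpoints_def biframe_comp_hom)

text \<open>A precomposed point \<open>h \<circ> f\<close> holds at \<open>a\<close> exactly when
  \<open>h\<close> holds at the image of \<open>a\<close> under \<open>f\<close>. This gives both
  the continuity of \<open>bpt_map\<close> and the naturality of \<open>phi\<close>.\<close>

lemma bpt_map_preimage:
  assumes f: "f \<in> biframe_hom L M"
  shows "a \<in> carrier (pos_part L) \<Longrightarrow> {h \<in> bpoints M. bpt_map L M f h \<in> phi_pos L a} = phi_pos M (fst f a)"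
    and "b \<in> carrier (neg_part L) \<Longrightarrow> {h \<in> bpoints M. bpt_map L M f h \<in> phi_neg L b} = phi_neg M (snd f b)"
  using bpt_map_bpoints[OF f]
  by (auto simp: mem_phi biframe_hom_closed[OF f] bpt_map_apply)

lemma bpt_map_hom:
  assumes M: "M \<in> BiFrm" and f: "f \<in> biframe_hom L M"
  shows "bpt_map L M f \<in> bitop_hom (bpt M) (bpt L)"
proof -
  interpret M: biframe_struct M by unfold_locales fact
  have "continuous_map (pos_top (bpt M)) (pos_top (bpt L)) (bpt_map L M f)"
    "continuous_map (neg_top (bpt M)) (neg_top (bpt L)) (bpt_map L M f)"
    using bpt_map_bpoints[OF f]
    by (auto simp: continuous_map_def topspace_bpt M.topspace_bpt openin_bpt M.openin_bpt
        bpt_map_preimage[OF f] biframe_hom_closed[OF f])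
  then show ?thesis
    by (simp add: bitop_hom_def M.points_bpt bpt_map_def)
qed

end

section \<open>Functoriality, naturality and the triangle identities\<close>

lemma bOmega_fin_map_apply:
  "openin (pos_top Y) U \<Longrightarrow> fst (bOmega_fin_map X Y f) U = {x \<in> points X. f x \<in> U}"
  "openin (neg_top Y) V \<Longrightarrow> snd (bOmega_fin_map X Y f) V = {x \<in> points X. f x \<in> V}"
  by (simp_all add: bOmega_fin_map_def)

lemma bOmega_fin_map_extensional:
  "fst (bOmega_fin_map X Y f) \<in> extensional {U. openin (pos_top Y) U}"
  "snd (bOmega_fin_map X Y f) \<in> extensional {U. openin (neg_top Y) U}"
  by (simp_all add: bOmega_fin_map_def)

lemma carrier_bOmega_fin:
  "carrier (pos_part (bOmega_fin X)) = {U. openin (pos_top X) U}"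
  "carrier (neg_part (bOmega_fin X)) = {U. openin (neg_top X) U}"
  by (simp_all add: bOmega_fin_def)

lemma (in bispace_struct) openin_subset_points:
  "openin (pos_top X) U \<Longrightarrow> U \<subseteq> points X" "openin (neg_top X) U \<Longrightarrow> U \<subseteq> points X"
  using openin_subset by (fastforce simp: topspace_pos topspace_neg)+

lemma (in bispace_struct) bOmega_fin_map_id:
  "bOmega_fin_map X X (bitop_id X) = biframe_id (bOmega_fin X)"
proof -
  have "{x \<in> points X. bitop_id X x \<in> U} = U" if "U \<subseteq> points X" for U
    using that by (auto simp: bitop_id_def)
  then show ?thesis
    unfolding bOmega_fin_map_def biframe_id_def carrier_bOmega_fin
    by (auto intro!: restrict_ext dest!: openin_subset_points)
qed

lemma bitop_hom_preimage:
  assumes "X \<in> BiTop" "f \<in> bitop_hom X Y"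
  shows "openin (pos_top Y) U \<Longrightarrow> openin (pos_top X) {x \<in> points X. f x \<in> U}"
    and "openin (neg_top Y) U \<Longrightarrow> openin (neg_top X) {x \<in> points X. f x \<in> U}"
proof -
  interpret X: bispace_struct X by unfold_locales fact
  have c: "continuous_map (pos_top X) (pos_top Y) f" "continuous_map (neg_top X) (neg_top Y) f"
    using assms(2) by (auto simp: bitop_hom_def)
  show "openin (pos_top Y) U \<Longrightarrow> openin (pos_top X) {x \<in> points X. f x \<in> U}"
    using openin_continuous_map_preimage[OF c(1)] by (simp add: X.topspace_pos)
  show "openin (neg_top Y) U \<Longrightarrow> openin (neg_top X) {x \<in> points X. f x \<in> U}"
    using openin_continuous_map_preimage[OF c(2)] by (simp add: X.topspace_neg)
qed

lemma bitop_hom_points: "\<lbrakk>f \<in> bitop_hom X Y; x \<in> points X\<rbrakk> \<Longrightarrow> f x \<in> points Y"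
  unfolding bitop_hom_def points_def using continuous_map_funspace by fastforce

lemma bOmega_fin_map_comp:
  assumes "X \<in> BiTop" "Y \<in> BiTop" and f: "f \<in> bitop_hom X Y" and g: "g \<in> bitop_hom Y Z"
  shows "bOmega_fin_map X Z (bitop_comp X g f) =
    biframe_comp (bOmega_fin Z) (bOmega_fin_map X Y f) (bOmega_fin_map Y Z g)"
proof (rule biframe_comp_eqI[symmetric], unfold carrier_bOmega_fin mem_Collect_eq)
  show "fst (bOmega_fin_map X Y f) (fst (bOmega_fin_map Y Z g) U) = fst (bOmega_fin_map X Z (bitop_comp X g f)) U"
    if "openin (pos_top Z) U" for U
    using that bitop_hom_preimage(1)[OF assms(2) g that] bitop_hom_points[OF f]
    by (auto simp: bOmega_fin_map_apply bitop_comp_def compose_def)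
  show "snd (bOmega_fin_map X Y f) (snd (bOmega_fin_map Y Z g) U) = snd (bOmega_fin_map X Z (bitop_comp X g f)) U"
    if "openin (neg_top Z) U" for U
    using that bitop_hom_preimage(2)[OF assms(2) g that] bitop_hom_points[OF f]
    by (auto simp: bOmega_fin_map_apply bitop_comp_def compose_def)
qed (rule bOmega_fin_map_extensional)+

context biframe_struct
begin

lemma bpt_map_id: "bpt_map L L (biframe_id L) = bitop_id (bpt L)"
  unfolding bpt_map_def bitop_id_def points_bpt
proof (rule restrict_ext)
  fix h assume "h \<in> bpoints L"
  then show "biframe_comp L h (biframe_id L) = h"
    by (intro biframe_comp_eqI bpointsD) (simp_all add: biframe_id_def)
qed

lemma bpt_map_comp:
  assumes M: "M \<in> BiFrm" and N: "N \<in> BiFrm" and f: "f \<in> biframe_hom L M" and g: "g \<in> biframe_hom M N"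
  shows "bpt_map L N (biframe_comp L g f) = bitop_comp (bpt N) (bpt_map L M f) (bpt_map M N g)"
proof -
  interpret M: biframe_struct M by unfold_locales fact
  interpret N: biframe_struct N by unfold_locales fact
  show ?thesis
    unfolding bpt_map_def[of L N] bitop_comp_def N.points_bpt compose_def
  proof (rule restrict_ext)
    fix h assume h: "h \<in> bpoints N"
    have "biframe_comp L h (biframe_comp L g f) = biframe_comp L (biframe_comp M h g) f"
      by (rule biframe_comp_eqI)
        (simp_all add: biframe_hom_closed[OF f], simp_all add: biframe_comp_def)
    then show "biframe_comp L h (biframe_comp L g f) = bpt_map L M f (bpt_map M N g h)"
      using M.bpt_map_bpoints[OF g h] h by (simp add: bpt_map_apply M.bpt_map_apply)
  qed
qed

text \<open>On each part the square is \<open>bpt_map_preimage\<close> read from left to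
  right.\<close>

lemma phi_natural:
  assumes M: "M \<in> BiFrm" and f: "f \<in> biframe_hom L M"
  shows "biframe_comp L (bOmega_fin_map (bpt M) (bpt L) (bpt_map L M f)) (phi L) = biframe_comp L (phi M) f"
proof -
  interpret M: biframe_struct M by unfold_locales fact
  show ?thesis
    by (rule biframe_comp_eqI)
      (simp_all add: phi_def bOmega_fin_map_apply openin_phi M.points_bpt bpt_map_preimage[OF f],
        simp_all add: biframe_comp_def)
qed

text \<open>Evaluated at a positive \<open>a\<close>, the composite point asks whether
  \<open>h\<close> belongs to \<open>phi_pos L a\<close>, which is the truth value of
  \<open>h\<close> at \<open>a\<close>; likewise on the negative part.\<close>

lemma bpt_triangle:
  "bitop_comp (bpt L) (bpt_map L (bOmega_fin (bpt L)) (phi L)) (psi (bpt L)) = bitop_id (bpt L)"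
proof -
  interpret X: bispace_struct "bpt L" by unfold_locales (rule bpt_BiTop)
  show ?thesis
    unfolding bitop_comp_def compose_def bitop_id_def
  proof (rule restrict_ext)
    fix h assume h: "h \<in> points (bpt L)"
    have "biframe_comp L (psi (bpt L) h) (phi L) = h"
      using h by (intro biframe_comp_eqI)
        (simp_all add: points_bpt bpointsD psi_def phi_def openin_phi mem_phi)
    then show "bpt_map L (bOmega_fin (bpt L)) (phi L) (psi (bpt L) h) = h"
      by (simp add: bpt_map_apply X.psi_bpoints[OF h])
  qed
qed

end

context bispace_struct
begin

text \<open>The point \<open>psi X x\<close> holds at \<open>U\<close> exactly when
  \<open>x \<in> U\<close>. Since all opens of the bispace of points have the form
  \<open>phi_pos\<close> or \<open>phi_neg\<close>, this yields continuity of \<open>psi\<close> as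
  well as the triangle identity on \<open>bOmega_fin X\<close>.\<close>

lemma psi_preimage:
  "openin (pos_top X) U \<Longrightarrow> {x \<in> points X. psi X x \<in> phi_pos (bOmega_fin X) U} = U"
  "openin (neg_top X) U \<Longrightarrow> {x \<in> points X. psi X x \<in> phi_neg (bOmega_fin X) U} = U"
  using psi_bpoints openin_subset_points[of U]
  by (auto simp: mem_phi carrier_bOmega_fin psi_def)

lemma psi_hom: "psi X \<in> bitop_hom X (bpt (bOmega_fin X))"
proof -
  have "continuous_map (pos_top X) (pos_top (bpt (bOmega_fin X))) (psi X)"
    "continuous_map (neg_top X) (neg_top (bpt (bOmega_fin X))) (psi X)"
    using psi_bpoints
    by (auto simp: continuous_map_def bO.topspace_bpt bO.openin_bpt carrier_bOmega_fin
        topspace_pos topspace_neg psi_preimage)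
  then show ?thesis by (simp add: bitop_hom_def psi_def)
qed

lemma bOmega_fin_triangle:
  "biframe_comp (bOmega_fin X) (bOmega_fin_map X (bpt (bOmega_fin X)) (psi X)) (phi (bOmega_fin X)) =
    biframe_id (bOmega_fin X)"
proof -
  have "openin (pos_top (bpt (bOmega_fin X))) (phi_pos (bOmega_fin X) U)" if "openin (pos_top X) U" for U
    using bO.openin_phi(1)[of U] that by (simp add: carrier_bOmega_fin)
  moreover have "openin (neg_top (bpt (bOmega_fin X))) (phi_neg (bOmega_fin X) U)" if "openin (neg_top X) U" for U
    using bO.openin_phi(2)[of U] that by (simp add: carrier_bOmega_fin)
  ultimately show ?thesis
    by (intro biframe_comp_eqI)
      (simp_all add: biframe_id_def carrier_bOmega_fin phi_def bOmega_fin_map_apply psi_preimage)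
qed

end

text \<open>At an open \<open>U\<close> of \<open>Y\<close>, both composites return the truth value
  of \<open>f x \<in> U\<close>.\<close>

lemma psi_natural:
  assumes "X \<in> BiTop" "Y \<in> BiTop" and f: "f \<in> bitop_hom X Y"
  shows "bitop_comp X (bpt_map (bOmega_fin Y) (bOmega_fin X) (bOmega_fin_map X Y f)) (psi X) =
    bitop_comp X (psi Y) f"
proof -
  interpret X: bispace_struct X by unfold_locales fact
  interpret Y: bispace_struct Y by unfold_locales fact
  show ?thesis
    unfolding bitop_comp_def compose_def
  proof (rule restrict_ext)
    fix x assume x: "x \<in> points X"
    have "biframe_comp (bOmega_fin Y) (psi X x) (bOmega_fin_map X Y f) = psi Y (f x)"
      using x bitop_hom_preimage[OF assms(1) f] bitop_hom_points[OF f x]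
      by (intro biframe_comp_eqI) (simp_all add: carrier_bOmega_fin bOmega_fin_map_apply psi_def)
    then show "bpt_map (bOmega_fin Y) (bOmega_fin X) (bOmega_fin_map X Y f) (psi X x) = psi Y (f x)"
      by (simp add: Y.bO.bpt_map_apply X.psi_bpoints[OF x])
  qed
qed

lemma bispace_structI: "X \<in> BiTop \<Longrightarrow> bispace_struct X"
  by (rule bispace_struct.intro)

lemma biframe_structI: "L \<in> BiFrm_fin \<Longrightarrow> biframe_struct L"
  by (rule biframe_struct.intro) (simp add: BiFrm_fin_def)

lemma BiFrm_fin_BiFrm: "L \<in> BiFrm_fin \<Longrightarrow> L \<in> BiFrm"
  by (simp add: BiFrm_fin_def)

text \<open>The adjunction is spelled out as two functors with a unit, a counit and the triangle
  identities. Arrows of the opposite category are written as biframe maps, so the counit appears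
  reversed, from \<open>L\<close> to \<open>bOmega_fin (bpt L)\<close>. The objects range over
  independent types because the functors change the types of points and of frame elements.\<close>

theorem theorem3p11:
  shows
    "(\<comment> \<open>\<open>bOmega_fin\<close> is a functor from bispaces to the opposite of finitary biframes\<close>
      (\<forall>X \<in> (BiTop :: 'x bispace set). bOmega_fin X \<in> BiFrm_fin) \<and>
      (\<forall>X \<in> (BiTop :: 'x bispace set). \<forall>Y \<in> (BiTop :: 'y bispace set). \<forall>f \<in> bitop_hom X Y.
         bOmega_fin_map X Y f \<in> biframe_hom (bOmega_fin Y) (bOmega_fin X)) \<and>
      (\<forall>X \<in> (BiTop :: 'x bispace set).
         bOmega_fin_map X X (bitop_id X) = biframe_id (bOmega_fin X)) \<and>
      (\<forall>X \<in> (BiTop :: 'x bispace set). \<forall>Y \<in> (BiTop :: 'y bispace set).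
       \<forall>Z \<in> (BiTop :: 'z bispace set). \<forall>f \<in> bitop_hom X Y. \<forall>g \<in> bitop_hom Y Z.
         bOmega_fin_map X Z (bitop_comp X g f) =
         biframe_comp (bOmega_fin Z) (bOmega_fin_map X Y f) (bOmega_fin_map Y Z g)))
   \<and> (\<comment> \<open>\<open>bpt\<close> is a functor from the opposite of finitary biframes to bispaces\<close>
      (\<forall>L \<in> (BiFrm_fin :: ('p, 'n, 'm) biframe set). bpt L \<in> BiTop) \<and>
      (\<forall>L \<in> (BiFrm_fin :: ('p, 'n, 'm) biframe set).
       \<forall>M \<in> (BiFrm_fin :: ('p1, 'n1, 'm1) biframe set). \<forall>f \<in> biframe_hom L M.
         bpt_map L M f \<in> bitop_hom (bpt M) (bpt L)) \<and>
      (\<forall>L \<in> (BiFrm_fin :: ('p, 'n, 'm) biframe set).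
         bpt_map L L (biframe_id L) = bitop_id (bpt L)) \<and>
      (\<forall>L \<in> (BiFrm_fin :: ('p, 'n, 'm) biframe set).
       \<forall>M \<in> (BiFrm_fin :: ('p1, 'n1, 'm1) biframe set).
       \<forall>N \<in> (BiFrm_fin :: ('p2, 'n2, 'm2) biframe set).
       \<forall>f \<in> biframe_hom L M. \<forall>g \<in> biframe_hom M N.
         bpt_map L N (biframe_comp L g f) =
         bitop_comp (bpt N) (bpt_map L M f) (bpt_map M N g)))
   \<and> (\<comment> \<open>\<open>psi\<close> is natural from the identity to \<open>bpt\<close> after \<open>bOmega_fin\<close>\<close>
      (\<forall>X \<in> (BiTop :: 'x bispace set). psi X \<in> bitop_hom X (bpt (bOmega_fin X))) \<and>
      (\<forall>X \<in> (BiTop :: 'x bispace set). \<forall>Y \<in> (BiTop :: 'y bispace set). \<forall>f \<in> bitop_hom X Y.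
         bitop_comp X (bpt_map (bOmega_fin Y) (bOmega_fin X) (bOmega_fin_map X Y f)) (psi X) =
         bitop_comp X (psi Y) f))
   \<and> (\<comment> \<open>\<open>phi\<close> is natural, in biframes from the identity to \<open>bOmega_fin\<close> after \<open>bpt\<close>\<close>
      (\<forall>L \<in> (BiFrm_fin :: ('p, 'n, 'm) biframe set). phi L \<in> biframe_hom L (bOmega_fin (bpt L))) \<and>
      (\<forall>L \<in> (BiFrm_fin :: ('p, 'n, 'm) biframe set).
       \<forall>M \<in> (BiFrm_fin :: ('p1, 'n1, 'm1) biframe set). \<forall>f \<in> biframe_hom L M.
         biframe_comp L (bOmega_fin_map (bpt M) (bpt L) (bpt_map L M f)) (phi L) =
         biframe_comp L (phi M) f))
   \<and> (\<comment> \<open>triangle identities, the first one written in biframes\<close>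
      (\<forall>X \<in> (BiTop :: 'x bispace set).
         biframe_comp (bOmega_fin X)
           (bOmega_fin_map X (bpt (bOmega_fin X)) (psi X)) (phi (bOmega_fin X)) =
         biframe_id (bOmega_fin X)) \<and>
      (\<forall>L \<in> (BiFrm_fin :: ('p, 'n, 'm) biframe set).
         bitop_comp (bpt L) (bpt_map L (bOmega_fin (bpt L)) (phi L)) (psi (bpt L)) =
         bitop_id (bpt L)))"
  by (intro conjI ballI; rule bispace_struct.bOmega_fin_BiFrm_fin[OF bispace_structI]
      bOmega_fin_map_hom bispace_struct.bOmega_fin_map_id[OF bispace_structI]
      bOmega_fin_map_comp biframe_struct.bpt_BiTop[OF biframe_structI]
      biframe_struct.bpt_map_hom[OF biframe_structI]
      biframe_struct.bpt_map_id[OF biframe_structI]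
      biframe_struct.bpt_map_comp[OF biframe_structI]
      bispace_struct.psi_hom[OF bispace_structI] psi_natural
      biframe_struct.phi_hom[OF biframe_structI]
      biframe_struct.phi_natural[OF biframe_structI]
      bispace_struct.bOmega_fin_triangle[OF bispace_structI]
      biframe_struct.bpt_triangle[OF biframe_structI];
      (assumption | erule BiFrm_fin_BiFrm))

end
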